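(* Let $S$ be a TBRSC of dimension $2$. Then (i) the homology groups of $S$ are free abelian; and (ii) the geometric realization of $S$ has the homotopy type of a wedge of 1-spheres and 2-spheres.
   Context: A (finite) simplicial complex is a pair $S=(V,\mathcal{H})$ where $V$ is a finite nonempty set and $\mathcal{H}\subseteq 2^V$ contains all singletons and is closed under taking subsets; its dimension is $\max\{|I|:I\in\mathcal{H}\}-1$. $P_{\leq n}(V)$ is the set of subsets of $V$ of size at most $n$. $S$ is boolean representable (BRSC) if there is a boolean matrix $M$ with columns indexed by $V$ such that $\mathcal{H}$ is exactly the set of $X\subseteq V$ for which some square submatrix with column set $X$ is congruent (by permuting rows and columns) to a lower unitriangular boolean matrix. For $k\geq 1$, $T_k(S)=(V,\mathcal{H}\cap P_{\leq k}(V))$; $S$ is a TBRSC if $S=T_k(S')$ for some BRSC $S'$ and $k\geq 1$. Homology refers to simplicial homology of $S$. *)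

theory Defs
  imports "HOL-Homology.Homology"
begin

section \<open>Abstract simplicial complexes\<close>

type_synonym 'a abs_complex = "'a set \<times> 'a set set"

abbreviation verts :: "'a abs_complex \<Rightarrow> 'a set" where "verts \<equiv> fst"

abbreviation faces :: "'a abs_complex \<Rightarrow> 'a set set" where "faces \<equiv> snd"

definition is_abs_complex :: "'a abs_complex \<Rightarrow> bool" where
  "is_abs_complex S \<longleftrightarrow>
     finite (verts S) \<and> verts S \<noteq> {} \<and> faces S \<subseteq> Pow (verts S) \<and>
     (\<forall>v\<in>verts S. {v} \<in> faces S) \<and> (\<forall>I\<in>faces S. \<forall>J\<subseteq>I. J \<in> faces S)"

definition complex_dim :: "'a abs_complex \<Rightarrow> int" where
  "complex_dim S = int (Max (card ` faces S)) - 1"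

section \<open>Boolean representability and truncations\<close>

text \<open>Boolean matrices are functions to \<^typ>\<open>bool\<close>, with \<^const>\<open>True\<close> for the entry 1.\<close>

definition lower_unitriangular :: "nat \<Rightarrow> (nat \<Rightarrow> nat \<Rightarrow> bool) \<Rightarrow> bool" where
  "lower_unitriangular n A \<longleftrightarrow> (\<forall>i<n. A i i) \<and> (\<forall>i j. i < j \<and> j < n \<longrightarrow> \<not> A i j)"

text \<open>The submatrix of \<open>M\<close> with row set \<open>R\<close> and column set \<open>X\<close> is square and congruent to a lower
  unitriangular matrix; \<open>r\<close> and \<open>c\<close> list its rows and columns in the permuted order.
  The empty submatrix qualifies.\<close>

definition congruent_lower_unitriangular ::
    "('r \<Rightarrow> 'a \<Rightarrow> bool) \<Rightarrow> 'r set \<Rightarrow> 'a set \<Rightarrow> bool" where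
  "congruent_lower_unitriangular M R X \<longleftrightarrow>
     (\<exists>n r c. bij_betw r {..<n} R \<and> bij_betw c {..<n} X \<and>
              lower_unitriangular n (\<lambda>i j. M (r i) (c j)))"

definition BRSC :: "'a abs_complex \<Rightarrow> bool" where
  "BRSC S \<longleftrightarrow> is_abs_complex S \<and>
     (\<exists>m (M :: nat \<Rightarrow> 'a \<Rightarrow> bool).
        faces S = {X. X \<subseteq> verts S \<and> (\<exists>R\<subseteq>{..<m}. congruent_lower_unitriangular M R X)})"

definition truncation :: "nat \<Rightarrow> 'a abs_complex \<Rightarrow> 'a abs_complex" where
  "truncation k S = (verts S, faces S \<inter> {X. X \<subseteq> verts S \<and> card X \<le> k})"

definition TBRSC :: "'a abs_complex \<Rightarrow> bool" where
  "TBRSC S \<longleftrightarrow> (\<exists>S' k. BRSC S' \<and> 1 \<le> k \<and> S = truncation k S')"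

section \<open>Simplicial homology\<close>

text \<open>Each face is oriented by a linear order \<open>r\<close> on the vertices, so the chain groups are
  free on the faces themselves. In the boundary of \<open>I\<close>, the face omitting \<open>v\<close> has sign
  \<open>(-1) ^ i\<close>, where \<open>v\<close> is the \<open>i\<close>-th vertex of \<open>I\<close> with respect to \<open>r\<close>, counting from 0.\<close>

definition face_chain_group :: "'a abs_complex \<Rightarrow> nat \<Rightarrow> ('a set \<Rightarrow>\<^sub>0 int) monoid" where
  "face_chain_group S p = free_Abelian_group {I \<in> faces S. card I = Suc p}"

definition face_boundary :: "'a rel \<Rightarrow> nat \<Rightarrow> ('a set \<Rightarrow>\<^sub>0 int) \<Rightarrow> ('a set \<Rightarrow>\<^sub>0 int)" where
  "face_boundary r p c =
     (if p = 0 then 0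
      else frag_extend
        (\<lambda>I. \<Sum>v\<in>I. frag_cmul ((-1) ^ card {w \<in> I. w \<noteq> v \<and> (w, v) \<in> r}) (frag_of (I - {v}))) c)"

definition simplicial_homology_group ::
    "'a rel \<Rightarrow> 'a abs_complex \<Rightarrow> nat \<Rightarrow> ('a set \<Rightarrow>\<^sub>0 int) set monoid" where
  "simplicial_homology_group r S p =
     subgroup_generated (face_chain_group S p)
        {c \<in> carrier (face_chain_group S p). face_boundary r p c = 0}
     Mod (face_boundary r (Suc p) ` carrier (face_chain_group S (Suc p)))"

text \<open>Taking the basis inside the carrier of \<open>G\<close> loses no generality.\<close>

definition is_free_abelian :: "('g, 'm) monoid_scheme \<Rightarrow> bool" where
  "is_free_abelian G \<longleftrightarrow> comm_group G \<and> (\<exists>B\<subseteq>carrier G. G \<cong> free_Abelian_group B)"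

section \<open>Geometric realization\<close>

text \<open>Points are given by barycentric coordinates, extended by 0 outside the vertex set. For
  finite complexes the subspace topology is the usual one.\<close>

definition geometric_realization :: "'a abs_complex \<Rightarrow> ('a \<Rightarrow> real) topology" where
  "geometric_realization S =
     subtopology (powertop_real UNIV)
       {x. (\<forall>v. 0 \<le> x v) \<and> {v. x v \<noteq> 0} \<in> faces S \<and> (\<Sum>v\<in>verts S. x v) = 1}"

section \<open>Wedges of spheres\<close>

text \<open>The wedge of the pointed spaces \<open>(X i, b i)\<close> is the quotient of their disjoint union
  identifying all base points; \<^const>\<open>None\<close> is the common base point. It is always included, so
  that the empty wedge is a point.\<close>

definition wedge_incl :: "('i \<Rightarrow> 'b) \<Rightarrow> 'i \<Rightarrow> 'b \<Rightarrow> ('i \<times> 'b) option" where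
  "wedge_incl b i x = (if x = b i then None else Some (i, x))"

definition wedge :: "'i set \<Rightarrow> ('i \<Rightarrow> 'b topology) \<Rightarrow> ('i \<Rightarrow> 'b) \<Rightarrow> ('i \<times> 'b) option topology" where
  "wedge I X b = topology (\<lambda>U.
     U \<subseteq> insert None (\<Union>i\<in>I. wedge_incl b i ` topspace (X i)) \<and>
     (\<forall>i\<in>I. openin (X i) {x \<in> topspace (X i). wedge_incl b i x \<in> U}))"

lemma openin_wedge:
  "openin (wedge I X b) U \<longleftrightarrow>
     U \<subseteq> insert None (\<Union>i\<in>I. wedge_incl b i ` topspace (X i)) \<and>
     (\<forall>i\<in>I. openin (X i) {x \<in> topspace (X i). wedge_incl b i x \<in> U})"
proof -
  let ?T = "\<lambda>U. U \<subseteq> insert None (\<Union>i\<in>I. wedge_incl b i ` topspace (X i)) \<and>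
     (\<forall>i\<in>I. openin (X i) {x \<in> topspace (X i). wedge_incl b i x \<in> U})"
  have "istopology ?T"
    unfolding istopology_def
  proof (intro conjI allI impI)
    fix U V assume U: "?T U" and V: "?T V"
    show "U \<inter> V \<subseteq> insert None (\<Union>i\<in>I. wedge_incl b i ` topspace (X i))"
      using U by blast
    show "\<forall>i\<in>I. openin (X i) {x \<in> topspace (X i). wedge_incl b i x \<in> U \<inter> V}"
    proof
      fix i assume "i \<in> I"
      then have "openin (X i) ({x \<in> topspace (X i). wedge_incl b i x \<in> U}
                   \<inter> {x \<in> topspace (X i). wedge_incl b i x \<in> V})"
        using U V by blast
      moreover have "{x \<in> topspace (X i). wedge_incl b i x \<in> U}
          \<inter> {x \<in> topspace (X i). wedge_incl b i x \<in> V}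
          = {x \<in> topspace (X i). wedge_incl b i x \<in> U \<inter> V}" by blast
      ultimately show "openin (X i) {x \<in> topspace (X i). wedge_incl b i x \<in> U \<inter> V}" by simp
    qed
  next
    fix \<K> assume K: "\<forall>K\<in>\<K>. ?T K"
    show "\<Union>\<K> \<subseteq> insert None (\<Union>i\<in>I. wedge_incl b i ` topspace (X i))"
      using K by blast
    show "\<forall>i\<in>I. openin (X i) {x \<in> topspace (X i). wedge_incl b i x \<in> \<Union>\<K>}"
    proof
      fix i assume "i \<in> I"
      then have "openin (X i) (\<Union>K\<in>\<K>. {x \<in> topspace (X i). wedge_incl b i x \<in> K})"
        using K by blast
      moreover have "(\<Union>K\<in>\<K>. {x \<in> topspace (X i). wedge_incl b i x \<in> K})
          = {x \<in> topspace (X i). wedge_incl b i x \<in> \<Union>\<K>}" by blast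
      ultimately show "openin (X i) {x \<in> topspace (X i). wedge_incl b i x \<in> \<Union>\<K>}" by simp
    qed
  qed
  then show ?thesis
    by (simp add: wedge_def topology_inverse')
qed

lemma topspace_wedge:
  "topspace (wedge I X b) = insert None (\<Union>i\<in>I. wedge_incl b i ` topspace (X i))"
proof -
  let ?W = "insert None (\<Union>i\<in>I. wedge_incl b i ` topspace (X i))"
  have "{x \<in> topspace (X i). wedge_incl b i x \<in> ?W} = topspace (X i)" if "i \<in> I" for i
    using that by auto
  then have "openin (wedge I X b) ?W"
    unfolding openin_wedge by simp
  moreover have "topspace (wedge I X b) \<subseteq> ?W"
    using openin_wedge[THEN iffD1, OF openin_topspace] by (rule conjunct1)
  ultimately show ?thesis
    by (intro subset_antisym openin_subset)
qed

lemma quotient_map_wedge: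
  assumes "I \<noteq> {}" and "\<And>i. i \<in> I \<Longrightarrow> b i \<in> topspace (X i)"
  shows "quotient_map (sum_topology X I) (wedge I X b) (\<lambda>(i, x). wedge_incl b i x)"
proof -
  have "None \<in> (\<Union>i\<in>I. wedge_incl b i ` topspace (X i))"
    using assms by (force simp: wedge_incl_def)
  then have top: "topspace (wedge I X b) = (\<Union>i\<in>I. wedge_incl b i ` topspace (X i))"
    by (simp add: topspace_wedge insert_absorb)
  have "(\<lambda>(i, x). wedge_incl b i x) ` topspace (sum_topology X I) = topspace (wedge I X b)"
    unfolding top topspace_sum_topology by force
  moreover have "openin (sum_topology X I)
      {y \<in> topspace (sum_topology X I). (case y of (i, x) \<Rightarrow> wedge_incl b i x) \<in> U}
      = openin (wedge I X b) U" if "U \<subseteq> topspace (wedge I X b)" for U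
  proof -
    have "{x. (i, x) \<in> {y \<in> topspace (sum_topology X I).
             (case y of (i, x) \<Rightarrow> wedge_incl b i x) \<in> U}}
        = {x \<in> topspace (X i). wedge_incl b i x \<in> U}" if "i \<in> I" for i
      using that by (auto simp: topspace_sum_topology)
    moreover have "{y \<in> topspace (sum_topology X I). (case y of (i, x) \<Rightarrow> wedge_incl b i x) \<in> U}
        \<subseteq> Sigma I (topspace \<circ> X)"
      by (auto simp: topspace_sum_topology)
    ultimately show ?thesis
      using that unfolding openin_sum_topology openin_wedge topspace_wedge by simp
  qed
  ultimately show ?thesis
    unfolding quotient_map_def by (intro conjI allI impI)
qed

definition sphere_base :: "nat \<Rightarrow> real" where
  "sphere_base = (\<lambda>i. if i = 0 then 1 else 0)"

lemma sphere_base_in_nsphere: "sphere_base \<in> topspace (nsphere n)"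
proof -
  have "(\<Sum>i\<le>n. (sphere_base i)\<^sup>2) = (\<Sum>i\<le>n. if i = 0 then 1 else 0 :: real)"
    by (rule sum.cong) (auto simp: sphere_base_def)
  then have "(\<Sum>i\<le>n. (sphere_base i)\<^sup>2) = 1"
    by simp
  then show ?thesis
    by (simp add: nsphere sphere_base_def)
qed

text \<open>The sphere with index \<open>i\<close> has dimension \<open>d i\<close>.\<close>

definition wedge_of_spheres :: "'i set \<Rightarrow> ('i \<Rightarrow> nat) \<Rightarrow> ('i \<times> (nat \<Rightarrow> real)) option topology" where
  "wedge_of_spheres I d = wedge I (\<lambda>i. nsphere (d i)) (\<lambda>i. sphere_base)"

end

theory Submission
  imports Defs
begin

text \<open>Call the zero sets of the rows of the matrix flats. Two vertices form an edge iff some flat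
  separates them, and an edge forms a triangle with a third vertex if some flat contains the edge
  but not that vertex. Choose a maximal family of flats such that the edges lying in a proper flat
  of the family form a disconnected graph, and a spanning tree consisting of shortest paths to a
  root in each component and of edges joining the other roots to one of them. Every edge outside the
  tree, except possibly some edges between roots, bounds a triangle whose other two edges precede
  it in a suitable order, so adding that edge together with that triangle preserves the homotopy
  type. The remaining edges between roots contribute 1-spheres. Transport to the roots along the
  tree shows that the boundary of every remaining triangle is null-homotopic, so that such a
  triangle contributes a 2-sphere. Homology is free because the same construction embeds the first
  homology group into a free group.\<close>

section \<open>Attaching cones\<close>

text \<open>A triangle glued along an essential loop could create torsion, so every triangle must
  either be collapsed together with a new edge or be glued along a null-homotopic boundary.
  Disconnectedness of the graph yields the collapses: a flat of the family through an edge of one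
  component contains no vertex of another, since such a vertex would be adjacent, within that flat,
  to an end of the edge. Hence an edge of the graph spans a triangle with every vertex of every
  other component. Maximality settles the edges between roots. If no flat is left over, every
  triangle has two vertices in one component, no triangle joins three roots, and the root edges off
  the tree survive as 1-spheres. Otherwise some further flat connects the graph and therefore meets
  all components. With one root outside this flat and the others inside it, an edge between two of
  the others spans a triangle with the exceptional root, and no 1-sphere arises. In the first case
  the transported boundary of a triangle degenerates; in the second it is coned off from the
  exceptional root.\<close>

abbreviation unit_interval :: "real topology" where
  "unit_interval \<equiv> top_of_set {0..1}"

lemma compact_unit_interval: "compact_space unit_interval"
  by (simp add: compact_space_subtopology)

text \<open>Closed subsets of the compact \<open>T\<close> have compact, hence closed, images in the
  Hausdorff space \<open>X\<close>, so the preimage of a closed set is a union of two closed sets.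
  In effect \<open>X\<close> is a quotient of the disjoint union of \<open>B\<close> and
  \<open>T\<close>, without any quotient topology being formed.\<close>

lemma continuous_map_glue_compact:
  assumes haus: "Hausdorff_space X" and clo: "closedin X B" and comp: "compact_space T"
    and c: "continuous_map T X c" and top: "topspace X \<subseteq> B \<union> c ` topspace T"
    and gB: "continuous_map (subtopology X B) Z g" and gc: "continuous_map T Z (g \<circ> c)"
  shows "continuous_map X Z g"
  unfolding continuous_map_closedin
proof (intro conjI allI impI)
  have BX: "B \<subseteq> topspace X"
    using clo closedin_subset by blast
  have B: "g x \<in> topspace Z" if "x \<in> B" for x
    using gB that BX by (auto simp: continuous_map_def Pi_iff)
  have T: "g (c t) \<in> topspace Z" if "t \<in> topspace T" for t
    using gc that by (auto simp: continuous_map_def Pi_iff)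
  show "g \<in> topspace X \<rightarrow> topspace Z"
    using B T top by blast
  fix D assume D: "closedin Z D"
  have "closedin (subtopology X B) {x \<in> topspace (subtopology X B). g x \<in> D}"
    using gB D by (rule closedin_continuous_map_preimage)
  then have "closedin X {x \<in> topspace (subtopology X B). g x \<in> D}"
    using clo by (rule closedin_trans_full)
  then have 1: "closedin X {x \<in> B. g x \<in> D}"
    using BX by (simp add: Int_absorb1)
  have "closedin T {t \<in> topspace T. (g \<circ> c) t \<in> D}"
    using gc D by (rule closedin_continuous_map_preimage)
  then have "compactin T {t \<in> topspace T. g (c t) \<in> D}"
    using comp closedin_compact_space by fastforce
  then have "compactin X (c ` {t \<in> topspace T. g (c t) \<in> D})"
    using c image_compactin by blast
  then have 2: "closedin X (c ` {t \<in> topspace T. g (c t) \<in> D})"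
    using haus compactin_imp_closedin by blast
  have "{x \<in> topspace X. g x \<in> D} = {x \<in> B. g x \<in> D} \<union> c ` {t \<in> topspace T. g (c t) \<in> D}"
    using top BX c by (auto simp: continuous_map_def)
  then show "closedin X {x \<in> topspace X. g x \<in> D}"
    using 1 2 by (simp add: closedin_Un)
qed

text \<open>\<open>X\<close> is the closed subspace \<open>B\<close> with a cone over \<open>A\<close> attached along \<open>\<lambda>a. c (0, a)\<close>; the
  points \<open>c (1, a)\<close> all coincide with the apex.\<close>

locale cone_attachment =
  fixes X :: "'x topology" and B :: "'x set" and A :: "'a topology" and c :: "real \<times> 'a \<Rightarrow> 'x"
  assumes Hausdorff_total: "Hausdorff_space X"
    and closed_base: "closedin X B"
    and compact_A: "compact_space A"
    and continuous_cone: "continuous_map (prod_topology unit_interval A) X c"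
    and cone_0: "a \<in> topspace A \<Longrightarrow> c (0, a) \<in> B"
    and total_subset: "topspace X \<subseteq> B \<union> c ` ({0<..1} \<times> topspace A)"
    and cone_notin: "a \<in> topspace A \<Longrightarrow> 0 < s \<Longrightarrow> s \<le> 1 \<Longrightarrow> c (s, a) \<notin> B"
    and cone_inj: "a \<in> topspace A \<Longrightarrow> a' \<in> topspace A \<Longrightarrow> 0 < s \<Longrightarrow> s \<le> 1 \<Longrightarrow> 0 < s' \<Longrightarrow> s' \<le> 1 \<Longrightarrow>
           c (s, a) = c (s', a') \<Longrightarrow> s = s' \<and> (s = 1 \<or> a = a')"
    and cone_1: "a \<in> topspace A \<Longrightarrow> a' \<in> topspace A \<Longrightarrow> c (1, a) = c (1, a')"
begin

lemma base_subset: "B \<subseteq> topspace X"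
  using closed_base closedin_subset by blast

lemma total_cases:
  assumes "x \<in> topspace X"
  obtains "x \<in> B" | s a where "0 < s" "s \<le> 1" "a \<in> topspace A" "x = c (s, a)"
  using assms total_subset by fastforce

text \<open>The product of \<open>unit_interval\<close> with a closed base is closed and its product
  with a compact cone is compact, so the gluing lemma applies to the cylinder over \<open>X\<close>
  directly and products of quotient maps never come up.\<close>

lemma homotopy_extend:
  assumes u: "continuous_map (prod_topology unit_interval (subtopology X B)) Z u"
    and v: "continuous_map (prod_topology unit_interval (prod_topology unit_interval A)) Z v"
    and v0: "\<And>t a. 0 \<le> t \<Longrightarrow> t \<le> 1 \<Longrightarrow> a \<in> topspace A \<Longrightarrow> v (t, 0, a) = u (t, c (0, a))"
    and v1: "\<And>t a a'. 0 \<le> t \<Longrightarrow> t \<le> 1 \<Longrightarrow> a \<in> topspace A \<Longrightarrow> a' \<in> topspace A \<Longrightarrow>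
               v (t, 1, a) = v (t, 1, a')"
  obtains g where "continuous_map (prod_topology unit_interval X) Z g"
    and "\<And>t x. 0 \<le> t \<Longrightarrow> t \<le> 1 \<Longrightarrow> x \<in> B \<Longrightarrow> g (t, x) = u (t, x)"
    and "\<And>t s a. 0 \<le> t \<Longrightarrow> t \<le> 1 \<Longrightarrow> 0 \<le> s \<Longrightarrow> s \<le> 1 \<Longrightarrow> a \<in> topspace A \<Longrightarrow>
           g (t, c (s, a)) = v (t, s, a)"
proof -
  \<comment> \<open>Cone coordinates are unique below the apex. At the apex only
    \<open>s = 1\<close> is determined, and \<open>v1\<close> makes the choice of \<open>a\<close>
    harmless.\<close>
  define pt where "pt x = (SOME y. y \<in> {0<..1} \<times> topspace A \<and> c y = x)" for x
  define g where "g = (\<lambda>(t, x). if x \<in> B then u (t, x) else v (t, pt x))"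
  have gB: "g (t, x) = u (t, x)" if "x \<in> B" for t x
    using that by (simp add: g_def)
  have gc: "g (t, c (s, a)) = v (t, s, a)"
    if "0 \<le> t" "t \<le> 1" "0 \<le> s" "s \<le> 1" "a \<in> topspace A" for t s a
  proof (cases "s = 0")
    case True
    then show ?thesis using that by (simp add: gB cone_0 v0)
  next
    case False
    then have s: "0 < s" using that by simp
    let ?x = "c (s, a)"
    have "pt ?x \<in> {0<..1} \<times> topspace A \<and> c (pt ?x) = ?x"
      unfolding pt_def by (rule someI[of _ "(s, a)"]) (use that s in auto)
    then obtain s' a' where p: "pt ?x = (s', a')" "0 < s'" "s' \<le> 1" "a' \<in> topspace A"
      "c (s', a') = ?x"
      by (cases "pt ?x") auto
    then have "s' = s \<and> (s' = 1 \<or> a' = a)"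
      using cone_inj[of a' a s' s] that s by auto
    moreover have "?x \<notin> B" using cone_notin that s by blast
    ultimately show ?thesis
      using p that v1[of t a' a] by (auto simp: g_def)
  qed
  have "continuous_map (prod_topology unit_interval X) Z g"
  proof (rule continuous_map_glue_compact)
    let ?c = "\<lambda>(t, y). (t, c y)"
    show "Hausdorff_space (prod_topology unit_interval X)"
      by (simp add: Hausdorff_space_prod_topology Hausdorff_total Hausdorff_space_subtopology)
    show "closedin (prod_topology unit_interval X) ({0..1} \<times> B)"
      by (simp add: closedin_prod_Times_iff closed_base)
    show "compact_space (prod_topology unit_interval (prod_topology unit_interval A))"
      by (simp add: compact_space_prod_topology compact_A compact_unit_interval)
    show "continuous_map (prod_topology unit_interval (prod_topology unit_interval A))
            (prod_topology unit_interval X) ?c"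
      unfolding case_prod_beta
      by (intro continuous_map_pairedI continuous_map_fst
          continuous_map_compose[OF continuous_map_snd continuous_cone, unfolded o_def])
    show "topspace (prod_topology unit_interval X) \<subseteq> {0..1} \<times> B \<union>
        ?c ` topspace (prod_topology unit_interval (prod_topology unit_interval A))"
    proof
      fix z assume "z \<in> topspace (prod_topology unit_interval X)"
      then obtain t x where z: "z = (t, x)" "t \<in> {0..1}" "x \<in> topspace X" by auto
      from z(3) show "z \<in> {0..1} \<times> B \<union>
        ?c ` topspace (prod_topology unit_interval (prod_topology unit_interval A))"
      proof (cases rule: total_cases)
        case 1 then show ?thesis using z by auto
      next
        case (2 s a)
        then have "z = ?c (t, s, a)" using z by simp
        moreover have "(t, s, a) \<in> topspace (prod_topology unit_interval (prod_topology unit_interval A))"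
          using 2 z by auto
        ultimately show ?thesis by blast
      qed
    qed
    have "subtopology (prod_topology unit_interval X) ({0..1} \<times> B)
        = prod_topology unit_interval (subtopology X B)"
      by (simp add: subtopology_Times subtopology_subtopology)
    then show "continuous_map (subtopology (prod_topology unit_interval X) ({0..1} \<times> B)) Z g"
      using gB by (auto intro: continuous_map_eq[OF u])
    show "continuous_map (prod_topology unit_interval (prod_topology unit_interval A)) Z (g \<circ> ?c)"
      by (rule continuous_map_eq[OF v]) (auto simp: gc)
  qed
  then show ?thesis
    using that gB gc by blast
qed

lemma map_extend:
  assumes u: "continuous_map (subtopology X B) Z u"
    and v: "continuous_map (prod_topology unit_interval A) Z v"
    and v0: "\<And>a. a \<in> topspace A \<Longrightarrow> v (0, a) = u (c (0, a))"
    and v1: "\<And>a a'. a \<in> topspace A \<Longrightarrow> a' \<in> topspace A \<Longrightarrow> v (1, a) = v (1, a')"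
  obtains g where "continuous_map X Z g"
    and "\<And>x. x \<in> B \<Longrightarrow> g x = u x"
    and "\<And>s a. 0 \<le> s \<Longrightarrow> s \<le> 1 \<Longrightarrow> a \<in> topspace A \<Longrightarrow> g (c (s, a)) = v (s, a)"
proof -
  show thesis
  proof (rule homotopy_extend)
    show "continuous_map (prod_topology unit_interval (subtopology X B)) Z (u \<circ> snd)"
      "continuous_map (prod_topology unit_interval (prod_topology unit_interval A)) Z (v \<circ> snd)"
      using u v by (auto simp: continuous_map_of_snd)
    show "(v \<circ> snd) (t, 0, a) = (u \<circ> snd) (t, c (0, a))" if "a \<in> topspace A" for t :: real and a
      using v0[OF that] by simp
    show "(v \<circ> snd) (t, 1, a) = (v \<circ> snd) (t, 1, a')"
      if "a \<in> topspace A" "a' \<in> topspace A" for t :: real and a a'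
      using v1[OF that] by simp
    fix g
    assume g: "continuous_map (prod_topology unit_interval X) Z g"
      and gB: "\<And>t x. 0 \<le> t \<Longrightarrow> t \<le> 1 \<Longrightarrow> x \<in> B \<Longrightarrow> g (t, x) = (u \<circ> snd) (t, x)"
      and gc: "\<And>t s a. 0 \<le> t \<Longrightarrow> t \<le> 1 \<Longrightarrow> 0 \<le> s \<Longrightarrow> s \<le> 1 \<Longrightarrow> a \<in> topspace A \<Longrightarrow>
             g (t, c (s, a)) = (v \<circ> snd) (t, s, a)"
    have "continuous_map X Z (g \<circ> Pair 0)"
      using g by (rule continuous_map_o_Pair) simp
    then show thesis
      using that[of "g \<circ> Pair 0"] gB[of 0] gc[of 0] by simp
  qed
qed

end

text \<open>\<open>G\<close> has the shape prescribed for \<open>F\<close>. Applying the lemma first to \<open>F\<close> and then to \<open>G\<close>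
  therefore yields inverses on both sides.\<close>

lemma cone_map_left_inverse:
  fixes X :: "'x topology" and X' :: "'y topology" and A :: "'a topology"
  assumes "cone_attachment X B A c" and "cone_attachment X' B' A c'"
    and h: "continuous_map (subtopology X B) (subtopology X' B') h"
    and k: "continuous_map (subtopology X' B') (subtopology X B) k"
    and H: "continuous_map (prod_topology unit_interval (subtopology X B)) (subtopology X B) H"
    and H0: "\<And>x. x \<in> B \<Longrightarrow> H (0, x) = k (h x)" and H1: "\<And>x. x \<in> B \<Longrightarrow> H (1, x) = x"
    and \<Phi>: "continuous_map (prod_topology unit_interval A) (subtopology X' B') \<Phi>"
    and \<Phi>0: "\<And>a. a \<in> topspace A \<Longrightarrow> \<Phi> (0, a) = h (c (0, a))"
    and \<Phi>1: "\<And>a. a \<in> topspace A \<Longrightarrow> \<Phi> (1, a) = c' (0, a)"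
    and F: "continuous_map X X' F" and FB: "\<And>x. x \<in> B \<Longrightarrow> F x = h x"
    and Fc: "\<And>s a. 0 \<le> s \<Longrightarrow> s \<le> 1 \<Longrightarrow> a \<in> topspace A \<Longrightarrow>
      F (c (s, a)) = (if s \<le> 2/3 then \<Phi> (3 * s / 2, a) else c' (3 * s - 2, a))"
  obtains \<Psi> G where
    "continuous_map (prod_topology unit_interval A) (subtopology X B) \<Psi>"
    "\<And>a. a \<in> topspace A \<Longrightarrow> \<Psi> (0, a) = k (c' (0, a))"
    "\<And>a. a \<in> topspace A \<Longrightarrow> \<Psi> (1, a) = c (0, a)"
    "continuous_map X' X G" "\<And>x. x \<in> B' \<Longrightarrow> G x = k x"
    "\<And>s a. 0 \<le> s \<Longrightarrow> s \<le> 1 \<Longrightarrow> a \<in> topspace A \<Longrightarrow>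
      G (c' (s, a)) = (if s \<le> 2/3 then \<Psi> (3 * s / 2, a) else c (3 * s - 2, a))"
    "homotopic_with (\<lambda>_. True) X X (G \<circ> F) id"
proof -
  interpret X: cone_attachment X B A c by fact
  interpret X': cone_attachment X' B' A c' by fact
  let ?I3 = "top_of_set {-1..2::real}"
  \<comment> \<open>For fixed \<open>a\<close>, \<open>p\<close> is one path over [-1, 2] made of
    three unit pieces: the image under \<open>k\<close> of the reversed track of
    \<open>\<Phi>\<close>, the track of \<open>c (0, a)\<close> under \<open>H\<close>, and the cone
    line to the apex; \<open>q\<close> is the part over [0, 2]. On the cones, \<open>\<Psi>\<close>,
    \<open>G\<close>, \<open>G \<circ> F\<close> and the final homotopy are all this path after a
    change of parameter.\<close>
  define q where "q = (\<lambda>(r, a). if r \<le> 1 then H (r, c (0, a)) else c (r - 1, a))"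
  define p where "p = (\<lambda>(r, a). if r \<le> 0 then k (\<Phi> (-r, a)) else q (r, a))"
  let ?P = "prod_topology ?I3 A"
  have fst_cont: "continuous_map ?P euclideanreal fst"
    by (metis continuous_map_fst continuous_map_in_subtopology)
  have c0: "continuous_map ?P (subtopology X B) (\<lambda>z. c (0, snd z))"
  proof -
    have "continuous_map ?P X (\<lambda>z. c (0, snd z))"
      by (rule continuous_map_compose[OF _ X.continuous_cone, unfolded o_def])
         (simp add: continuous_map_pairwise o_def continuous_map_snd)
    then show ?thesis
      by (auto intro!: continuous_map_into_subtopology X.cone_0)
  qed
  have cont_q: "continuous_map (subtopology ?P {z \<in> topspace ?P. 0 \<le> fst z}) X q"
    unfolding q_def case_prod_beta
  proof (rule continuous_map_cases_le)
    let ?Q = "subtopology ?P {z \<in> topspace ?P. 0 \<le> fst z}"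
    show "continuous_map ?Q euclideanreal fst"
      by (intro continuous_map_from_subtopology fst_cont)
    show "continuous_map ?Q euclideanreal (\<lambda>x. 1)" by simp
    show "continuous_map (subtopology ?Q {x \<in> topspace ?Q. fst x \<le> 1}) X (\<lambda>z. H (fst z, c (0, snd z)))"
    proof (rule continuous_map_compose[where g = H, unfolded o_def])
      show "continuous_map (prod_topology unit_interval (subtopology X B)) X H"
        using H continuous_map_in_subtopology by blast
      show "continuous_map (subtopology ?Q {x \<in> topspace ?Q. fst x \<le> 1})
          (prod_topology unit_interval (subtopology X B)) (\<lambda>z. (fst z, c (0, snd z)))"
        by (intro continuous_map_pairedI continuous_map_into_subtopology
              continuous_map_from_subtopology fst_cont c0) auto
    qed
    show "continuous_map (subtopology ?Q {x \<in> topspace ?Q. 1 \<le> fst x}) X (\<lambda>z. c (fst z - 1, snd z))"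
    proof (rule continuous_map_compose[OF _ X.continuous_cone, unfolded o_def])
      show "continuous_map (subtopology ?Q {x \<in> topspace ?Q. 1 \<le> fst x})
          (prod_topology unit_interval A) (\<lambda>z. (fst z - 1, snd z))"
        by (intro continuous_map_pairedI continuous_map_into_subtopology continuous_intros
              continuous_map_from_subtopology fst_cont continuous_map_snd) auto
    qed
    show "H (fst z, c (0, snd z)) = c (fst z - 1, snd z)"
      if "z \<in> topspace ?Q" "fst z = 1" for z
      using that by (auto simp: H1 X.cone_0)
  qed
  have cont_p: "continuous_map ?P X p"
    unfolding p_def case_prod_beta
  proof (rule continuous_map_cases_le)
    show "continuous_map ?P euclideanreal fst" by (rule fst_cont)
    show "continuous_map ?P euclideanreal (\<lambda>x. 0)" by simp
    show "continuous_map (subtopology ?P {x \<in> topspace ?P. fst x \<le> 0}) X (\<lambda>z. k (\<Phi> (- fst z, snd z)))"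
    proof (rule continuous_map_compose[where g = k, unfolded o_def])
      show "continuous_map (subtopology X' B') X k"
        using k continuous_map_in_subtopology by blast
      show "continuous_map (subtopology ?P {x \<in> topspace ?P. fst x \<le> 0}) (subtopology X' B')
          (\<lambda>z. \<Phi> (- fst z, snd z))"
      proof (rule continuous_map_compose[OF _ \<Phi>, unfolded o_def])
        show "continuous_map (subtopology ?P {x \<in> topspace ?P. fst x \<le> 0})
          (prod_topology unit_interval A) (\<lambda>z. (- fst z, snd z))"
          by (intro continuous_map_pairedI continuous_map_into_subtopology continuous_intros
              continuous_map_from_subtopology fst_cont continuous_map_snd) auto
      qed
    qed
    show "continuous_map (subtopology ?P {x \<in> topspace ?P. 0 \<le> fst x}) X (\<lambda>z. q (fst z, snd z))"
      using cont_q by simp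
    show "k (\<Phi> (- fst z, snd z)) = q (fst z, snd z)" if "z \<in> topspace ?P" "fst z = 0" for z
      using that by (auto simp: q_def \<Phi>0 H0 X.cone_0)
  qed
  have \<Phi>B: "\<Phi> (r, a) \<in> B'" if "0 \<le> r" "r \<le> 1" "a \<in> topspace A" for r a
  proof -
    have "\<Phi> (r, a) \<in> topspace (subtopology X' B')"
      using continuous_map_funspace[OF \<Phi>] that by auto
    then show ?thesis by simp
  qed
  have pB: "p (r, a) \<in> B" if "r \<le> 1" "-1 \<le> r" "a \<in> topspace A" for r a
  proof -
    have 1: "k (\<Phi> (-r, a)) \<in> B" if "r \<le> 0"
    proof -
      have "\<Phi> (-r, a) \<in> B'" using that \<open>-1 \<le> r\<close> \<open>a \<in> topspace A\<close>
        by (auto intro: \<Phi>B)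
      then show ?thesis using k X'.base_subset by (auto simp: continuous_map_def Pi_iff)
    qed
    have 2: "H (r, c (0, a)) \<in> B" if "0 \<le> r"
    proof -
      have "(r, c (0, a)) \<in> topspace (prod_topology unit_interval (subtopology X B))"
        using that \<open>r \<le> 1\<close> \<open>a \<in> topspace A\<close> X.cone_0[of a] X.base_subset by auto
      then have "H (r, c (0, a)) \<in> topspace (subtopology X B)"
        using continuous_map_funspace[OF H] by blast
      then show ?thesis by simp
    qed
    show ?thesis using 1 2 that by (auto simp: p_def q_def)
  qed
  have p1: "p (1, a) = c (0, a)" and pm1: "p (-1, a) = k (c' (0, a))"
    and p2: "p (2, a) = c (1, a)" if "a \<in> topspace A" for a
    using that by (auto simp: p_def q_def H1 X.cone_0 \<Phi>1)
  have pH: "p (r, a) = H (r, c (0, a))" if "0 \<le> r" "r \<le> 1" "a \<in> topspace A" for r a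
    using that by (auto simp: p_def q_def \<Phi>0 H0 X.cone_0)
  have pc: "p (r, a) = c (r - 1, a)" if "1 \<le> r" "a \<in> topspace A" for r a
    using that by (auto simp: p_def q_def X.cone_0 H1)
  define \<Psi> where "\<Psi> = (\<lambda>(r, a). p (2 * r - 1, a))"
  have \<Psi>: "continuous_map (prod_topology unit_interval A) (subtopology X B) \<Psi>"
    unfolding \<Psi>_def case_prod_beta
  proof (rule continuous_map_into_subtopology)
    show "continuous_map (prod_topology unit_interval A) X (\<lambda>z. p (2 * fst z - 1, snd z))"
      by (rule continuous_map_compose[OF _ cont_p, unfolded o_def],
          intro continuous_map_pairedI continuous_map_into_subtopology continuous_intros
             continuous_map_snd continuous_map_fst[THEN continuous_map_in_subtopology[THEN iffD1, THEN conjunct1]])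
        auto
  qed (auto intro!: pB)
  \<comment> \<open>\<open>G\<close> runs through the whole path at speed 3. Its first two pieces
    form \<open>\<Psi>\<close> and fill the part \<open>s \<le> 2/3\<close>, which is the origin of
    the 2/3 in the prescribed shape.\<close>
  obtain G where G: "continuous_map X' X G" and GB: "\<And>x. x \<in> B' \<Longrightarrow> G x = k x"
    and Gc: "\<And>s a. 0 \<le> s \<Longrightarrow> s \<le> 1 \<Longrightarrow> a \<in> topspace A \<Longrightarrow>
       G (c' (s, a)) = (\<lambda>(s, a). p (3 * s - 1, a)) (s, a)"
  proof (rule X'.map_extend)
    show "continuous_map (subtopology X' B') X k"
      using k continuous_map_in_subtopology by blast
    show "continuous_map (prod_topology unit_interval A) X (\<lambda>(s, a). p (3 * s - 1, a))"
      unfolding case_prod_beta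
      by (rule continuous_map_compose[OF _ cont_p, unfolded o_def],
          intro continuous_map_pairedI continuous_map_into_subtopology continuous_intros
             continuous_map_snd continuous_map_fst[THEN continuous_map_in_subtopology[THEN iffD1, THEN conjunct1]])
        auto
    show "(\<lambda>(s, a). p (3 * s - 1, a)) (0, a) = k (c' (0, a))" if "a \<in> topspace A" for a
      using pm1[OF that] by simp
    show "(\<lambda>(s, a). p (3 * s - 1, a)) (1, a) = (\<lambda>(s, a). p (3 * s - 1, a)) (1, a')"
      if "a \<in> topspace A" "a' \<in> topspace A" for a a'
      using p2[OF that(1)] p2[OF that(2)] X.cone_1[OF that] by simp
    fix G
    assume "continuous_map X' X G" "\<And>x. x \<in> B' \<Longrightarrow> G x = k x"
      "\<And>s a. 0 \<le> s \<Longrightarrow> s \<le> 1 \<Longrightarrow> a \<in> topspace A \<Longrightarrow>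
       G (c' (s, a)) = (\<lambda>(s, a). p (3 * s - 1, a)) (s, a)"
    then show thesis by (rule that)
  qed
  have Gc': "G (c' (s, a)) = (if s \<le> 2/3 then \<Psi> (3 * s / 2, a) else c (3 * s - 2, a))"
    if "0 \<le> s" "s \<le> 1" "a \<in> topspace A" for s a
    using Gc[OF that] pc[of "3 * s - 1" a] that by (auto simp: \<Psi>_def)
  \<comment> \<open>\<open>G \<circ> F\<close> follows the path from 0 back to -1 and then forward
    to 2: \<open>F\<close> first runs along \<open>\<Phi>\<close>, where \<open>G\<close> is
    \<open>k\<close>, and then along the cone of \<open>X'\<close> at speed 3, to which
    \<open>G\<close> adds another factor 3.\<close>
  define \<rho> where "\<rho> s = (if s \<le> 2/3 then - 3 * s / 2 else 9 * s - 7 :: real)" for s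
  have \<rho>: "-1 \<le> \<rho> s" "\<rho> s \<le> 2" if "0 \<le> s" "s \<le> 1" for s
    using that by (auto simp: \<rho>_def)
  have cont_\<rho>: "continuous_on {0..1} \<rho>"
    unfolding \<rho>_def by (intro continuous_on_cases_le continuous_intros) auto
  have GF: "G (F (c (s, a))) = p (\<rho> s, a)" if "0 \<le> s" "s \<le> 1" "a \<in> topspace A" for s a
  proof (cases "s \<le> 2/3")
    case True
    have "\<Phi> (3 * s / 2, a) \<in> B'" using that True by (auto intro: \<Phi>B)
    then show ?thesis using True that by (simp add: Fc GB \<rho>_def p_def)
  next
    case False
    then show ?thesis using that by (simp add: Fc Gc \<rho>_def algebra_simps)
  qed
  \<comment> \<open>The identity on the cone is the path with parameter \<open>1 + s\<close>. The
    convex combination of both parameters is \<open>t\<close> at \<open>s = 0\<close>, which matches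
    \<open>H\<close> on the base, and 2 at \<open>s = 1\<close>, which is the apex
    throughout.\<close>
  obtain K where K: "continuous_map (prod_topology unit_interval X) X K"
    and KB: "\<And>t x. 0 \<le> t \<Longrightarrow> t \<le> 1 \<Longrightarrow> x \<in> B \<Longrightarrow> K (t, x) = H (t, x)"
    and Kc: "\<And>t s a. 0 \<le> t \<Longrightarrow> t \<le> 1 \<Longrightarrow> 0 \<le> s \<Longrightarrow> s \<le> 1 \<Longrightarrow> a \<in> topspace A \<Longrightarrow>
      K (t, c (s, a)) = (\<lambda>(t, s, a). p ((1 - t) * \<rho> s + t * (1 + s), a)) (t, s, a)"
  proof (rule X.homotopy_extend)
    show "continuous_map (prod_topology unit_interval (subtopology X B)) X H"
      using H continuous_map_in_subtopology by blast
    let ?Q = "prod_topology unit_interval (prod_topology unit_interval A)"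
    have f: "continuous_map ?Q euclideanreal fst"
      by (metis continuous_map_fst continuous_map_in_subtopology)
    have fs: "continuous_map ?Q unit_interval (\<lambda>z. fst (snd z))"
      by (rule continuous_map_compose[OF continuous_map_snd continuous_map_fst, unfolded o_def])
    have ss: "continuous_map ?Q A (\<lambda>z. snd (snd z))"
      by (rule continuous_map_compose[OF continuous_map_snd continuous_map_snd, unfolded o_def])
    have r: "continuous_map ?Q euclideanreal (\<lambda>z. \<rho> (fst (snd z)))"
      by (rule continuous_map_compose[OF fs, unfolded o_def]) (simp add: cont_\<rho>)
    have fs': "continuous_map ?Q euclideanreal (\<lambda>z. fst (snd z))"
      using fs continuous_map_in_subtopology by blast
    have b: "(1 - t) * \<rho> s + t * (1 + s) \<in> {-1..2}" if "t \<in> {0..1}" "s \<in> {0..1}" for t s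
    proof -
      have "(1 - t) *\<^sub>R \<rho> s + t *\<^sub>R (1 + s) \<in> {-1..2}"
        by (rule convexD_alt) (use that \<rho>[of s] in auto)
      then show ?thesis by simp
    qed
    show "continuous_map ?Q X (\<lambda>(t, s, a). p ((1 - t) * \<rho> s + t * (1 + s), a))"
      unfolding case_prod_beta
    proof (rule continuous_map_compose[OF _ cont_p, unfolded o_def], intro continuous_map_pairedI ss)
      show "continuous_map ?Q ?I3 (\<lambda>z. (1 - fst z) * \<rho> (fst (snd z)) + fst z * (1 + fst (snd z)))"
        by (intro continuous_map_into_subtopology continuous_intros f fs' r) (use b in auto)
    qed
    show "(\<lambda>(t, s, a). p ((1 - t) * \<rho> s + t * (1 + s), a)) (t, 0, a) = H (t, c (0, a))"
      if "0 \<le> t" "t \<le> 1" "a \<in> topspace A" for t a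
      using pH[OF that] by (simp add: \<rho>_def)
    show "(\<lambda>(t, s, a). p ((1 - t) * \<rho> s + t * (1 + s), a)) (t, 1, a) =
        (\<lambda>(t, s, a). p ((1 - t) * \<rho> s + t * (1 + s), a)) (t, 1, a')"
      if "a \<in> topspace A" "a' \<in> topspace A" for t a a'
      using p2[OF that(1)] p2[OF that(2)] X.cone_1[OF that] by (simp add: \<rho>_def algebra_simps)
    fix K
    assume "continuous_map (prod_topology unit_interval X) X K"
      "\<And>t x. 0 \<le> t \<Longrightarrow> t \<le> 1 \<Longrightarrow> x \<in> B \<Longrightarrow> K (t, x) = H (t, x)"
      "\<And>t s a. 0 \<le> t \<Longrightarrow> t \<le> 1 \<Longrightarrow> 0 \<le> s \<Longrightarrow> s \<le> 1 \<Longrightarrow> a \<in> topspace A \<Longrightarrow>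
      K (t, c (s, a)) = (\<lambda>(t, s, a). p ((1 - t) * \<rho> s + t * (1 + s), a)) (t, s, a)"
    then show thesis by (rule that)
  qed
  have "homotopic_with (\<lambda>_. True) X X (G \<circ> F) id"
    unfolding homotopic_with[where P = "\<lambda>_. True", simplified]
  proof (intro exI[of _ K] conjI ballI K)
    fix x assume x: "x \<in> topspace X"
    from x show "K (0, x) = (G \<circ> F) x"
    proof (cases rule: X.total_cases)
      case 1
      then have "h x \<in> B'" using h X.base_subset by (auto simp: continuous_map_def Pi_iff)
      then show ?thesis using 1 by (simp add: KB H0 FB GB)
    next
      case (2 s a)
      then show ?thesis using GF[of s a] by (simp add: Kc)
    qed
    from x show "K (1, x) = id x"
    proof (cases rule: X.total_cases)
      case 1
      then show ?thesis by (simp add: KB H1)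
    next
      case (2 s a)
      then show ?thesis using pc[of "1 + s" a] by (simp add: Kc)
    qed
  qed
  then show ?thesis
    using that[of \<Psi> G] \<Psi> G GB Gc' p1 pm1 by (simp add: \<Psi>_def)
qed

text \<open>The homotopy \<open>hf\<close> between the two attaching maps is inserted as a collar:
  the map \<open>F\<close> is \<open>h\<close> on the base, follows the collar on the two thirds of
  the cone next to the base, and covers the cone of \<open>X'\<close> with the rest.\<close>

theorem cone_attachment_homotopy_equivalent:
  assumes at: "cone_attachment X B A c" and at': "cone_attachment X' B' A c'"
    and h: "continuous_map (subtopology X B) (subtopology X' B') h"
    and k: "continuous_map (subtopology X' B') (subtopology X B) k"
    and kh: "homotopic_with (\<lambda>_. True) (subtopology X B) (subtopology X B) (k \<circ> h) id"
    and hk: "homotopic_with (\<lambda>_. True) (subtopology X' B') (subtopology X' B') (h \<circ> k) id"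
    and hf: "homotopic_with (\<lambda>_. True) A (subtopology X' B') (\<lambda>a. h (c (0, a))) (\<lambda>a. c' (0, a))"
  shows "X homotopy_equivalent_space X'"
proof -
  interpret X: cone_attachment X B A c by fact
  interpret X': cone_attachment X' B' A c' by fact
  obtain H where H: "continuous_map (prod_topology unit_interval (subtopology X B)) (subtopology X B) H"
    and H0: "\<And>x. H (0, x) = k (h x)" and H1: "\<And>x. H (1, x) = x"
    using kh by (auto simp: homotopic_with_def)
  obtain H' where H': "continuous_map (prod_topology unit_interval (subtopology X' B')) (subtopology X' B') H'"
    and H'0: "\<And>x. H' (0, x) = h (k x)" and H'1: "\<And>x. H' (1, x) = x"
    using hk by (auto simp: homotopic_with_def)
  obtain \<Phi> where \<Phi>: "continuous_map (prod_topology unit_interval A) (subtopology X' B') \<Phi>"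
    and \<Phi>0: "\<And>a. \<Phi> (0, a) = h (c (0, a))" and \<Phi>1: "\<And>a. \<Phi> (1, a) = c' (0, a)"
    using hf by (auto simp: homotopic_with_def)
  let ?v = "\<lambda>(s, a). if s \<le> 2/3 then \<Phi> (3 * s / 2, a) else c' (3 * s - 2, a)"
  have hX': "continuous_map (subtopology X B) X' h" and \<Phi>X': "continuous_map (prod_topology unit_interval A) X' \<Phi>"
    using h \<Phi> continuous_map_in_subtopology by blast+
  have cv: "continuous_map (prod_topology unit_interval A) X' ?v"
  proof -
    let ?P = "prod_topology unit_interval A"
    have f: "continuous_map ?P euclideanreal fst"
      by (metis continuous_map_fst continuous_map_in_subtopology)
    show ?thesis
      unfolding case_prod_beta
    proof (rule continuous_map_cases_le)
      show "continuous_map ?P euclideanreal fst" by (rule f)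
      show "continuous_map ?P euclideanreal (\<lambda>x. 2/3)" by simp
      show "continuous_map (subtopology ?P {x \<in> topspace ?P. fst x \<le> 2/3}) X'
              (\<lambda>z. \<Phi> (3 * fst z / 2, snd z))"
        by (rule continuous_map_compose[OF _ \<Phi>X', unfolded o_def],
            intro continuous_map_pairedI continuous_map_into_subtopology continuous_intros
              continuous_map_from_subtopology f continuous_map_snd) auto
      show "continuous_map (subtopology ?P {x \<in> topspace ?P. 2/3 \<le> fst x}) X'
              (\<lambda>z. c' (3 * fst z - 2, snd z))"
        by (rule continuous_map_compose[OF _ X'.continuous_cone, unfolded o_def],
            intro continuous_map_pairedI continuous_map_into_subtopology continuous_intros
              continuous_map_from_subtopology f continuous_map_snd) auto
      show "\<Phi> (3 * fst z / 2, snd z) = c' (3 * fst z - 2, snd z)"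
        if "z \<in> topspace ?P" "fst z = 2/3" for z
      proof -
        have "3 * fst z / 2 = 1" "3 * fst z - 2 = 0" using that by simp_all
        then show ?thesis by (simp only: \<Phi>1)
      qed
    qed
  qed
  have v0: "?v (0, a) = h (c (0, a))" if "a \<in> topspace A" for a
    by (simp add: \<Phi>0)
  have v1: "?v (1, a) = ?v (1, a')" if "a \<in> topspace A" "a' \<in> topspace A" for a a'
    using X'.cone_1[OF that] by simp
  show ?thesis
  proof (rule X.map_extend[OF hX' cv v0 v1])
    fix F
    assume F: "continuous_map X X' F" and FB: "\<And>x. x \<in> B \<Longrightarrow> F x = h x"
      and "\<And>s a. 0 \<le> s \<Longrightarrow> s \<le> 1 \<Longrightarrow> a \<in> topspace A \<Longrightarrow> F (c (s, a)) = ?v (s, a)"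
    then have Fc: "F (c (s, a)) = (if s \<le> 2/3 then \<Phi> (3 * s / 2, a) else c' (3 * s - 2, a))"
      if "0 \<le> s" "s \<le> 1" "a \<in> topspace A" for s a
      using that by simp
    show ?thesis
    proof (rule cone_map_left_inverse[OF at at' h k H H0 H1 \<Phi> \<Phi>0 \<Phi>1 F FB Fc])
      fix \<Psi> G
      assume \<Psi>: "continuous_map (prod_topology unit_interval A) (subtopology X B) \<Psi>"
        and \<Psi>0: "\<And>a. a \<in> topspace A \<Longrightarrow> \<Psi> (0, a) = k (c' (0, a))"
        and \<Psi>1: "\<And>a. a \<in> topspace A \<Longrightarrow> \<Psi> (1, a) = c (0, a)"
        and G: "continuous_map X' X G" and GB: "\<And>x. x \<in> B' \<Longrightarrow> G x = k x"
        and Gc: "\<And>s a. 0 \<le> s \<Longrightarrow> s \<le> 1 \<Longrightarrow> a \<in> topspace A \<Longrightarrow>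
          G (c' (s, a)) = (if s \<le> 2/3 then \<Psi> (3 * s / 2, a) else c (3 * s - 2, a))"
        and GF: "homotopic_with (\<lambda>_. True) X X (G \<circ> F) id"
      show ?thesis
      proof (rule cone_map_left_inverse[OF at' at k h H' H'0 H'1 \<Psi> \<Psi>0 \<Psi>1 G GB Gc])
        fix \<Psi>' F'
        assume F': "continuous_map X X' F'" and F'G: "homotopic_with (\<lambda>_. True) X' X' (F' \<circ> G) id"
        \<comment> \<open>\<open>F' \<circ> G \<circ> F \<circ> G\<close> reduces to
          \<open>F' \<circ> G\<close> in the middle and to \<open>F \<circ> G\<close> at the left
          end, so \<open>F \<circ> G\<close> is homotopic to the identity.\<close>
        have "homotopic_with (\<lambda>_. True) X' X' (F' \<circ> (G \<circ> F) \<circ> G) (F' \<circ> id \<circ> G)"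
          by (rule homotopic_with_compose_continuous_map_right[OF
                homotopic_with_compose_continuous_map_left[OF GF F', of "\<lambda>_. True"] G]) auto
        then have 1: "homotopic_with (\<lambda>_. True) X' X' ((F' \<circ> G) \<circ> (F \<circ> G)) (F' \<circ> G)"
          by (simp add: o_assoc)
        have "homotopic_with (\<lambda>_. True) X' X' ((F' \<circ> G) \<circ> (F \<circ> G)) (id \<circ> (F \<circ> G))"
          by (rule homotopic_with_compose_continuous_map_right[OF F'G])
             (auto intro: continuous_map_compose F G)
        then have 2: "homotopic_with (\<lambda>_. True) X' X' (F \<circ> G) ((F' \<circ> G) \<circ> (F \<circ> G))"
          by (simp add: homotopic_with_symD)
        have "homotopic_with (\<lambda>_. True) X' X' (F \<circ> G) id"
          by (rule homotopic_with_trans[OF homotopic_with_trans[OF 2 1] F'G])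
        then show ?thesis
          unfolding homotopy_equivalent_space_def by (intro exI[of _ F] exI[of _ G] conjI F G GF)
      qed
    qed
  qed
qed

section \<open>Realizations\<close>

text \<open>The sum runs over the support and not over a vertex set, so the space depends on the
  face family alone and faces can be added one at a time. Empty support has sum 0, so the empty face
  contributes no point.\<close>

definition realization :: "'a set set \<Rightarrow> ('a \<Rightarrow> real) set" where
  "realization F = {x. (\<forall>v. 0 \<le> x v) \<and> {v. x v \<noteq> 0} \<in> F \<and> (\<Sum>v | x v \<noteq> 0. x v) = 1}"

lemma geometric_realization_eq:
  assumes "finite (verts S)" "faces S \<subseteq> Pow (verts S)"
  shows "geometric_realization S = top_of_set (realization (faces S))"
proof -
  have "(\<Sum>v | x v \<noteq> 0. x v) = (\<Sum>v\<in>verts S. x v)" if "{v. x v \<noteq> 0} \<in> faces S" for x :: "'a \<Rightarrow> real"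
    using that assms by (intro sum.mono_neutral_left) auto
  then have "realization (faces S) =
      {x. (\<forall>v. 0 \<le> x v) \<and> {v. x v \<noteq> 0} \<in> faces S \<and> (\<Sum>v\<in>verts S. x v) = 1}"
    unfolding realization_def by auto
  then show ?thesis
    by (simp add: geometric_realization_def euclidean_product_topology)
qed

lemma realization_iff:
  assumes "finite W" and "{v. x v \<noteq> 0} \<subseteq> W"
  shows "x \<in> realization F \<longleftrightarrow> (\<forall>v. 0 \<le> x v) \<and> {v. x v \<noteq> 0} \<in> F \<and> (\<Sum>v\<in>W. x v) = 1"
proof -
  have "(\<Sum>v | x v \<noteq> 0. x v) = (\<Sum>v\<in>W. x v)"
    using assms by (intro sum.mono_neutral_left) auto
  then show ?thesis by (simp add: realization_def)
qed

lemma realization_mono: "F \<subseteq> G \<Longrightarrow> realization F \<subseteq> realization G"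
  by (auto simp: realization_def)

lemma realization_le_1:
  assumes "x \<in> realization F" "\<And>I. I \<in> F \<Longrightarrow> finite I" shows "x v \<le> 1"
proof (cases "x v = 0")
  case False
  have "x v \<le> (\<Sum>v | x v \<noteq> 0. x v)"
    using assms False by (intro member_le_sum) (auto simp: realization_def)
  then show ?thesis using assms by (simp add: realization_def)
qed auto

lemma continuous_on_coordinate [continuous_intros]: "continuous_on S (\<lambda>x :: 'a \<Rightarrow> real. x v)"
  by (rule continuous_on_product_then_coordinatewise[OF continuous_on_id])

lemma continuous_on_snd_coordinate [continuous_intros]:
  "continuous_on S (\<lambda>z :: 'b::topological_space \<times> ('a \<Rightarrow> real). snd z v)"
  by (rule continuous_on_product_then_coordinatewise[OF continuous_on_snd[OF continuous_on_id]])

lemma continuous_on_Min: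
  fixes f :: "'i \<Rightarrow> 'b::topological_space \<Rightarrow> real"
  assumes "finite I" "I \<noteq> {}" "\<And>i. i \<in> I \<Longrightarrow> continuous_on S (f i)"
  shows "continuous_on S (\<lambda>z. Min ((\<lambda>i. f i z) ` I))"
  using assms
proof (induction I rule: finite_ne_induct)
  case (insert i I)
  then have "(\<lambda>z. Min ((\<lambda>i. f i z) ` insert i I)) = (\<lambda>z. min (f i z) (Min ((\<lambda>i. f i z) ` I)))"
    by (simp add: fun_eq_iff)
  moreover have "continuous_on S (\<lambda>z. min (f i z) (Min ((\<lambda>i. f i z) ` I)))"
    using insert by (intro continuous_on_min) auto
  ultimately show ?case by (simp only:)
qed auto

text \<open>New points lie in the simplex on \<open>insert w \<tau>\<close>. Shifting weight evenly
  from \<open>\<tau>\<close> to \<open>w\<close> until the least \<open>\<tau>\<close>-coordinate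
  vanishes pushes them onto the facets opposite to vertices of \<open>\<tau>\<close>, which belong
  to \<open>F\<close>.\<close>

lemma elementary_expansion:
  assumes F: "\<And>I J. I \<in> F \<Longrightarrow> J \<subseteq> I \<Longrightarrow> J \<in> F"
    and fin: "\<And>I. I \<in> F \<Longrightarrow> finite I" and \<tau>: "finite \<tau>" "\<tau> \<noteq> {}" "\<tau> \<notin> F" "w \<notin> \<tau>"
    and facets: "\<And>v. v \<in> \<tau> \<Longrightarrow> insert w (\<tau> - {v}) \<in> F"
  shows "top_of_set (realization (F \<union> {\<tau>, insert w \<tau>})) homotopy_equivalent_space
    top_of_set (realization F)"
proof (rule deformation_retract_imp_homotopy_equivalent_space)
  let ?F' = "F \<union> {\<tau>, insert w \<tau>}"
  let ?X = "realization ?F'"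
  \<comment> \<open>\<open>m\<close> is how far the push can go. It vanishes on the old realization
    because \<open>\<tau>\<close> is not in \<open>F\<close>, so old points stay fixed. The factor
    \<open>card \<tau>\<close> in \<open>r\<close> preserves the coordinate sum.\<close>
  define m where "m x = Min (x ` \<tau>)" for x :: "'a \<Rightarrow> real"
  define r where "r t x = (\<lambda>v. x v - t * m x * of_bool (v \<in> \<tau>) + t * card \<tau> * m x * of_bool (v = w))"
    for t :: real and x :: "'a \<Rightarrow> real"
  have fin': "finite I" if "I \<in> ?F'" for I using that fin \<tau> by auto
  have m_le: "m x \<le> x v" if "v \<in> \<tau>" for x v
    using that \<tau> by (simp add: m_def)
  have m_ge0: "0 \<le> m x" if "x \<in> ?X" for x
    using that \<tau> by (auto simp: m_def realization_def)
  have m_ex: "\<exists>v\<in>\<tau>. m x = x v" for x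
  proof -
    have "m x \<in> x ` \<tau>" unfolding m_def using \<tau> by (intro Min_in) auto
    then show ?thesis by blast
  qed
  have m0: "m x = 0" if "x \<in> realization F" for x
  proof -
    have "\<not> \<tau> \<subseteq> {v. x v \<noteq> 0}" using that F \<tau> by (auto simp: realization_def)
    then obtain v where "v \<in> \<tau>" "x v = 0" by auto
    then show ?thesis using m_le[of v x] m_ge0[of x] that realization_mono[of F ?F'] by auto
  qed
  have sub: "J \<in> F" if J: "J \<subseteq> insert w \<tau>" "\<not> \<tau> \<subseteq> J" for J
  proof -
    obtain v where "v \<in> \<tau>" "v \<notin> J" using J by blast
    then show ?thesis using facets[of v] F[of _ J] J by blast
  qed
  have r_in: "r t x \<in> ?X" "t = 1 \<Longrightarrow> r t x \<in> realization F" if x: "x \<in> ?X" and t: "0 \<le> t" "t \<le> 1" for x t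
  proof -
    have "r t x \<in> ?X \<and> (t = 1 \<longrightarrow> r t x \<in> realization F)"
    proof (cases "x \<in> realization F")
      case True
      then show ?thesis using m0[OF True] x by (simp add: r_def)
    next
      case False
      then have supp: "{v. x v \<noteq> 0} \<in> {\<tau>, insert w \<tau>}"
        using x by (auto simp: realization_def)
      let ?W = "insert w \<tau>"
      have W: "finite ?W" "{v. x v \<noteq> 0} \<subseteq> ?W" using supp \<tau> by auto
      have W': "{v. r t x v \<noteq> 0} \<subseteq> ?W" using W by (auto simp: r_def)
      have s1: "(\<Sum>v\<in>?W. x v) = 1" using x realization_iff[OF W] by blast
      have pos: "0 \<le> r t x v" for v
      proof -
        have "t * m x \<le> x v" if "v \<in> \<tau>"
          using mult_right_mono[OF t(2) m_ge0[OF x]] m_le[OF that, of x] by simp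
        moreover have "0 \<le> x v" using x by (simp add: realization_def)
        ultimately show ?thesis using m_ge0[OF x] t \<tau>(4) by (auto simp: r_def)
      qed
      have "(\<Sum>v\<in>?W. r t x v) = (\<Sum>v\<in>?W. x v) - (\<Sum>v\<in>?W. t * m x * of_bool (v \<in> \<tau>))
           + (\<Sum>v\<in>?W. t * card \<tau> * m x * of_bool (v = w))"
        by (simp add: r_def sum.distrib sum_subtractf)
      also have "(\<Sum>v\<in>?W. t * m x * of_bool (v \<in> \<tau>)) = card \<tau> * (t * m x)"
        using \<tau> by (simp add: sum.insert_if)
      also have "(\<Sum>v\<in>?W. t * card \<tau> * m x * of_bool (v = w)) = t * card \<tau> * m x"
      proof -
        have "(\<Sum>v\<in>\<tau>. t * card \<tau> * m x * of_bool (v = w)) = 0"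
          using \<tau> by (intro sum.neutral) auto
        then show ?thesis using \<tau> by simp
      qed
      finally have s: "(\<Sum>v\<in>?W. r t x v) = 1" using s1 by simp
      have "{v. r t x v \<noteq> 0} \<in> ?F'"
        using sub[OF W'] W' by blast
      moreover have "{v. r t x v \<noteq> 0} \<in> F" if "t = 1"
      proof (rule sub[OF W'])
        obtain v where "v \<in> \<tau>" "m x = x v" using m_ex by blast
        then have "r t x v = 0" using that \<tau> by (auto simp: r_def)
        then show "\<not> \<tau> \<subseteq> {v. r t x v \<noteq> 0}" using \<open>v \<in> \<tau>\<close> by blast
      qed
      ultimately show ?thesis
        using realization_iff[OF W(1) W'] pos s by blast
    qed
    then show "r t x \<in> ?X" "t = 1 \<Longrightarrow> r t x \<in> realization F" by auto
  qed
  have cont: "continuous_on S (\<lambda>z. r (f z) (g z))"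
    if "continuous_on S f" "continuous_on S g" for S and f :: "'z::topological_space \<Rightarrow> real" and g
  proof -
    have g: "continuous_on S (\<lambda>z. g z v)" for v
      using continuous_on_product_then_coordinatewise[OF that(2)] .
    show ?thesis
      unfolding r_def m_def
      by (intro continuous_on_coordinatewise_then_product continuous_on_add continuous_on_diff
          continuous_on_mult continuous_on_const that(1) g continuous_on_Min \<tau>)
  qed
  have r0: "r 0 x = x" for x by (simp add: r_def)
  show "homotopic_with (\<lambda>x. True) (top_of_set ?X) (top_of_set ?X) (r 1) id"
    unfolding homotopic_with_def
  proof (intro exI conjI ballI allI)
    show "continuous_map (prod_topology (top_of_set {0..1}) (top_of_set ?X)) (top_of_set ?X)
        (\<lambda>z. r (1 - fst z) (snd z))"
    proof -
      have "continuous_on ({0..1} \<times> ?X) (\<lambda>z. r (1 - fst z) (snd z))"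
        by (intro cont continuous_on_diff continuous_on_const continuous_on_fst continuous_on_snd continuous_on_id)
      then show ?thesis using r_in(1) by auto
    qed
  qed (auto simp: r0)
  show "retraction_maps (top_of_set ?X) (top_of_set (realization F)) (r 1) id"
    unfolding retraction_maps_def
  proof (intro conjI ballI)
    have sub: "realization F \<subseteq> ?X" by (rule realization_mono) auto
    then show "continuous_map (top_of_set (realization F)) (top_of_set ?X) id" by auto
    show "continuous_map (top_of_set ?X) (top_of_set (realization F)) (r 1)"
      using r_in(2)[of _ 1] cont[of ?X "\<lambda>_. 1" "\<lambda>x. x"] by auto
    show "r 1 (id x) = x" if "x \<in> topspace (top_of_set (realization F))" for x
      using that by (simp add: m0 r_def)
  qed
qed

lemma compact_realization_boundary:
  assumes "finite \<sigma>" shows "compact (realization (Pow \<sigma> - {\<sigma>}))"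
proof -
  let ?C = "PiE UNIV (\<lambda>v. if v \<in> \<sigma> then {0..1::real} else {0})"
  have "compactin (powertop_real UNIV) ?C"
    by (subst compactin_PiE) auto
  then have 1: "compact ?C" by (simp add: euclidean_product_topology)
  have "closed {x :: 'a \<Rightarrow> real. (\<Sum>v\<in>\<sigma>. x v) = 1}"
    by (intro closed_Collect_eq continuous_intros)
  moreover have "closed (\<Union>v\<in>\<sigma>. {x :: 'a \<Rightarrow> real. x v = 0})"
    using assms by (intro closed_UN ballI closed_Collect_eq continuous_intros)
  ultimately have 2: "compact (?C \<inter> ({x. (\<Sum>v\<in>\<sigma>. x v) = 1} \<inter> (\<Union>v\<in>\<sigma>. {x. x v = 0})))"
    using 1 by (intro compact_Int_closed closed_Int)
  have "x \<in> realization (Pow \<sigma> - {\<sigma>}) \<longleftrightarrow>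
      x \<in> ?C \<inter> ({x. (\<Sum>v\<in>\<sigma>. x v) = 1} \<inter> (\<Union>v\<in>\<sigma>. {x. x v = 0}))" (is "?l = ?r") for x
  proof
    assume l: ?l
    then have s: "{v. x v \<noteq> 0} \<subseteq> \<sigma>" by (auto simp: realization_def)
    have "x v \<le> 1" for v
      using realization_le_1[OF l] assms finite_subset by blast
    then show ?r using l realization_iff[OF assms s, of "Pow \<sigma> - {\<sigma>}"] s by auto
  next
    assume r: ?r
    then have "x \<in> ?C" by blast
    then have v: "x v \<in> (if v \<in> \<sigma> then {0..1} else {0})" for v
      using PiE_mem[of x UNIV _ v] by blast
    have "v \<in> \<sigma>" if "x v \<noteq> 0" for v using v[of v] that by (auto split: if_splits)
    then have s: "{v. x v \<noteq> 0} \<subseteq> \<sigma>" by blast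
    moreover have "0 \<le> x u" for u using v[of u] by (auto split: if_splits)
    ultimately show ?l using realization_iff[OF assms s] r by auto
  qed
  then show ?thesis using 2 by (metis (no_types, lifting) subset_antisym subsetI)
qed

section \<open>The simplex as a cone over its boundary\<close>

definition barycentre :: "'a set \<Rightarrow> 'a \<Rightarrow> real" where
  "barycentre \<sigma> v = of_bool (v \<in> \<sigma>) / card \<sigma>"

definition face_cone :: "'a set \<Rightarrow> real \<times> ('a \<Rightarrow> real) \<Rightarrow> 'a \<Rightarrow> real" where
  "face_cone \<sigma> = (\<lambda>(s, a) v. (1 - s) * a v + s * barycentre \<sigma> v)"

lemma boundary_zero:
  assumes "a \<in> realization (Pow \<sigma> - {\<sigma>})" obtains v where "v \<in> \<sigma>" "a v = 0"
  using assms by (auto simp: realization_def)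

lemma boundary_off:
  assumes "a \<in> realization (Pow \<sigma> - {\<sigma>})" "v \<notin> \<sigma>" shows "a v = 0"
  using assms by (auto simp: realization_def)

lemma boundary_nonneg: "a \<in> realization F \<Longrightarrow> 0 \<le> a v"
  by (auto simp: realization_def)

lemma boundary_sum:
  assumes "finite \<sigma>" "a \<in> realization (Pow \<sigma> - {\<sigma>})" shows "(\<Sum>v\<in>\<sigma>. a v) = 1"
  using assms realization_iff[OF assms(1), of a "Pow \<sigma> - {\<sigma>}"] by (auto simp: realization_def)

lemma face_cone_in:
  assumes \<sigma>: "finite \<sigma>" "\<sigma> \<noteq> {}" and a: "a \<in> realization (Pow \<sigma> - {\<sigma>})" and s: "0 \<le> s" "s \<le> 1"
  shows "face_cone \<sigma> (s, a) \<in> realization (if s = 0 then Pow \<sigma> - {\<sigma>} else {\<sigma>})"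
proof (cases "s = 0")
  case True
  then show ?thesis using a by (simp add: face_cone_def)
next
  case False
  then have s0: "0 < s" using s by simp
  let ?x = "face_cone \<sigma> (s, a)"
  have c: "0 < real (card \<sigma>)" using \<sigma> by (simp add: card_gt_0_iff)
  have pos: "0 \<le> (1 - s) * a v" for v
    using s a boundary_nonneg[OF a] by simp
  have "0 < ?x v" if "v \<in> \<sigma>" for v
    using pos[of v] that s0 c by (auto simp: face_cone_def barycentre_def intro!: add_nonneg_pos)
  moreover have off: "?x v = 0" if "v \<notin> \<sigma>" for v
    using that boundary_off[OF a that] by (simp add: face_cone_def barycentre_def)
  ultimately have supp: "{v. ?x v \<noteq> 0} = \<sigma>" and nn: "0 \<le> ?x v" for v
    by (force, metis less_imp_le order_refl)
  have "(\<Sum>v\<in>\<sigma>. ?x v) = (1 - s) * (\<Sum>v\<in>\<sigma>. a v) + s * (\<Sum>v\<in>\<sigma>. barycentre \<sigma> v)"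
    by (simp add: face_cone_def sum.distrib sum_distrib_left)
  also have "(\<Sum>v\<in>\<sigma>. barycentre \<sigma> v) = 1"
    using c \<sigma> by (simp add: barycentre_def)
  finally have "(\<Sum>v\<in>\<sigma>. ?x v) = 1" using boundary_sum[OF \<sigma>(1) a] by simp
  then show ?thesis using realization_iff[OF \<sigma>(1), of ?x] supp nn False by auto
qed

text \<open>A multiple of the barycentre can be subtracted until the least coordinate
  \<open>m\<close> reaches 0. The barycentre has weight \<open>1 / card \<sigma>\<close> at each
  vertex, whence \<open>s = card \<sigma> * m\<close>; the rescaled remainder is the boundary
  point.\<close>

lemma face_cone_surj:
  assumes \<sigma>: "finite \<sigma>" "2 \<le> card \<sigma>" and x: "x \<in> realization {\<sigma>}"
  obtains s a where "0 < s" "s \<le> 1" "a \<in> realization (Pow \<sigma> - {\<sigma>})" "x = face_cone \<sigma> (s, a)"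
proof -
  let ?n = "real (card \<sigma>)"
  have ne: "\<sigma> \<noteq> {}" and n: "0 < ?n" using \<sigma> by auto
  have supp: "{v. x v \<noteq> 0} = \<sigma>" and nn: "0 \<le> x v" for v
    using x by (auto simp: realization_def)
  have sx: "(\<Sum>v\<in>\<sigma>. x v) = 1" using x supp by (simp add: realization_def)
  define m where "m = Min (x ` \<sigma>)"
  have "m \<in> x ` \<sigma>" unfolding m_def using \<sigma> ne by (intro Min_in) auto
  then obtain u where u: "u \<in> \<sigma>" "m = x u" by blast
  have m_le: "m \<le> x v" if "v \<in> \<sigma>" for v using that \<sigma> by (simp add: m_def)
  have m0: "0 < m" using u supp nn[of u] by (simp add: less_le) blast
  define s where "s = ?n * m"
  have s0: "0 < s" using m0 n by (simp add: s_def)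
  have "?n * m = (\<Sum>v\<in>\<sigma>. m)" by simp
  also have "\<dots> \<le> (\<Sum>v\<in>\<sigma>. x v)" using m_le by (rule sum_mono)
  finally have s1: "s \<le> 1" using sx by (simp add: s_def)
  have sb: "s * barycentre \<sigma> v = m * of_bool (v \<in> \<sigma>)" for v
    using n by (simp add: s_def barycentre_def)
  show ?thesis
  proof (cases "s = 1")
    case True
    have eq: "x v = m" if "v \<in> \<sigma>" for v
    proof -
      have "(\<Sum>v\<in>\<sigma>. x v - m) = 0" using sx True by (simp add: sum_subtractf s_def)
      then have "\<forall>v\<in>\<sigma>. x v - m = 0"
        by (subst (asm) sum_nonneg_eq_0_iff) (use \<sigma> m_le in auto)
      then show ?thesis using that by simp
    qed
    \<comment> \<open>At the barycentre any boundary point will do. A single vertex is one because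
      \<open>\<sigma>\<close> has at least two elements.\<close>
    define a where "a v = (if v = u then 1 else 0 :: real)" for v
    have "\<sigma> \<noteq> {u}" using \<sigma> by auto
    then have "a \<in> realization (Pow \<sigma> - {\<sigma>})"
      using u by (auto simp: realization_def a_def)
    moreover have "x = face_cone \<sigma> (s, a)"
      using eq supp sb True by (fastforce simp: face_cone_def fun_eq_iff)
    ultimately show ?thesis using that s0 s1 by blast
  next
    case False
    then have d: "0 < 1 - s" using s1 by simp
    define a where "a v = (x v - m * of_bool (v \<in> \<sigma>)) / (1 - s)" for v
    have as: "{v. a v \<noteq> 0} \<subseteq> \<sigma>" using supp by (auto simp: a_def)
    have au: "a u = 0" using u by (simp add: a_def)
    have "(\<Sum>v\<in>\<sigma>. a v) = (\<Sum>v\<in>\<sigma>. x v - m) / (1 - s)"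
      by (simp add: a_def sum_divide_distrib)
    also have "\<dots> = 1" using sx d by (simp add: sum_subtractf s_def)
    finally have "(\<Sum>v\<in>\<sigma>. a v) = 1" .
    moreover have "0 \<le> a v" for v
      using m_le[of v] nn[of v] d by (auto simp: a_def)
    ultimately have "a \<in> realization (Pow \<sigma> - {\<sigma>})"
      using realization_iff[OF \<sigma>(1) as] as au u by auto
    moreover have "x = face_cone \<sigma> (s, a)"
      using d by (auto simp: face_cone_def fun_eq_iff sb a_def)
    ultimately show ?thesis using that s0 s1 by blast
  qed
qed

text \<open>The cone parameter is \<open>card \<sigma>\<close> times the least coordinate. Comparing
  both sides at a zero coordinate of one boundary point gives one inequality between the parameters,
  and symmetry gives the other.\<close>

lemma face_cone_inj:
  assumes \<sigma>: "finite \<sigma>" "\<sigma> \<noteq> {}" and a: "a \<in> realization (Pow \<sigma> - {\<sigma>})"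
    and a': "a' \<in> realization (Pow \<sigma> - {\<sigma>})"
    and s: "s \<le> 1" "s' \<le> 1" and eq: "face_cone \<sigma> (s, a) = face_cone \<sigma> (s', a')"
  shows "s = s' \<and> (s = 1 \<or> a = a')"
proof -
  have le: "t' \<le> t" if b: "b \<in> realization (Pow \<sigma> - {\<sigma>})" and b': "b' \<in> realization (Pow \<sigma> - {\<sigma>})"
    and t: "t' \<le> 1" and e: "face_cone \<sigma> (t, b) = face_cone \<sigma> (t', b')" for t t' b b'
  proof -
    obtain v where v: "v \<in> \<sigma>" "b v = 0" using boundary_zero[OF b] by blast
    have c: "0 < 1 / real (card \<sigma>)" using \<sigma> by (simp add: card_gt_0_iff)
    have "(1 - t') * b' v + t' * (1 / card \<sigma>) = t * (1 / card \<sigma>)"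
      using fun_cong[OF e, of v] v by (simp add: face_cone_def barycentre_def)
    moreover have "0 \<le> (1 - t') * b' v" using t boundary_nonneg[OF b'] by simp
    ultimately have "t' * (1 / card \<sigma>) \<le> t * (1 / card \<sigma>)" by linarith
    then show ?thesis using c by (simp add: divide_le_cancel)
  qed
  have ss: "s = s'" using le[OF a a' s(2) eq] le[OF a' a s(1) eq[symmetric]] by simp
  moreover have "a = a'" if "s \<noteq> 1"
  proof
    fix v show "a v = a' v"
      using fun_cong[OF eq, of v] ss that by (simp add: face_cone_def)
  qed
  ultimately show ?thesis by blast
qed

lemma continuous_on_face_cone: "continuous_on S (face_cone \<sigma>)"
  unfolding face_cone_def case_prod_beta
  by (intro continuous_on_coordinatewise_then_product continuous_intros)

text \<open>Linear coordinates on the affine hull of a simplex, centred at the barycentre: radial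
  projection in them identifies the boundary with a sphere.\<close>

definition simplex_coord :: "(nat \<Rightarrow> 'a) \<Rightarrow> 'a \<Rightarrow> nat \<Rightarrow> ('a \<Rightarrow> real) \<Rightarrow> nat \<Rightarrow> real" where
  "simplex_coord e w n x i = (if i < n then x (e i) - x w else 0)"

text \<open>A continuous bijection is all that the cone description of a sphere asks for. The
  coordinates vanish only for constant weights, that is at the barycentre, so the radial projection
  is defined on the whole boundary.\<close>

lemma boundary_sphere:
  assumes \<sigma>: "finite \<sigma>" "card \<sigma> = Suc n" "0 < n"
  obtains \<phi> where "continuous_on (realization (Pow \<sigma> - {\<sigma>})) \<phi>"
    and "bij_betw \<phi> (realization (Pow \<sigma> - {\<sigma>})) (topspace (nsphere (n - 1)))"
proof -
  let ?A = "realization (Pow \<sigma> - {\<sigma>})"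
  obtain w where w: "w \<in> \<sigma>" using \<sigma> by fastforce
  have "card (\<sigma> - {w}) = n" using \<sigma> w by simp
  then obtain e where e: "bij_betw e {..<n} (\<sigma> - {w})"
    using ex_bij_betw_nat_finite[of "\<sigma> - {w}"] \<sigma> by (auto simp: atLeast0LessThan)
  define L where "L = simplex_coord e w n"
  define N where "N x = sqrt (\<Sum>i<n. (L x i)\<^sup>2)" for x
  define \<phi> where "\<phi> x i = L x i / N x" for x i
  have e_in: "e i \<in> \<sigma>" "e i \<noteq> w" if "i < n" for i
    using bij_betwE[OF e] that by auto
  have e_ex: "\<exists>i<n. v = e i" if "v \<in> \<sigma>" "v \<noteq> w" for v
  proof -
    have "v \<in> e ` {..<n}" using bij_betw_imp_surj_on[OF e] that by simp
    then show ?thesis by auto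
  qed
  have N0: "0 < N x" if x: "x \<in> ?A" for x
  proof (rule ccontr)
    assume "\<not> 0 < N x"
    then have "(\<Sum>i<n. (L x i)\<^sup>2) = 0"
      by (metis N_def le_less not_le real_sqrt_gt_0_iff sum_nonneg zero_le_power2)
    then have "L x i = 0" if "i < n" for i
      using that by (simp add: sum_nonneg_eq_0_iff)
    then have eq: "x v = x w" if "v \<in> \<sigma>" for v
      using e_ex[OF that] by (cases "v = w") (auto simp: L_def simplex_coord_def)
    then have "x v = 0" if "v \<in> \<sigma>" for v
      using boundary_zero[OF x] that by metis
    then show False using boundary_sum[OF \<sigma>(1) x] by simp
  qed
  have cont: "continuous_on ?A \<phi>"
  proof (rule continuous_on_coordinatewise_then_product)
    fix i
    have L: "continuous_on ?A (\<lambda>x. L x i)" for i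
      unfolding L_def simplex_coord_def by (cases "i < n") (auto intro!: continuous_intros)
    have "continuous_on ?A N"
      unfolding N_def
      by (intro continuous_on_real_sqrt continuous_on_sum continuous_on_power L)
    then show "continuous_on ?A (\<lambda>x. \<phi> x i)"
      unfolding \<phi>_def using L N0 by (intro continuous_on_divide) force+
  qed
  have im: "\<phi> x \<in> topspace (nsphere (n - 1))" if x: "x \<in> ?A" for x
  proof -
    have "(\<Sum>i\<le>n-1. (\<phi> x i)\<^sup>2) = (\<Sum>i<n. (L x i)\<^sup>2) / (N x)\<^sup>2"
      using \<sigma>(3) by (simp add: \<phi>_def power_divide sum_divide_distrib lessThan_Suc_atMost[symmetric])
    also have "\<dots> = 1" using N0[OF x] by (simp add: N_def)
    finally show ?thesis by (auto simp: nsphere \<phi>_def L_def simplex_coord_def)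
  qed
  have inj: "inj_on \<phi> ?A"
  proof (rule inj_onI)
    fix x y assume x: "x \<in> ?A" and y: "y \<in> ?A" and xy: "\<phi> x = \<phi> y"
    \<comment> \<open>Equal directions mean \<open>x = \<kappa> * y + k\<close> on
      \<open>\<sigma>\<close> with constant \<open>k\<close>. Both points are nonnegative with a
      zero coordinate, which forces \<open>k = 0\<close>; the coordinate sums then force
      \<open>\<kappa> = 1\<close>.\<close>
    define \<kappa> where "\<kappa> = N x / N y"
    have l: "0 < \<kappa>" using N0[OF x] N0[OF y] by (simp add: \<kappa>_def)
    have Lxy: "L x i = \<kappa> * L y i" for i
      using fun_cong[OF xy, of i] N0[OF x] N0[OF y] by (simp add: \<phi>_def \<kappa>_def field_simps)
    define k where "k = x w - \<kappa> * y w"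
    have xk: "x v = \<kappa> * y v + k" if v: "v \<in> \<sigma>" for v
    proof (cases "v = w")
      case False
      then obtain i where "i < n" "v = e i" using e_ex v by blast
      then show ?thesis using Lxy[of i] by (simp add: L_def simplex_coord_def k_def algebra_simps)
    qed (simp add: k_def)
    obtain v0 where v0: "v0 \<in> \<sigma>" "x v0 = 0" using boundary_zero[OF x] by blast
    obtain v1 where v1: "v1 \<in> \<sigma>" "y v1 = 0" using boundary_zero[OF y] by blast
    have "k \<le> 0"
    proof -
      have "0 \<le> \<kappa> * y v0" using l boundary_nonneg[OF y] by simp
      then show ?thesis using xk[OF v0(1)] v0 by simp
    qed
    moreover have "0 \<le> k" using xk[OF v1(1)] v1 boundary_nonneg[OF x, of v1] by simp
    ultimately have k: "k = 0" by simp
    have "(\<Sum>v\<in>\<sigma>. x v) = (\<Sum>v\<in>\<sigma>. \<kappa> * y v)" using xk k by (intro sum.cong) auto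
    then have "\<kappa> = 1"
      using boundary_sum[OF \<sigma>(1) x] boundary_sum[OF \<sigma>(1) y] by (simp flip: sum_distrib_left)
    then show "x = y"
      using xk k boundary_off[OF x] boundary_off[OF y] by (metis add.right_neutral ext mult_1)
  qed
  have surj: "topspace (nsphere (n - 1)) \<subseteq> \<phi> ` ?A"
  proof
    fix p :: "nat \<Rightarrow> real" assume "p \<in> topspace (nsphere (n - 1))"
    then have p1: "(\<Sum>i<n. (p i)\<^sup>2) = 1" and p0: "p i = 0" if "i \<ge> n" for i
      using \<sigma>(3) that by (auto simp: nsphere lessThan_Suc_atMost[symmetric])
    \<comment> \<open>\<open>q\<close> is the lift of \<open>p\<close> with value 0 at
      \<open>w\<close>. Lifts differ by constants: subtracting the minimum and dividing by the total
      gives the boundary point in the direction \<open>p\<close>.\<close>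
    define q where "q v = (if v = w then 0 else p (the_inv_into {..<n} e v))" for v
    have qe: "q (e i) = p i" if "i < n" for i
      using that e e_in by (simp add: q_def the_inv_into_f_f bij_betw_def)
    define m where "m = Min (q ` \<sigma>)"
    have "m \<in> q ` \<sigma>" unfolding m_def using \<sigma> w by (intro Min_in) auto
    then obtain u where u: "u \<in> \<sigma>" "m = q u" by blast
    have m_le: "m \<le> q v" if "v \<in> \<sigma>" for v using that \<sigma> by (simp add: m_def)
    define T where "T = (\<Sum>v\<in>\<sigma>. q v - m)"
    have T: "0 < T"
    proof -
      have "0 \<le> T" unfolding T_def using m_le by (intro sum_nonneg) auto
      moreover have "T \<noteq> 0"
      proof
        assume "T = 0"
        then have "\<forall>v\<in>\<sigma>. q v - m = 0"
          unfolding T_def by (subst (asm) sum_nonneg_eq_0_iff) (use \<sigma> m_le in auto)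
        then have "q v = q w" if "v \<in> \<sigma>" for v using that w by force
        then have "p i = 0" if "i < n" for i
          using qe[OF that] e_in[OF that] by (metis q_def)
        then show False using p1[of n] by simp
      qed
      ultimately show ?thesis by simp
    qed
    define x where "x v = of_bool (v \<in> \<sigma>) * (q v - m) / T" for v
    have xs: "{v. x v \<noteq> 0} \<subseteq> \<sigma>" by (auto simp: x_def)
    have "(\<Sum>v\<in>\<sigma>. x v) = (\<Sum>v\<in>\<sigma>. q v - m) / T"
      by (simp add: x_def sum_divide_distrib)
    then have "(\<Sum>v\<in>\<sigma>. x v) = 1" using T by (simp add: T_def[symmetric])
    moreover have "0 \<le> x v" for v using m_le[of v] T by (simp add: x_def)
    moreover have "x u = 0" using u by (simp add: x_def)
    ultimately have x: "x \<in> ?A"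
      using realization_iff[OF \<sigma>(1) xs] xs u T by auto
    have Lx: "L x i = p i / T" for i
    proof (cases "i < n")
      case True
      then show ?thesis using e_in[OF True] w qe[OF True]
        by (simp add: L_def simplex_coord_def x_def q_def[of w] flip: diff_divide_distrib add_divide_distrib)
    qed (use p0 in \<open>simp add: L_def simplex_coord_def\<close>)
    have "(N x)\<^sup>2 = (\<Sum>i<n. (p i)\<^sup>2) / T\<^sup>2"
      by (simp add: N_def Lx sum_nonneg power_divide sum_divide_distrib)
    then have "(N x)\<^sup>2 = (1 / T)\<^sup>2" using p1[of n] by (simp add: power_divide)
    then have "N x = 1 / T" using T N0[OF x] by (simp add: power2_eq_iff_nonneg)
    then have "\<phi> x = p" using T by (simp add: \<phi>_def Lx fun_eq_iff)
    then show "p \<in> \<phi> ` ?A" using x by blast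
  qed
  show ?thesis
    using that[OF cont] inj im surj by (force simp: bij_betw_def)
qed

section \<open>Wedges and sphere attachments\<close>

lemma continuous_map_wedge_incl:
  assumes "i \<in> I" shows "continuous_map (X i) (wedge I X b) (wedge_incl b i)"
  using assms by (auto simp: continuous_map_def topspace_wedge openin_wedge)

text \<open>Universal property of the wedge. The condition at \<open>None\<close> secures the base
  point when there is no summand.\<close>

lemma continuous_map_from_wedge:
  assumes "\<And>i. i \<in> I \<Longrightarrow> continuous_map (X i) Z (g \<circ> wedge_incl b i)" and "g None \<in> topspace Z"
  shows "continuous_map (wedge I X b) Z g"
  unfolding continuous_map_def
proof (intro conjI allI impI)
  show "g \<in> topspace (wedge I X b) \<rightarrow> topspace Z"
    using assms by (force simp: topspace_wedge continuous_map_def Pi_iff)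
  fix U assume U: "openin Z U"
  show "openin (wedge I X b) {x \<in> topspace (wedge I X b). g x \<in> U}"
    unfolding openin_wedge
  proof (intro conjI ballI)
    show "{x \<in> topspace (wedge I X b). g x \<in> U} \<subseteq> insert None (\<Union>i\<in>I. wedge_incl b i ` topspace (X i))"
      by (auto simp: topspace_wedge)
    fix i assume i: "i \<in> I"
    have "{x \<in> topspace (X i). wedge_incl b i x \<in> {x \<in> topspace (wedge I X b). g x \<in> U}}
        = {x \<in> topspace (X i). (g \<circ> wedge_incl b i) x \<in> U}"
      using i by (auto simp: topspace_wedge)
    then show "openin (X i) {x \<in> topspace (X i). wedge_incl b i x \<in> {x \<in> topspace (wedge I X b). g x \<in> U}}"
      using openin_continuous_map_preimage[OF assms(1)[OF i] U] by simp
  qed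
qed

lemma subtopology_wedge_insert:
  assumes "j \<notin> I"
  shows "subtopology (wedge (insert j I) X b) (topspace (wedge I X b)) = wedge I X b"
  unfolding topology_eq
proof (intro allI iffI)
  let ?T = "topspace (wedge I X b)"
  fix U assume "openin (subtopology (wedge (insert j I) X b) ?T) U"
  then obtain V where V: "openin (wedge (insert j I) X b) V" "U = V \<inter> ?T"
    by (auto simp: openin_subtopology)
  have "{x \<in> topspace (X i). wedge_incl b i x \<in> U} = {x \<in> topspace (X i). wedge_incl b i x \<in> V}"
    if "i \<in> I" for i
    using that V(2) by (auto simp: topspace_wedge)
  then show "openin (wedge I X b) U"
    using V by (auto simp: openin_wedge topspace_wedge)
next
  let ?T = "topspace (wedge I X b)"
  fix U assume U: "openin (wedge I X b) U"
  then have sub: "U \<subseteq> ?T" by (rule openin_subset)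
  \<comment> \<open>An open set around the base point has to contain a neighbourhood of the base
    point in the new summand; taking the whole summand is the simplest extension.\<close>
  define V where "V = (if None \<in> U then U \<union> wedge_incl b j ` topspace (X j) else U)"
  have TV: "U = V \<inter> ?T"
    using sub assms by (auto simp: V_def topspace_wedge wedge_incl_def split: if_splits)
  have "openin (wedge (insert j I) X b) V"
    unfolding openin_wedge
  proof (intro conjI ballI)
    show "V \<subseteq> insert None (\<Union>i\<in>insert j I. wedge_incl b i ` topspace (X i))"
      using sub by (auto simp: V_def topspace_wedge)
    fix i assume i: "i \<in> insert j I"
    show "openin (X i) {x \<in> topspace (X i). wedge_incl b i x \<in> V}"
    proof (cases "i = j")
      case True
      have "{x \<in> topspace (X i). wedge_incl b i x \<in> V} = (if None \<in> U then topspace (X i) else {})"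
        using sub assms True by (auto simp: V_def topspace_wedge wedge_incl_def split: if_splits)
      then show ?thesis by simp
    next
      case False
      then have "{x \<in> topspace (X i). wedge_incl b i x \<in> V} = {x \<in> topspace (X i). wedge_incl b i x \<in> U}"
        by (auto simp: V_def wedge_incl_def split: if_splits)
      then show ?thesis using U i False by (auto simp: openin_wedge)
    qed
  qed
  then show "openin (subtopology (wedge (insert j I) X b) ?T) U"
    using TV by (auto simp: openin_subtopology)
qed

lemma closedin_wedge_insert:
  assumes "j \<notin> I" "closedin (X j) {b j}"
  shows "closedin (wedge (insert j I) X b) (topspace (wedge I X b))"
proof -
  let ?W = "wedge (insert j I) X b" and ?T = "topspace (wedge I X b)"
  have eq: "topspace ?W - ?T = Some ` ({j} \<times> (topspace (X j) - {b j}))"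
    using assms(1) by (auto simp: topspace_wedge wedge_incl_def split: if_splits)
  have "openin ?W (topspace ?W - ?T)"
    unfolding openin_wedge
  proof (intro conjI ballI)
    show "topspace ?W - ?T \<subseteq> insert None (\<Union>i\<in>insert j I. wedge_incl b i ` topspace (X i))"
      by (auto simp: topspace_wedge)
    fix i assume i: "i \<in> insert j I"
    have "{x \<in> topspace (X i). wedge_incl b i x \<in> topspace ?W - ?T} =
        (if i = j then topspace (X j) - {b j} else {})"
      unfolding eq using i by (auto simp: wedge_incl_def)
    then show "openin (X i) {x \<in> topspace (X i). wedge_incl b i x \<in> topspace ?W - ?T}"
      using assms(2) by (auto simp: closedin_def)
  qed
  then show ?thesis
    by (auto simp: closedin_def topspace_wedge)
qed

text \<open>Collapsing all summands but one is continuous, and distinct points of the wedge stay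
  distinct under one of these collapses. This reduces separation to a single summand.\<close>

lemma Hausdorff_space_wedge:
  assumes "\<And>i. i \<in> I \<Longrightarrow> Hausdorff_space (X i)" and b: "\<And>i. i \<in> I \<Longrightarrow> b i \<in> topspace (X i)"
  shows "Hausdorff_space (wedge I X b)"
  unfolding Hausdorff_space_def
proof (intro allI impI)
  fix x y assume xy: "x \<in> topspace (wedge I X b) \<and> y \<in> topspace (wedge I X b) \<and> x \<noteq> y"
  define r where "r i z = (case z of None \<Rightarrow> b i | Some (k, u) \<Rightarrow> if k = i then u else b i)" for i z
  have r: "continuous_map (wedge I X b) (X i) (r i)" if i: "i \<in> I" for i
  proof (rule continuous_map_from_wedge)
    fix k assume "k \<in> I"
    show "continuous_map (X k) (X i) (r i \<circ> wedge_incl b k)"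
    proof (cases "k = i")
      case True
      show ?thesis
        by (rule continuous_map_eq[of _ _ id]) (auto simp: True r_def wedge_incl_def)
    next
      case False
      show ?thesis
        by (rule continuous_map_eq[of _ _ "\<lambda>_. b i"]) (auto simp: False r_def wedge_incl_def b i)
    qed
  qed (simp add: r_def b i)
  have "\<exists>i\<in>I. r i x \<noteq> r i y"
    using xy by (fastforce simp: topspace_wedge wedge_incl_def r_def split: if_splits)
  then obtain i where i: "i \<in> I" "r i x \<noteq> r i y" by blast
  have "r i x \<in> topspace (X i)" "r i y \<in> topspace (X i)"
    using r[OF i(1)] xy by (auto simp: continuous_map_def Pi_iff)
  then obtain U V where UV: "openin (X i) U" "openin (X i) V" "r i x \<in> U" "r i y \<in> V" "disjnt U V"
    using assms(1)[OF i(1)] i(2) unfolding Hausdorff_space_def by blast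
  let ?P = "\<lambda>U. {z \<in> topspace (wedge I X b). r i z \<in> U}"
  have "openin (wedge I X b) (?P U)" "openin (wedge I X b) (?P V)"
    using openin_continuous_map_preimage[OF r[OF i(1)]] UV by blast+
  moreover have "x \<in> ?P U" "y \<in> ?P V" "disjnt (?P U) (?P V)"
    using UV xy by (auto simp: disjnt_def)
  ultimately show "\<exists>U V. openin (wedge I X b) U \<and> openin (wedge I X b) V \<and> x \<in> U \<and> y \<in> V \<and> disjnt U V"
    by blast
qed

section \<open>Spheres in polar coordinates about the base point\<close>

lemma nsphere_eq_top_of_set:
  "nsphere n = top_of_set {x. (\<Sum>i\<le>n. (x i)\<^sup>2) = 1 \<and> (\<forall>i>n. x i = 0)}"
  by (simp add: nsphere euclidean_product_topology)

lemma Hausdorff_nsphere: "Hausdorff_space (nsphere n)"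
  by (simp add: nsphere_eq_top_of_set Hausdorff_space_subtopology)

text \<open>Polar coordinates: the point at angle \<open>pi * s\<close> from the base point in
  direction \<open>u\<close>. All of \<open>s = 0\<close> is the base point and all of
  \<open>s = 1\<close> its antipode, so a sphere is a point with a cone over a lower sphere attached
  by a constant map.\<close>

definition sphere_cone :: "real \<times> (nat \<Rightarrow> real) \<Rightarrow> nat \<Rightarrow> real" where
  "sphere_cone = (\<lambda>(s, u) i. case i of 0 \<Rightarrow> cos (pi * s) | Suc k \<Rightarrow> sin (pi * s) * u k)"

lemma sphere_cone_in:
  assumes "u \<in> topspace (nsphere m)" shows "sphere_cone (s, u) \<in> topspace (nsphere (Suc m))"
proof -
  have "(\<Sum>i\<le>Suc m. (sphere_cone (s, u) i)\<^sup>2) = (cos (pi * s))\<^sup>2 + (\<Sum>i\<le>m. (sin (pi * s))\<^sup>2 * (u i)\<^sup>2)"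
    by (subst sum.atMost_Suc_shift) (simp add: sphere_cone_def power_mult_distrib)
  also have "\<dots> = (cos (pi * s))\<^sup>2 + (sin (pi * s))\<^sup>2 * (\<Sum>i\<le>m. (u i)\<^sup>2)"
    by (simp add: sum_distrib_left)
  also have "\<dots> = 1" using assms by (simp add: nsphere)
  finally show ?thesis
    using assms by (auto simp: nsphere sphere_cone_def split: nat.split)
qed

lemma continuous_on_sphere_cone: "continuous_on S sphere_cone"
proof (rule continuous_on_coordinatewise_then_product)
  fix i
  have 1: "continuous_on S (\<lambda>z :: real \<times> (nat \<Rightarrow> real). snd z k)" for k
    by (rule continuous_on_product_then_coordinatewise[OF continuous_on_snd[OF continuous_on_id]])
  show "continuous_on S (\<lambda>z. sphere_cone z i)"
    unfolding sphere_cone_def case_prod_beta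
    by (cases i) (auto intro!: continuous_on_mult continuous_on_cos continuous_on_sin continuous_on_fst 1)
qed

lemma sphere_cone_eq_base:
  assumes "u \<in> topspace (nsphere m)" "0 \<le> s" "s \<le> 1"
  shows "sphere_cone (s, u) = sphere_base \<longleftrightarrow> s = 0"
proof
  assume "sphere_cone (s, u) = sphere_base"
  then have "cos (pi * s) = cos 0"
    by (metis (no_types, lifting) case_prod_conv cos_zero nat.case(1) sphere_base_def sphere_cone_def)
  then have "pi * s = 0"
    using assms by - (rule cos_inj_pi, simp_all add: mult_left_le)
  then show "s = 0" by simp
qed (auto simp: sphere_cone_def sphere_base_def fun_eq_iff split: nat.split)

lemma sphere_cone_inj:
  assumes "u \<in> topspace (nsphere m)" "u' \<in> topspace (nsphere m)" "0 < s" "s \<le> 1" "0 < s'" "s' \<le> 1"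
    "sphere_cone (s, u) = sphere_cone (s', u')"
  shows "s = s' \<and> (s = 1 \<or> u = u')"
proof -
  have "cos (pi * s) = cos (pi * s')"
    using fun_cong[OF assms(7), of 0] by (simp add: sphere_cone_def)
  then have "pi * s = pi * s'"
    using assms by - (rule cos_inj_pi, simp_all add: mult_left_le)
  then have ss: "s = s'" by simp
  moreover have "u = u'" if "s \<noteq> 1"
  proof
    fix k
    have "0 < sin (pi * s)" using assms that by (intro sin_gt_zero) auto
    then show "u k = u' k" using fun_cong[OF assms(7), of "Suc k"] ss by (simp add: sphere_cone_def)
  qed
  ultimately show ?thesis by blast
qed

lemma sphere_cone_surj:
  assumes y: "y \<in> topspace (nsphere (Suc m))" "y \<noteq> sphere_base"
  obtains s u where "0 < s" "s \<le> 1" "u \<in> topspace (nsphere m)" "y = sphere_cone (s, u)"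
proof -
  have sum: "(y 0)\<^sup>2 + (\<Sum>i\<le>m. (y (Suc i))\<^sup>2) = 1" and off: "y i = 0" if "i > Suc m" for i
    using y(1) that by (auto simp: nsphere sum.atMost_Suc_shift simp del: sum.atMost_Suc)
  have "(y 0)\<^sup>2 \<le> 1"
    using sum[of "Suc (Suc m)"] sum_nonneg[of "{..m}" "\<lambda>i. (y (Suc i))\<^sup>2"] by simp
  then have y0: "-1 \<le> y 0" "y 0 \<le> 1" by (auto simp: abs_square_le_1 abs_le_iff)
  define s where "s = arccos (y 0) / pi"
  have c: "cos (pi * s) = y 0" using y0 by (simp add: s_def)
  have s: "0 \<le> s" "s \<le> 1" using arccos_bounded[OF y0] by (auto simp: s_def divide_le_eq_1)
  have sc: "(sin (pi * s))\<^sup>2 = (\<Sum>i\<le>m. (y (Suc i))\<^sup>2)"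
    using sum[of "Suc (Suc m)"] c by (simp add: sin_squared_eq)
  have s0: "s \<noteq> 0"
  proof
    assume "s = 0"
    then have "(\<Sum>i\<le>m. (y (Suc i))\<^sup>2) = 0" using sc by simp
    then have "y (Suc i) = 0" for i
      using off[of "Suc i"] by (cases "i \<le> m") (simp_all add: sum_nonneg_eq_0_iff)
    then have "y = sphere_base"
      using c \<open>s = 0\<close> by (auto simp: sphere_base_def fun_eq_iff gr0_conv_Suc)
    then show False using y by simp
  qed
  show ?thesis
  proof (cases "s = 1")
    case True
    then have "(\<Sum>i\<le>m. (y (Suc i))\<^sup>2) = 0" using sc by simp
    then have z: "y (Suc i) = 0" for i
      using off[of "Suc i"] by (cases "i \<le> m") (simp_all add: sum_nonneg_eq_0_iff)
    \<comment> \<open>At the antipode the direction is arbitrary.\<close>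
    have "y = sphere_cone (s, sphere_base)"
      using c z True by (auto simp: sphere_cone_def fun_eq_iff split: nat.split)
    then show ?thesis using that[of s sphere_base] s s0 sphere_base_in_nsphere[of m] by simp
  next
    case False
    then have sp: "0 < sin (pi * s)" using s s0 by (intro sin_gt_zero) auto
    define u where "u i = y (Suc i) / sin (pi * s)" for i
    have "(\<Sum>i\<le>m. (u i)\<^sup>2) = (\<Sum>i\<le>m. (y (Suc i))\<^sup>2) / (sin (pi * s))\<^sup>2"
      by (simp add: u_def power_divide sum_divide_distrib)
    then have "(\<Sum>i\<le>m. (u i)\<^sup>2) = 1"
      using sp by (simp add: sc[symmetric])
    moreover have "u i = 0" if "m < i" for i
      using off[of "Suc i"] that by (simp add: u_def)
    ultimately have "u \<in> topspace (nsphere m)"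
      by (simp add: nsphere)
    moreover have "y = sphere_cone (s, u)"
    proof
      fix i show "y i = sphere_cone (s, u) i"
        using c sp by (cases i) (simp_all add: sphere_cone_def u_def)
    qed
    moreover have "0 < s" using s s0 by simp
    ultimately show ?thesis using that s(2) by blast
  qed
qed

text \<open>Meridians, with fixed direction and \<open>s\<close> shrinking to 0, join every point to
  the common base point. Positive dimension excludes the 0-sphere, whose second point would be
  isolated.\<close>

lemma path_connected_wedge_of_spheres:
  assumes "\<And>i. i \<in> I \<Longrightarrow> 0 < d i"
  shows "path_connected_space (wedge_of_spheres I d)"
proof -
  let ?W = "wedge_of_spheres I d"
  have *: "path_component_of ?W None p" if "p \<in> topspace ?W" for p
  proof (cases "p = None")
    case True
    then show ?thesis using that by (simp add: path_component_of_refl)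
  next
    case False
    then have "p \<in> (\<Union>i\<in>I. wedge_incl (\<lambda>i. sphere_base) i ` topspace (nsphere (d i)))"
      using that by (simp add: wedge_of_spheres_def topspace_wedge) blast
    then obtain i y where iy: "i \<in> I" "y \<in> topspace (nsphere (d i))"
      "p = wedge_incl (\<lambda>i. sphere_base) i y"
      by blast
    then have "y \<noteq> sphere_base" using False by (auto simp: wedge_incl_def)
    obtain m where m: "d i = Suc m" using assms[OF iy(1)] gr0_conv_Suc by blast
    have "y \<in> topspace (nsphere (Suc m))" using iy(2) m by simp
    then obtain s u where su: "0 < s" "s \<le> 1" "u \<in> topspace (nsphere m)" "y = sphere_cone (s, u)"
      using \<open>y \<noteq> sphere_base\<close> by (rule sphere_cone_surj)
    have "continuous_map (top_of_set {0..1::real}) (nsphere (Suc m)) (\<lambda>t. sphere_cone (t * s, u))"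
    proof -
      have "continuous_on {0..1} (\<lambda>t. sphere_cone (t * s, u))"
        by (rule continuous_on_compose2[OF continuous_on_sphere_cone[of UNIV]])
           (auto intro!: continuous_intros)
      then show ?thesis
        using sphere_cone_in[OF su(3)] by (auto simp: nsphere_eq_top_of_set)
    qed
    then have "continuous_map (top_of_set {0..1::real}) (nsphere (d i)) (\<lambda>t. sphere_cone (t * s, u))"
      using m by simp
    then have "continuous_map (top_of_set {0..1::real}) ?W
        (wedge_incl (\<lambda>i. sphere_base) i \<circ> (\<lambda>t. sphere_cone (t * s, u)))"
      unfolding wedge_of_spheres_def
      by (rule continuous_map_compose[OF _ continuous_map_wedge_incl[OF iy(1)]])
    then have "pathin ?W (wedge_incl (\<lambda>i. sphere_base) i \<circ> (\<lambda>t. sphere_cone (t * s, u)))"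
      unfolding pathin_def .
    moreover have "wedge_incl (\<lambda>i. sphere_base) i (sphere_cone (0 * s, u)) = None"
      using sphere_cone_eq_base[OF su(3), of 0] by (simp add: wedge_incl_def)
    moreover have "wedge_incl (\<lambda>i. sphere_base) i (sphere_cone (1 * s, u)) = p"
      using su(4) iy(3) by simp
    ultimately show ?thesis
      unfolding path_component_of_def
      by (intro exI[of _ "wedge_incl (\<lambda>i. sphere_base) i \<circ> (\<lambda>t. sphere_cone (t * s, u))"]) simp
  qed
  have "path_component_of ?W x y" if "x \<in> topspace ?W" "y \<in> topspace ?W" for x y
    by (rule path_component_of_trans[OF path_component_of_sym[OF *[OF that(1)]] *[OF that(2)]])
  then show ?thesis
    unfolding path_connected_space_iff_path_component by simp
qed

section \<open>Attaching a simplex along a null-homotopic boundary\<close>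

lemma Hausdorff_top_of_set_fun: "Hausdorff_space (top_of_set (S :: ('a \<Rightarrow> real) set))"
  using Hausdorff_space_product_topology[of "\<lambda>_. euclideanreal" "UNIV :: 'a set"]
  by (simp add: euclidean_product_topology Hausdorff_space_subtopology)

lemma wedge_of_spheres_cong:
  assumes "\<And>i. i \<in> I \<Longrightarrow> d i = d' i" shows "wedge_of_spheres I d = wedge_of_spheres I d'"
  unfolding wedge_of_spheres_def wedge_def
  using assms by (simp cong: SUP_cong ball_cong)

lemma realization_insert_subtopology:
  "subtopology (top_of_set (realization (insert \<sigma> F))) (realization F) = top_of_set (realization F)"
  using realization_mono[of F "insert \<sigma> F"] by (simp add: subtopology_subtopology Int_absorb1 subset_insertI)

text \<open>Adding a simplex whose proper faces are present cones off its boundary from the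
  barycentre. The old realization is closed in the new one, being the set where some coordinate of
  \<open>\<sigma>\<close> vanishes.\<close>

lemma face_cone_attachment:
  assumes F: "\<And>I J. I \<in> F \<Longrightarrow> J \<subseteq> I \<Longrightarrow> J \<in> F"
    and \<sigma>: "finite \<sigma>" "2 \<le> card \<sigma>" "\<sigma> \<notin> F" "\<And>J. J \<subset> \<sigma> \<Longrightarrow> J \<in> F"
  shows "cone_attachment (top_of_set (realization (insert \<sigma> F))) (realization F)
    (top_of_set (realization (Pow \<sigma> - {\<sigma>}))) (face_cone \<sigma>)"
proof
  let ?X = "realization (insert \<sigma> F)" and ?A = "realization (Pow \<sigma> - {\<sigma>})"
  have ne: "\<sigma> \<noteq> {}" using \<sigma> by auto
  have AF: "?A \<subseteq> realization F" using \<sigma> by (intro realization_mono) auto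
  have \<sigma>F: "realization {\<sigma>} \<subseteq> ?X" by (intro realization_mono) auto
  have FX: "realization F \<subseteq> ?X" by (intro realization_mono) auto
  show "Hausdorff_space (top_of_set ?X)" by (rule Hausdorff_top_of_set_fun)
  have "realization F = ?X \<inter> (\<Union>v\<in>\<sigma>. {x. x v = 0})"
  proof (rule equalityI; rule subsetI)
    fix x assume x: "x \<in> realization F"
    then have "\<not> \<sigma> \<subseteq> {v. x v \<noteq> 0}" using F \<sigma>(3) by (auto simp: realization_def)
    then show "x \<in> ?X \<inter> (\<Union>v\<in>\<sigma>. {x. x v = 0})" using x FX by auto
  next
    fix x assume "x \<in> ?X \<inter> (\<Union>v\<in>\<sigma>. {x. x v = 0})"
    then show "x \<in> realization F" by (auto simp: realization_def)
  qed
  moreover have "closed (\<Union>v\<in>\<sigma>. {x :: 'a \<Rightarrow> real. x v = 0})"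
    using \<sigma> by (intro closed_UN ballI closed_Collect_eq continuous_intros)
  ultimately show "closedin (top_of_set ?X) (realization F)"
    by (metis closedin_closed)
  show "compact_space (top_of_set ?A)"
    using compact_realization_boundary[OF \<sigma>(1)] by (simp add: compact_space_subtopology)
  have in_X: "face_cone \<sigma> (s, a) \<in> ?X" if "a \<in> ?A" "0 \<le> s" "s \<le> 1" for s a
    using face_cone_in[OF \<sigma>(1) ne that] AF \<sigma>F FX by (auto split: if_splits)
  then show "continuous_map (prod_topology unit_interval (top_of_set ?A)) (top_of_set ?X) (face_cone \<sigma>)"
    using continuous_on_face_cone by (auto simp: Pi_iff)
  show "face_cone \<sigma> (0, a) \<in> realization F" if "a \<in> topspace (top_of_set ?A)" for a
    using face_cone_in[OF \<sigma>(1) ne, of a 0] that AF by auto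
  show "topspace (top_of_set ?X) \<subseteq> realization F \<union> face_cone \<sigma> ` ({0<..1} \<times> topspace (top_of_set ?A))"
  proof
    fix x assume "x \<in> topspace (top_of_set ?X)"
    then consider "x \<in> realization F" | "x \<in> realization {\<sigma>}" by (auto simp: realization_def)
    then show "x \<in> realization F \<union> face_cone \<sigma> ` ({0<..1} \<times> topspace (top_of_set ?A))"
    proof cases
      case 2
      then obtain s a where "0 < s" "s \<le> 1" "a \<in> ?A" "x = face_cone \<sigma> (s, a)"
        using face_cone_surj[OF \<sigma>(1,2)] by blast
      then show ?thesis by auto
    qed simp
  qed
  show "face_cone \<sigma> (s, a) \<notin> realization F"
    if "a \<in> topspace (top_of_set ?A)" "0 < s" "s \<le> 1" for a s
    using face_cone_in[OF \<sigma>(1) ne, of a s] that \<sigma>(3) by (auto simp: realization_def)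
  show "s = s' \<and> (s = 1 \<or> a = a')"
    if "a \<in> topspace (top_of_set ?A)" "a' \<in> topspace (top_of_set ?A)" "s \<le> 1" "s' \<le> 1"
      "face_cone \<sigma> (s, a) = face_cone \<sigma> (s', a')" for a a' s s'
    by (rule face_cone_inj[OF \<sigma>(1) ne]) (use that in simp_all)
  show "face_cone \<sigma> (1, a) = face_cone \<sigma> (1, a')" for a a'
    by (simp add: face_cone_def)
qed

lemma sphere_base_closed: "closedin (nsphere n) {sphere_base}"
  using Hausdorff_nsphere sphere_base_in_nsphere by (metis closedin_Hausdorff_singleton)

text \<open>The new sphere is a cone attached by the constant map to the base point. Parametrising
  its directions by \<open>A\<close> through \<open>\<phi>\<close> allows the comparison with a
  simplex, which is a cone over the same \<open>A\<close>.\<close>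

lemma wedge_of_spheres_cone_attachment:
  assumes j: "j \<notin> I" "d j = Suc m"
    and A: "compact_space A" "topspace A \<noteq> {}"
    and \<phi>: "continuous_map A (nsphere m) \<phi>" "bij_betw \<phi> (topspace A) (topspace (nsphere m))"
  shows "cone_attachment (wedge_of_spheres (insert j I) d) (topspace (wedge_of_spheres I d)) A
    (\<lambda>(s, a). wedge_incl (\<lambda>_. sphere_base) j (sphere_cone (s, \<phi> a)))"
proof
  let ?W = "wedge_of_spheres (insert j I) d" and ?B = "topspace (wedge_of_spheres I d)"
  let ?incl = "wedge_incl (\<lambda>_. sphere_base) j"
  let ?c = "\<lambda>(s, a). ?incl (sphere_cone (s, \<phi> a))"
  have \<phi>_in: "\<phi> a \<in> topspace (nsphere m)" if "a \<in> topspace A" for a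
    using bij_betwE[OF \<phi>(2)] that by blast
  show "Hausdorff_space ?W"
    unfolding wedge_of_spheres_def
    by (rule Hausdorff_space_wedge) (auto simp: Hausdorff_nsphere sphere_base_in_nsphere)
  show "closedin ?W ?B"
    unfolding wedge_of_spheres_def by (rule closedin_wedge_insert) (auto simp: j sphere_base_closed)
  show "compact_space A" by fact
  show "continuous_map (prod_topology unit_interval A) ?W ?c"
  proof -
    have 1: "continuous_map (prod_topology unit_interval (nsphere m)) (nsphere (Suc m)) sphere_cone"
      using sphere_cone_in[of _ m] continuous_on_sphere_cone
      by (auto simp: nsphere_eq_top_of_set Pi_iff)
    have 2: "continuous_map (prod_topology unit_interval A) (prod_topology unit_interval (nsphere m))
        (\<lambda>z. (fst z, \<phi> (snd z)))"
      by (intro continuous_map_pairedI continuous_map_fst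
            continuous_map_compose[OF continuous_map_snd \<phi>(1), unfolded o_def])
    have 3: "continuous_map (nsphere (Suc m)) ?W ?incl"
      using continuous_map_wedge_incl[of j "insert j I" "\<lambda>i. nsphere (d i)" "\<lambda>_. sphere_base"] j
      by (simp add: wedge_of_spheres_def)
    show ?thesis
      using continuous_map_compose[OF continuous_map_compose[OF 2 1] 3]
      by (simp add: o_def case_prod_beta')
  qed
  show "?c (0, a) \<in> ?B" if "a \<in> topspace A" for a
    using sphere_cone_eq_base[OF \<phi>_in[OF that], of 0]
    by (simp add: wedge_incl_def wedge_of_spheres_def topspace_wedge)
  have nB: "?c (s, a) = Some (j, sphere_cone (s, \<phi> a))" if "a \<in> topspace A" "0 < s" "s \<le> 1" for s a
    using sphere_cone_eq_base[OF \<phi>_in[OF that(1)], of s] that by (simp add: wedge_incl_def)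
  show "?c (s, a) \<notin> ?B" if "a \<in> topspace A" "0 < s" "s \<le> 1" for a s
    using nB[OF that] j
    by (auto simp: wedge_incl_def wedge_of_spheres_def topspace_wedge split: if_splits)
  show "topspace ?W \<subseteq> ?B \<union> ?c ` ({0<..1} \<times> topspace A)"
  proof
    fix p assume p: "p \<in> topspace ?W"
    show "p \<in> ?B \<union> ?c ` ({0<..1} \<times> topspace A)"
    proof (cases "p \<in> ?B")
      case False
      then obtain y where y: "y \<in> topspace (nsphere (d j))" "p = ?incl y"
        using p by (auto simp: wedge_of_spheres_def topspace_wedge)
      then have "y \<noteq> sphere_base" using False
        by (auto simp: wedge_incl_def wedge_of_spheres_def topspace_wedge)
      moreover have "y \<in> topspace (nsphere (Suc m))" using y j by simp
      ultimately obtain s u where su: "0 < s" "s \<le> 1" "u \<in> topspace (nsphere m)" "y = sphere_cone (s, u)"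
        using sphere_cone_surj by blast
      then obtain a where "a \<in> topspace A" "u = \<phi> a"
        using bij_betw_imp_surj_on[OF \<phi>(2)] by blast
      then have "p = ?c (s, a)" "(s, a) \<in> {0<..1} \<times> topspace A" using su y by auto
      then show ?thesis by blast
    qed simp
  qed
  show "s = s' \<and> (s = 1 \<or> a = a')"
    if "a \<in> topspace A" "a' \<in> topspace A" "0 < s" "s \<le> 1" "0 < s'" "s' \<le> 1" "?c (s, a) = ?c (s', a')"
    for a a' s s'
  proof -
    have "sphere_cone (s, \<phi> a) = sphere_cone (s', \<phi> a')"
      using that(7) nB[OF that(1,3,4)] nB[OF that(2,5,6)] by simp
    then have "s = s' \<and> (s = 1 \<or> \<phi> a = \<phi> a')"
      using sphere_cone_inj[OF \<phi>_in[OF that(1)] \<phi>_in[OF that(2)]] that by blast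
    then show ?thesis
      using bij_betw_imp_inj_on[OF \<phi>(2)] that by (auto dest: inj_onD)
  qed
  show "?c (1, a) = ?c (1, a')" if "a \<in> topspace A" "a' \<in> topspace A" for a a'
  proof -
    have "sphere_cone (1, \<phi> a) = sphere_cone (1, \<phi> a')"
      by (auto simp: sphere_cone_def fun_eq_iff split: nat.split)
    then show ?thesis by simp
  qed
qed

text \<open>Both sides are cones over the boundary of \<open>\<sigma>\<close> on homotopy equivalent
  bases: the simplex is attached by the inclusion, the sphere by a constant map. The null-homotopy
  makes the two attaching maps homotopic.\<close>

theorem sphere_attachment:
  assumes F: "\<And>I J. I \<in> F \<Longrightarrow> J \<subseteq> I \<Longrightarrow> J \<in> F"
    and \<sigma>: "card \<sigma> = Suc (Suc m)" "\<sigma> \<notin> F" "\<And>J. J \<subset> \<sigma> \<Longrightarrow> J \<in> F"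
    and null: "homotopic_with (\<lambda>_. True) (top_of_set (realization (Pow \<sigma> - {\<sigma>})))
      (top_of_set (realization F)) id (\<lambda>_. y)"
    and he: "top_of_set (realization F) homotopy_equivalent_space wedge_of_spheres I d"
    and d: "\<And>i. i \<in> I \<Longrightarrow> 0 < d i" and j: "j \<notin> I"
  shows "top_of_set (realization (insert \<sigma> F)) homotopy_equivalent_space
    wedge_of_spheres (insert j I) (d(j := Suc m))"
proof -
  have fin: "finite \<sigma>" using \<sigma>(1) by (intro card_ge_0_finite) simp
  let ?A = "top_of_set (realization (Pow \<sigma> - {\<sigma>}))" and ?d = "d(j := Suc m)"
  let ?W = "wedge_of_spheres I d"
  have W: "wedge_of_spheres I ?d = ?W"
    using j by (intro wedge_of_spheres_cong) auto
  have at: "cone_attachment (top_of_set (realization (insert \<sigma> F))) (realization F) ?A (face_cone \<sigma>)"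
    by (rule face_cone_attachment) (use F \<sigma> fin in auto)
  obtain \<phi> where \<phi>: "continuous_on (realization (Pow \<sigma> - {\<sigma>})) \<phi>"
    "bij_betw \<phi> (realization (Pow \<sigma> - {\<sigma>})) (topspace (nsphere m))"
    using boundary_sphere[OF fin \<sigma>(1)] by auto
  have \<phi>': "continuous_map ?A (nsphere m) \<phi>"
    using \<phi> bij_betwE[OF \<phi>(2)] by (auto simp: nsphere_eq_top_of_set)
  have ne: "topspace ?A \<noteq> {}"
    using \<phi>(2) sphere_base_in_nsphere[of m] by (auto simp: bij_betw_def)
  let ?c' = "\<lambda>(s, a). wedge_incl (\<lambda>_. sphere_base) j (sphere_cone (s, \<phi> a))"
  have at': "cone_attachment (wedge_of_spheres (insert j I) ?d) (topspace ?W) ?A ?c'"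
    unfolding W[symmetric]
    by (rule wedge_of_spheres_cone_attachment)
       (use j ne \<phi>' \<phi>(2) cone_attachment.compact_A[OF at] in auto)
  have sub: "subtopology (wedge_of_spheres (insert j I) ?d) (topspace ?W) = ?W"
    unfolding W[symmetric] unfolding wedge_of_spheres_def by (rule subtopology_wedge_insert[OF j])
  obtain h k where h: "continuous_map (top_of_set (realization F)) ?W h"
    and k: "continuous_map ?W (top_of_set (realization F)) k"
    and kh: "homotopic_with (\<lambda>_. True) (top_of_set (realization F)) (top_of_set (realization F)) (k \<circ> h) id"
    and hk: "homotopic_with (\<lambda>_. True) ?W ?W (h \<circ> k) id"
    using he unfolding homotopy_equivalent_space_def by blast
  have y: "y \<in> realization F"
    using continuous_map_funspace[OF conjunct2[OF homotopic_with_imp_continuous_maps[OF null]]] ne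
    by (auto simp del: topspace_euclidean_subtopology)
  have "homotopic_with (\<lambda>_. True) ?A ?W (h \<circ> id) (h \<circ> (\<lambda>_. y))"
    by (rule homotopic_with_compose_continuous_map_left[OF null h]) auto
  then have "homotopic_with (\<lambda>_. True) ?A ?W h (\<lambda>_. h y)"
    by (simp add: o_def)
  \<comment> \<open>The null-homotopy may end anywhere; path-connectedness of the wedge moves its
    end to the base point.\<close>
  moreover have "homotopic_with (\<lambda>_. True) ?A ?W (\<lambda>_. h y) (\<lambda>_. None)"
  proof -
    have "h y \<in> topspace ?W" using h y by (auto simp: continuous_map_def Pi_iff)
    moreover have "None \<in> topspace ?W" by (simp add: wedge_of_spheres_def topspace_wedge)
    ultimately have "path_component_of ?W (h y) None"
      using path_connected_wedge_of_spheres[OF d, of I] by (simp add: path_connected_space_iff_path_component)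
    then show ?thesis by (simp add: homotopic_constant_maps)
  qed
  ultimately have h0: "homotopic_with (\<lambda>_. True) ?A ?W h (\<lambda>_. None)"
    by (rule homotopic_with_trans)
  have hf: "homotopic_with (\<lambda>_. True) ?A ?W (\<lambda>a. h (face_cone \<sigma> (0, a))) (\<lambda>a. ?c' (0, a))"
  proof (rule homotopic_with_eq[OF h0])
    fix a assume "a \<in> topspace ?A"
    then have "\<phi> a \<in> topspace (nsphere m)" using bij_betwE[OF \<phi>(2)] by simp
    from sphere_cone_eq_base[OF this, of 0] show "?c' (0, a) = None"
      by (simp add: wedge_incl_def)
  qed (auto simp: face_cone_def)
  show ?thesis
    by (rule cone_attachment_homotopy_equivalent[OF at at'])
       (use h k kh hk hf in \<open>simp_all add: sub realization_insert_subtopology\<close>)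
qed

section \<open>Edge walks\<close>

text \<open>In \<open>walk_face\<close> the vertices need not be distinct; \<open>a = c\<close> allows backtracking.\<close>

inductive walk_equiv :: "'a set set \<Rightarrow> 'a list \<Rightarrow> 'a list \<Rightarrow> bool" for F where
  walk_refl: "walk_equiv F p p"
| walk_sym: "walk_equiv F p q \<Longrightarrow> walk_equiv F q p"
| walk_trans: "walk_equiv F p q \<Longrightarrow> walk_equiv F q r \<Longrightarrow> walk_equiv F p r"
| walk_stay: "walk_equiv F (xs @ a # a # ys) (xs @ a # ys)"
| walk_face: "{a, b, c} \<in> F \<Longrightarrow> walk_equiv F (xs @ a # b # c # ys) (xs @ a # c # ys)"

fun is_walk :: "'a set set \<Rightarrow> 'a list \<Rightarrow> bool" where
  "is_walk F [] = False"
| "is_walk F [a] = ({a} \<in> F)"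
| "is_walk F (a # b # l) = ({a, b} \<in> F \<and> is_walk F (b # l))"

section \<open>Walks as paths in the realization\<close>

definition vertex_point :: "'a \<Rightarrow> 'a \<Rightarrow> real" where
  "vertex_point a v = of_bool (v = a)"

definition edge_path :: "'a \<Rightarrow> 'a \<Rightarrow> real \<Rightarrow> 'a \<Rightarrow> real" where
  "edge_path a b t v = (1 - t) * vertex_point a v + t * vertex_point b v"

fun walk_path :: "'a list \<Rightarrow> real \<Rightarrow> 'a \<Rightarrow> real" where
  "walk_path [] = (\<lambda>_ _. 0)"
| "walk_path [a] = (\<lambda>_. vertex_point a)"
| "walk_path (a # b # l) = edge_path a b +++ walk_path (b # l)"

lemma vertex_point_in: "{a} \<in> F \<Longrightarrow> vertex_point a \<in> realization F"
  by (simp add: realization_def vertex_point_def)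

lemma edge_path_ends [simp]: "edge_path a b 0 = vertex_point a" "edge_path a b 1 = vertex_point b"
  by (auto simp: edge_path_def)

lemma path_edge_path: "path (edge_path a b)"
  unfolding path_def edge_path_def
  by (intro continuous_on_coordinatewise_then_product continuous_intros)

lemma pathstart_edge_path [simp]: "pathstart (edge_path a b) = vertex_point a"
  and pathfinish_edge_path [simp]: "pathfinish (edge_path a b) = vertex_point b"
  by (simp_all add: pathstart_def pathfinish_def)

lemma convex_realization_face:
  assumes x: "x \<in> realization (Pow \<sigma>)" and y: "y \<in> realization (Pow \<sigma>)" and "finite \<sigma>"
    and t: "0 \<le> t" "t \<le> 1"
  shows "(\<lambda>v. (1 - t) * x v + t * y v) \<in> realization (Pow \<sigma>)" (is "?z \<in> _")
proof -
  have sx: "{v. x v \<noteq> 0} \<subseteq> \<sigma>" and sy: "{v. y v \<noteq> 0} \<subseteq> \<sigma>"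
    using x y by (auto simp: realization_def)
  have nx: "0 \<le> x v" "0 \<le> y v" for v
    using x y by (auto simp: realization_def)
  have "?z v = 0" if "v \<notin> \<sigma>" for v
  proof -
    have "x v = 0" "y v = 0" using sx sy that by blast+
    then show ?thesis by simp
  qed
  then have s: "{v. ?z v \<noteq> 0} \<subseteq> \<sigma>" by blast
  have "(\<Sum>v\<in>\<sigma>. ?z v) = (1 - t) * (\<Sum>v\<in>\<sigma>. x v) + t * (\<Sum>v\<in>\<sigma>. y v)"
    by (simp add: sum.distrib sum_distrib_left)
  also have "\<dots> = 1"
    using x y realization_iff[OF \<open>finite \<sigma>\<close> sx] realization_iff[OF \<open>finite \<sigma>\<close> sy] by auto
  finally show ?thesis
    using realization_iff[OF \<open>finite \<sigma>\<close> s] s nx t by auto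
qed

lemma edge_path_in:
  assumes "0 \<le> t" "t \<le> 1" shows "edge_path a b t \<in> realization (Pow {a, b})"
proof -
  have "vertex_point a \<in> realization (Pow {a, b})" "vertex_point b \<in> realization (Pow {a, b})"
    by (simp_all add: vertex_point_in)
  from convex_realization_face[OF this _ assms] show ?thesis
    by (simp add: edge_path_def[abs_def])
qed

lemma path_image_edge_path: "path_image (edge_path a b) \<subseteq> realization (Pow {a, b})"
  unfolding path_image_def by (intro image_subsetI edge_path_in) simp_all

lemma homotopic_paths_const_left:
  fixes p :: "real \<Rightarrow> 'b::topological_space"
  assumes "path p" "path_image p \<subseteq> S"
  shows "homotopic_paths S ((\<lambda>_. pathstart p) +++ p) p"
proof (rule homotopic_paths_sym, rule homotopic_paths_reparametrize[OF assms])
  let ?f = "\<lambda>t::real. if t \<le> 1/2 then 0 else 2 * t - 1"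
  show "continuous_on {0..1} ?f" by (intro continuous_on_cases_le continuous_intros) auto
  show "?f \<in> {0..1} \<rightarrow> {0..1}" by auto
  show "((\<lambda>_. pathstart p) +++ p) t = p (?f t)" for t
    by (simp add: joinpaths_def pathstart_def)
qed auto

lemma homotopic_paths_const_right:
  fixes p :: "real \<Rightarrow> 'b::topological_space"
  assumes "path p" "path_image p \<subseteq> S"
  shows "homotopic_paths S (p +++ (\<lambda>_. pathfinish p)) p"
proof (rule homotopic_paths_sym, rule homotopic_paths_reparametrize[OF assms])
  let ?f = "\<lambda>t::real. if t \<le> 1/2 then 2 * t else 1"
  show "continuous_on {0..1} ?f" by (intro continuous_on_cases_le continuous_intros) auto
  show "?f \<in> {0..1} \<rightarrow> {0..1}" by auto
  show "(p +++ (\<lambda>_. pathfinish p)) t = p (?f t)" for t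
    by (simp add: joinpaths_def pathfinish_def)
qed auto

text \<open>A closed simplex is convex, so the linear homotopy stays inside it. The empty face
  supports no point, hence the difference with \<open>{{}}\<close>.\<close>

lemma homotopic_paths_in_face:
  assumes p: "path p" "path_image p \<subseteq> realization (Pow \<sigma>)"
    and q: "path q" "path_image q \<subseteq> realization (Pow \<sigma>)"
    and ends: "pathstart p = pathstart q" "pathfinish p = pathfinish q"
    and \<sigma>: "finite \<sigma>" "Pow \<sigma> - {{}} \<subseteq> F"
  shows "homotopic_paths (realization F) p q"
proof -
  have "{v. x v \<noteq> 0} \<noteq> {}" if "x \<in> realization (Pow \<sigma>)" for x
  proof
    assume "{v. x v \<noteq> 0} = {}"
    then have "(\<Sum>v | x v \<noteq> 0. x v) = 0" by (simp only: sum.empty)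
    then show False using that by (simp add: realization_def)
  qed
  then have "realization (Pow \<sigma>) = realization (Pow \<sigma> - {{}})"
    by (auto simp: realization_def)
  then have sub: "realization (Pow \<sigma>) \<subseteq> realization F" using realization_mono[OF \<sigma>(2)] by simp
  let ?h = "\<lambda>z v. (1 - fst z) * p (snd z) v + fst z * q (snd z) v"
  have pc: "continuous_on ({0..1} \<times> {0..1}) (\<lambda>z :: real \<times> real. p (snd z) v)" for v
    by (rule continuous_on_product_then_coordinatewise[OF continuous_on_compose2[OF p(1)[unfolded path_def]]])
       (auto intro: continuous_intros)
  have qc: "continuous_on ({0..1} \<times> {0..1}) (\<lambda>z :: real \<times> real. q (snd z) v)" for v
    by (rule continuous_on_product_then_coordinatewise[OF continuous_on_compose2[OF q(1)[unfolded path_def]]])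
       (auto intro: continuous_intros)
  show ?thesis
    unfolding homotopic_paths
  proof (intro exI conjI ballI)
    show "continuous_on ({0..1} \<times> {0..1}) ?h"
      by (intro continuous_on_coordinatewise_then_product continuous_intros pc qc)
    have "?h (t, s) \<in> realization (Pow \<sigma>)" if "0 \<le> t" "t \<le> 1" "0 \<le> s" "s \<le> 1" for t s
    proof -
      have "p s \<in> realization (Pow \<sigma>)" "q s \<in> realization (Pow \<sigma>)"
        using p(2) q(2) that by (auto simp: path_image_def)
      then show ?thesis using convex_realization_face[OF _ _ \<sigma>(1) that(1,2)] by simp
    qed
    then show "?h \<in> {0..1} \<times> {0..1} \<rightarrow> realization F" using sub by auto
    fix t
    show "pathstart (?h \<circ> Pair t) = pathstart p" "pathfinish (?h \<circ> Pair t) = pathfinish p"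
      using ends by (auto simp: pathstart_def pathfinish_def fun_eq_iff algebra_simps)
  qed auto
qed

context
  fixes F :: "'a set set"
  assumes closed: "\<And>I J. I \<in> F \<Longrightarrow> J \<subseteq> I \<Longrightarrow> J \<in> F"
begin

lemma face_sub: "I \<in> F \<Longrightarrow> realization (Pow I) \<subseteq> realization F"
  using closed by (intro realization_mono) blast

lemma walk_path_facts:
  assumes "is_walk F w"
  shows "path (walk_path w)" "path_image (walk_path w) \<subseteq> realization F"
    "pathstart (walk_path w) = vertex_point (hd w)"
proof -
  have "path (walk_path w) \<and> path_image (walk_path w) \<subseteq> realization F
      \<and> pathstart (walk_path w) = vertex_point (hd w)"
    using assms
  proof (induction w rule: induct_list012)
    case (2 a)
    then show ?case
      by (auto simp: path_def path_image_def pathstart_def vertex_point_in)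
  next
    case (3 a b l)
    have "{a, b} \<in> F" and w: "is_walk F (b # l)" using 3(3) by simp_all
    then have "path_image (edge_path a b) \<subseteq> realization F"
      using subset_trans[OF path_image_edge_path face_sub] by blast
    then show ?case
      using 3(2)[OF w] path_edge_path[of a b] by (simp add: subset_path_image_join)
  qed simp
  then show "path (walk_path w)" "path_image (walk_path w) \<subseteq> realization F"
    "pathstart (walk_path w) = vertex_point (hd w)" by auto
qed

text \<open>The relation \<open>walk_equiv\<close> also passes through lists that are not walks, so
  the invariant records that both lists are walks or neither is. The common head allows a vertex to
  be prepended to both; the case \<open>p = q\<close> admits the empty list.\<close>

definition walks_homotopic :: "'a list \<Rightarrow> 'a list \<Rightarrow> bool" where
  "walks_homotopic p q \<longleftrightarrow> (p = q \<or> p \<noteq> [] \<and> q \<noteq> [] \<and> hd p = hd q) \<and> (is_walk F p \<longleftrightarrow> is_walk F q) \<and>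
     (is_walk F p \<longrightarrow> homotopic_paths (realization F) (walk_path p) (walk_path q))"

lemma walks_homotopic_Cons:
  assumes "walks_homotopic p q" shows "walks_homotopic (a # p) (a # q)"
proof (cases "p = q")
  case True
  then show ?thesis using walk_path_facts[of "a # p"] by (auto simp: walks_homotopic_def)
next
  case False
  then obtain b p' q' where pq: "p = b # p'" "q = b # q'"
    using assms by (metis list.collapse walks_homotopic_def)
  have "homotopic_paths (realization F) (walk_path (a # p)) (walk_path (a # q))" if w: "is_walk F (a # p)"
  proof -
    have "path_image (edge_path a b) \<subseteq> realization F"
      using face_sub[of "{a, b}"] w pq by (intro subset_trans[OF path_image_edge_path]) simp
    then have "homotopic_paths (realization F) (edge_path a b) (edge_path a b)"
      by (simp add: path_edge_path)
    moreover have "pathstart (walk_path p) = vertex_point b"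
      using walk_path_facts(3)[of p] w pq by simp
    ultimately show ?thesis
      using assms w pq by (auto simp: walks_homotopic_def intro!: homotopic_paths_join)
  qed
  then show ?thesis using assms pq by (auto simp: walks_homotopic_def)
qed

lemma walks_homotopic_append: "walks_homotopic p q \<Longrightarrow> walks_homotopic (xs @ p) (xs @ q)"
  by (induction xs) (auto intro: walks_homotopic_Cons)

text \<open>A repeated vertex is a constant piece of path, and a detour over a face is homotopic to
  the direct edge inside that closed simplex. Concatenation carries the rest of the walk
  along.\<close>

lemma walk_equiv_imp_homotopic:
  assumes "walk_equiv F p q" shows "walks_homotopic p q"
  using assms
proof induction
  case (walk_refl p)
  then show ?case using walk_path_facts by (auto simp: walks_homotopic_def)
next
  case (walk_sym p q)
  then show ?case by (auto simp: walks_homotopic_def homotopic_paths_sym)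
next
  case (walk_trans p q r)
  then show ?case by (auto simp: walks_homotopic_def intro: homotopic_paths_trans)
next
  case (walk_stay xs a ys)
  have "is_walk F (a # a # ys) = is_walk F (a # ys)"
  proof -
    have "{a} \<in> F" if "is_walk F (a # ys)"
    proof (cases ys)
      case (Cons b l)
      then show ?thesis using that closed[of "{a, b}" "{a}"] by simp
    qed (use that in simp)
    then show ?thesis by auto
  qed
  moreover have "homotopic_paths (realization F) (walk_path (a # a # ys)) (walk_path (a # ys))"
    if w: "is_walk F (a # ys)"
  proof -
    have "edge_path a a = (\<lambda>_. pathstart (walk_path (a # ys)))"
      using walk_path_facts(3)[OF w] by (auto simp: edge_path_def fun_eq_iff algebra_simps)
    then show ?thesis
      using homotopic_paths_const_left[OF walk_path_facts(1,2)[OF w]] by simp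
  qed
  ultimately show ?case
    by (intro walks_homotopic_append) (auto simp: walks_homotopic_def)
next
  case (walk_face a b c xs ys)
  have e: "{a, b} \<in> F" "{b, c} \<in> F" "{a, c} \<in> F"
    by (rule closed[OF walk_face]; simp)+
  have "homotopic_paths (realization F) (walk_path (a # b # c # ys)) (walk_path (a # c # ys))"
    if w: "is_walk F (c # ys)"
  proof -
    let ?p = "walk_path (c # ys)"
    have im: "path_image (edge_path u v) \<subseteq> realization F" if "{u, v} \<in> F" for u v
      using path_image_edge_path face_sub[OF that] by (rule subset_trans)
    have imf: "path_image (edge_path u v) \<subseteq> realization (Pow {a, b, c})" if "{u, v} \<subseteq> {a, b, c}" for u v
      using path_image_edge_path realization_mono[OF Pow_mono[OF that]] by (rule subset_trans)
    have p: "path ?p" "path_image ?p \<subseteq> realization F" "pathstart ?p = vertex_point c"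
      using walk_path_facts[OF w] by auto
    have "homotopic_paths (realization F) (edge_path a b +++ edge_path b c) (edge_path a c)"
    proof (rule homotopic_paths_in_face[where \<sigma> = "{a, b, c}"])
      show "path_image (edge_path a b +++ edge_path b c) \<subseteq> realization (Pow {a, b, c})"
        using imf by (intro subset_path_image_join) simp_all
      show "path_image (edge_path a c) \<subseteq> realization (Pow {a, b, c})"
        using imf by simp
      show "Pow {a, b, c} - {{}} \<subseteq> F" using closed[OF walk_face] by blast
    qed (simp_all add: path_edge_path)
    then have "homotopic_paths (realization F) ((edge_path a b +++ edge_path b c) +++ ?p) (edge_path a c +++ ?p)"
      using p by (intro homotopic_paths_join) auto
    moreover have "homotopic_paths (realization F) (edge_path a b +++ (edge_path b c +++ ?p))
        ((edge_path a b +++ edge_path b c) +++ ?p)"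
      using p im e by (intro homotopic_paths_assoc) (auto simp: path_edge_path)
    ultimately show ?thesis
      using homotopic_paths_trans by (metis walk_path.simps(3))
  qed
  then show ?case
    using e by (intro walks_homotopic_append) (auto simp: walks_homotopic_def)
qed

end

text \<open>The breakpoints 1/2 and 3/4 come from the right-nested \<open>+++\<close>. Injectivity
  up to the two ends is what lets a homotopy of loops descend from the interval to the boundary of
  the triangle.\<close>

lemma triangle_loop_param:
  assumes abc: "a \<noteq> b" "b \<noteq> c" "a \<noteq> c"
  defines "p \<equiv> edge_path a b +++ (edge_path b c +++ edge_path c a)"
    and "A \<equiv> realization (Pow {a, b, c} - {{a, b, c}})"
  shows "path p" "p ` {0..1} = A"
    and "\<And>s s'. s \<in> {0..1} \<Longrightarrow> s' \<in> {0..1} \<Longrightarrow> p s = p s' \<Longrightarrow> s = s' \<or> {s, s'} = {0, 1}"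
proof -
  show "path p" by (simp add: p_def path_edge_path)
  have pa: "p s a = (if s \<le> 1/2 then 1 - 2 * s else if s \<le> 3/4 then 0 else 4 * s - 3)"
    and pb: "p s b = (if s \<le> 1/2 then 2 * s else if s \<le> 3/4 then 3 - 4 * s else 0)"
    and pc: "p s c = (if s \<le> 1/2 then 0 else if s \<le> 3/4 then 4 * s - 2 else 4 - 4 * s)"
    and po: "v \<notin> {a, b, c} \<Longrightarrow> p s v = 0" for s v
    using abc by (auto simp: p_def joinpaths_def edge_path_def vertex_point_def)
  show "s = s' \<or> {s, s'} = {0, 1}" if "s \<in> {0..1}" "s' \<in> {0..1}" "p s = p s'" for s s'
  proof -
    have "p s a = p s' a" "p s b = p s' b" "p s c = p s' c" using that(3) by auto
    then show ?thesis using that(1,2) unfolding pa pb pc by (auto split: if_splits)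
  qed
  have mem: "x \<in> A \<longleftrightarrow> (\<forall>v. 0 \<le> x v) \<and> (\<forall>v. v \<notin> {a, b, c} \<longrightarrow> x v = 0) \<and> x a + x b + x c = 1 \<and>
      (x a = 0 \<or> x b = 0 \<or> x c = 0)" (is "_ = ?R") for x
  proof (cases "{v. x v \<noteq> 0} \<subseteq> {a, b, c}")
    case True
    have "{v. x v \<noteq> 0} = {a, b, c} \<longleftrightarrow> x a \<noteq> 0 \<and> x b \<noteq> 0 \<and> x c \<noteq> 0" using True by blast
    moreover have "\<forall>v. v \<notin> {a, b, c} \<longrightarrow> x v = 0" using True by blast
    moreover have "(\<Sum>v\<in>{a, b, c}. x v) = x a + x b + x c" using abc by (simp add: add.assoc)
    ultimately show ?thesis
      unfolding A_def realization_iff[OF _ True, simplified] using True by simp blast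
  next
    case False
    moreover have "x \<notin> A" using False unfolding A_def realization_def by blast
    ultimately show ?thesis by blast
  qed
  show "p ` {0..1} = A"
  proof (rule equalityI; rule subsetI)
    fix x assume "x \<in> p ` {0..1}"
    then obtain s where s: "0 \<le> s" "s \<le> 1" "x = p s" by auto
    have nn: "0 \<le> p s a" "0 \<le> p s b" "0 \<le> p s c"
      using s(1,2) unfolding pa pb pc by auto
    have "0 \<le> p s v" for v
    proof (cases "v \<in> {a, b, c}")
      case True
      then show ?thesis using nn by blast
    next
      case False
      then show ?thesis using po[OF False, of s] by simp
    qed
    moreover have "p s a + p s b + p s c = 1" "p s a = 0 \<or> p s b = 0 \<or> p s c = 0"
      unfolding pa pb pc by auto
    ultimately show "x \<in> A" unfolding mem s(3) using po by blast
  next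
    fix x assume "x \<in> A"
    then have R: "\<And>v. 0 \<le> x v" "\<And>v. v \<notin> {a, b, c} \<Longrightarrow> x v = 0" "x a + x b + x c = 1"
      "x a = 0 \<or> x b = 0 \<or> x c = 0" using mem by auto
    have eq: "x = p s" if "x a = p s a" "x b = p s b" "x c = p s c" for s
    proof
      fix v show "x v = p s v" using that po[of v s] R(2)[of v] by (cases "v \<in> {a, b, c}") auto
    qed
    consider "x c = 0" | "x a = 0" "x c \<noteq> 0" | "x b = 0" "x a \<noteq> 0" using R(4) by blast
    then show "x \<in> p ` {0..1}"
    proof cases
      case 1
      have "x = p (x b / 2)" by (rule eq) (use 1 R(3) R(1)[of a] R(1)[of b] in \<open>auto simp: pa pb pc\<close>)
      moreover have "x b / 2 \<in> {0..1}" using 1 R(3) R(1)[of a] R(1)[of b] by auto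
      ultimately show ?thesis by (rule image_eqI)
    next
      case 2
      then have "0 < x c" using R(1)[of c] by simp
      then have "x = p ((x c + 2) / 4)"
        by (intro eq) (use 2 R(3) R(1)[of b] in \<open>auto simp: pa pb pc field_simps\<close>)
      moreover have "(x c + 2) / 4 \<in> {0..1}" using 2 R(3) R(1)[of c] R(1)[of b] by auto
      ultimately show ?thesis by (rule image_eqI)
    next
      case 3
      then have "0 < x a" using R(1)[of a] by simp
      then have "x = p ((x a + 3) / 4)"
        by (intro eq) (use 3 R(3) R(1)[of c] in \<open>auto simp: pa pb pc field_simps\<close>)
      moreover have "(x a + 3) / 4 \<in> {0..1}" using 3 R(3) R(1)[of c] R(1)[of a] by auto
      ultimately show ?thesis by (rule image_eqI)
    qed
  qed
qed

text \<open>Through the loop \<open>p\<close> the boundary is the interval with its ends identified.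
  A homotopy of paths keeps both ends at the same point, so it factors through this
  identification.\<close>

lemma triangle_boundary_null:
  assumes closed: "\<And>I J. I \<in> F \<Longrightarrow> J \<subseteq> I \<Longrightarrow> J \<in> F"
    and abc: "a \<noteq> b" "b \<noteq> c" "a \<noteq> c"
    and e: "{a, b} \<in> F" "{b, c} \<in> F" "{a, c} \<in> F"
    and null: "walk_equiv F [a, b, c, a] [a]"
  shows "homotopic_with (\<lambda>_. True) (top_of_set (realization (Pow {a, b, c} - {{a, b, c}})))
    (top_of_set (realization F)) id (\<lambda>_. vertex_point a)"
proof -
  let ?A = "realization (Pow {a, b, c} - {{a, b, c}})"
  define p where "p = edge_path a b +++ (edge_path b c +++ edge_path c a)"
  have p: "path p" "p ` {0..1} = ?A"
    unfolding p_def by (rule triangle_loop_param[OF abc])+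
  have p_inj: "s = s' \<or> {s, s'} = {0, 1}" if "s \<in> {0..1}" "s' \<in> {0..1}" "p s = p s'" for s s'
    using triangle_loop_param(3)[OF abc] that unfolding p_def by blast
  let ?e = "\<lambda>_ :: real. vertex_point a"
  have p01: "p 0 = vertex_point a" "p 1 = vertex_point a"
    by (auto simp: p_def joinpaths_def)
  have "is_walk F [a, b, c, a]" using e closed[OF e(1), of "{a}"] by (auto simp: insert_commute)
  then have h1: "homotopic_paths (realization F) (walk_path [a, b, c, a]) ?e"
    using walk_equiv_imp_homotopic[OF closed null] by (auto simp: walks_homotopic_def[OF closed])
  have im: "path_image (edge_path u v) \<subseteq> realization F" if "{u, v} \<in> F" for u v
    by (rule subset_trans[OF path_image_edge_path face_sub[OF closed that]])
  have ca: "path_image (edge_path c a) \<subseteq> realization F" using im e by (simp add: insert_commute)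
  \<comment> \<open>\<open>walk_path\<close> ends in a constant piece at the last vertex, which is
    removed here.\<close>
  have "homotopic_paths (realization F) (edge_path c a +++ ?e) (edge_path c a)"
    using homotopic_paths_const_right[OF path_edge_path ca] by simp
  then have h2: "homotopic_paths (realization F) (walk_path [a, b, c, a]) p"
    unfolding p_def using im e by (simp add: path_edge_path homotopic_paths_join)
  have "homotopic_paths (realization F) p ?e"
    using homotopic_paths_trans[OF homotopic_paths_sym[OF h2] h1] .
  then obtain H :: "real \<times> real \<Rightarrow> 'a \<Rightarrow> real" where HH: "continuous_on ({0..1} \<times> {0..1}) H \<and>
      H \<in> {0..1} \<times> {0..1} \<rightarrow> realization F \<and>
      (\<forall>s\<in>{0..1}. H (0, s) = p s) \<and> (\<forall>s\<in>{0..1}. H (1, s) = vertex_point a) \<and>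
      (\<forall>t\<in>{0..1}. pathstart (H \<circ> Pair t) = pathstart p \<and> pathfinish (H \<circ> Pair t) = pathfinish p)"
    unfolding homotopic_paths by (rule exE)
  note H = HH[THEN conjunct1] HH[THEN conjunct2, THEN conjunct1]
  have H0': "\<forall>s\<in>{0..1}. H (0, s) = p s" and H1': "\<forall>s\<in>{0..1}. H (1, s) = vertex_point a"
    and He: "\<forall>t\<in>{0..1}. pathstart (H \<circ> Pair t) = pathstart p \<and> pathfinish (H \<circ> Pair t) = pathfinish p"
    by (rule HH[THEN conjunct2, THEN conjunct2, THEN conjunct1]
        HH[THEN conjunct2, THEN conjunct2, THEN conjunct2, THEN conjunct1]
        HH[THEN conjunct2, THEN conjunct2, THEN conjunct2, THEN conjunct2])+
  note H0 = bspec[OF H0'] and H1 = bspec[OF H1']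
  have Hs: "H (t, 0) = p 0" if "t \<in> {0..1}" for t
    using conjunct1[OF bspec[OF He that]] unfolding pathstart_def o_def .
  have Hf: "H (t, 1) = p 1" if "t \<in> {0..1}" for t
    using conjunct2[OF bspec[OF He that]] unfolding pathfinish_def o_def .
  define q where "q x = (SOME s. s \<in> {0..1} \<and> p s = x)" for x
  define g where "g = (\<lambda>(t, x). H (t, q x))"
  have q: "q x \<in> {0..1}" "p (q x) = x" if "x \<in> ?A" for x
  proof -
    have "x \<in> p ` {0..1}" using that p(2) by (simp only:)
    then have "\<exists>s. s \<in> {0..1} \<and> p s = x" by (elim imageE) (intro exI conjI, assumption, rule sym)
    then have "q x \<in> {0..1} \<and> p (q x) = x" unfolding q_def by (rule someI_ex)
    then show "q x \<in> {0..1}" "p (q x) = x" by (rule conjunct1, rule conjunct2)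
  qed
  have gp: "g (t, p s) = H (t, s)" if "t \<in> {0..1}" "s \<in> {0..1}" for t s
  proof -
    have "p s \<in> ?A" using p(2) that by blast
    then have "q (p s) = s \<or> {q (p s), s} = {0, 1}" using q[of "p s"] p_inj[of "q (p s)" s] that by blast
    then have "H (t, q (p s)) = H (t, s)"
      using Hs[OF that(1)] Hf[OF that(1)] p01 by (auto simp: doubleton_eq_iff)
    then show ?thesis by (simp add: g_def)
  qed
  \<comment> \<open>With empty base the gluing lemma says that a continuous surjection from a
    compact onto a Hausdorff space is a quotient map.\<close>
  have cont: "continuous_map (prod_topology unit_interval (top_of_set ?A)) (top_of_set (realization F)) g"
  proof (rule continuous_map_glue_compact[where B = "{}" and T = "prod_topology unit_interval unit_interval"
        and c = "\<lambda>(t, s). (t, p s)"])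
    show "Hausdorff_space (prod_topology unit_interval (top_of_set ?A))"
      unfolding Hausdorff_space_prod_topology
      using Hausdorff_top_of_set_fun by (auto simp: Hausdorff_space_subtopology)
    show "compact_space (prod_topology unit_interval unit_interval)"
      by (simp add: compact_space_subtopology compact_Times)
    have "continuous_on ({0..1} \<times> {0..1}) (\<lambda>(t, s). (t, p s))"
      unfolding case_prod_beta
      by (intro continuous_intros continuous_on_compose2[OF p(1)[unfolded path_def]]) auto
    then show "continuous_map (prod_topology unit_interval unit_interval)
        (prod_topology unit_interval (top_of_set ?A)) (\<lambda>(t, s). (t, p s))"
      using p(2) by auto
    show "topspace (prod_topology unit_interval (top_of_set ?A)) \<subseteq>
        {} \<union> (\<lambda>(t, s). (t, p s)) ` topspace (prod_topology unit_interval unit_interval)"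
      using p(2) by (force simp: image_iff)
    have "continuous_on ({0..1} \<times> {0..1}) (g \<circ> (\<lambda>(t, s). (t, p s)))"
      by (rule continuous_on_eq[OF H(1)]) (auto simp: gp)
    then show "continuous_map (prod_topology unit_interval unit_interval) (top_of_set (realization F))
        (g \<circ> (\<lambda>(t, s). (t, p s)))"
      using H(2) by (auto simp: gp Pi_iff)
  qed auto
  show ?thesis
    unfolding homotopic_with[where P = "\<lambda>_. True", simplified]
    by (rule exI[of _ g]) (use cont q H0 H1 in \<open>auto simp: g_def\<close>)
qed

text \<open>The boundary is a pair of points, so a path between them is a null-homotopy: one point
  travels while the other waits.\<close>

lemma edge_boundary_null:
  assumes uv: "u \<noteq> v" and F: "{u} \<in> F" "{v} \<in> F"
    and pc: "path_connected_space (top_of_set (realization F))"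
  shows "homotopic_with (\<lambda>_. True) (top_of_set (realization (Pow {u, v} - {{u, v}})))
    (top_of_set (realization F)) id (\<lambda>_. vertex_point u)"
proof -
  let ?A = "realization (Pow {u, v} - {{u, v}})"
  have A: "x = vertex_point u \<or> x = vertex_point v" if x: "x \<in> ?A" for x
  proof -
    have s: "{w. x w \<noteq> 0} \<subseteq> {u, v}" using x by (auto simp: realization_def)
    then have off: "x w = 0" if "w \<noteq> u" "w \<noteq> v" for w using that by blast
    have sum: "x u + x v = 1"
      using x realization_iff[OF _ s, of "Pow {u, v} - {{u, v}}"] uv by simp
    obtain w where "w \<in> {u, v}" "x w = 0" using boundary_zero[OF x] by blast
    then have "x u = 0 \<and> x v = 1 \<or> x v = 0 \<and> x u = 1" using sum by auto
    then show ?thesis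
    proof
      assume "x u = 0 \<and> x v = 1"
      then have "x w = vertex_point v w" for w using off[of w] by (auto simp: vertex_point_def)
      then show ?thesis by blast
    next
      assume "x v = 0 \<and> x u = 1"
      then have "x w = vertex_point u w" for w using off[of w] by (auto simp: vertex_point_def)
      then show ?thesis by blast
    qed
  qed
  have "path_component_of (top_of_set (realization F)) (vertex_point v) (vertex_point u)"
    using pc vertex_point_in[OF F(1)] vertex_point_in[OF F(2)]
    by (simp add: path_connected_space_iff_path_component)
  then obtain g where g: "continuous_on {0..1} g" "g ` {0..1} \<subseteq> realization F"
    "g (0::real) = vertex_point v" "g 1 = vertex_point u"
    unfolding path_component_of_def pathin_def by auto
  \<comment> \<open>On the boundary the coordinate at \<open>u\<close> takes only the values 0 and
    1; the threshold 1/2 separates them, so the case distinction is continuous.\<close>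
  define H where "H z = (if snd z u \<le> 1/2 then g (fst z) else vertex_point u)" for z :: "real \<times> ('a \<Rightarrow> real)"
  have vu: "vertex_point u u = 1" "vertex_point v u = 0" using uv by (auto simp: vertex_point_def)
  have cont: "continuous_on ({0..1} \<times> ?A) H"
    unfolding H_def
  proof (rule continuous_on_cases_le)
    show "continuous_on {z \<in> {0..1} \<times> ?A. snd z u \<le> 1/2} (\<lambda>z. g (fst z))"
      by (rule continuous_on_compose2[OF g(1)]) (auto intro: continuous_intros)
    show "continuous_on ({0..1} \<times> ?A) (\<lambda>z. snd z u)" by (rule continuous_on_snd_coordinate)
    show "g (fst z) = vertex_point u" if "z \<in> {0..1} \<times> ?A" "snd z u = 1/2" for z
      using that A[of "snd z"] vu by auto
  qed auto
  have in_F: "H (t, x) \<in> realization F" if "t \<in> {0..1}" for t x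
    using g(2) that vertex_point_in[OF F(1)] by (auto simp: H_def)
  have H0: "H (0, x) = x" if "x \<in> ?A" for x
    using A[OF that] vu g(3) by (auto simp: H_def)
  have H1: "H (1, x) = vertex_point u" for x
    using g(4) by (simp add: H_def)
  show ?thesis
    unfolding homotopic_with[where P = "\<lambda>_. True", simplified]
    by (rule exI[of _ H]) (use cont in_F H0 H1 in auto)
qed

text \<open>The homotopy joins each \<open>x\<close> to \<open>k (h x)\<close>, and \<open>k\<close>
  carries a path of \<open>Y\<close> back to join \<open>k (h x)\<close> to
  \<open>k (h y)\<close>.\<close>

lemma homotopy_equivalent_path_connected_space:
  assumes he: "X homotopy_equivalent_space Y" and Y: "path_connected_space Y"
  shows "path_connected_space X"
proof -
  obtain h k where h: "continuous_map X Y h" and k: "continuous_map Y X k"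
    and kh: "homotopic_with (\<lambda>_. True) X X (k \<circ> h) id"
    using he unfolding homotopy_equivalent_space_def by blast
  obtain H where H: "continuous_map (prod_topology unit_interval X) X H"
    and H0: "\<And>x. H (0, x) = k (h x)" and H1: "\<And>x. H (1, x) = x"
    using kh by (auto simp: homotopic_with_def)
  have kx: "path_component_of X (k (h x)) x" if "x \<in> topspace X" for x
  proof -
    have "continuous_map unit_interval X (\<lambda>t. H (t, x))"
      by (rule continuous_map_compose[OF _ H, unfolded o_def])
         (use that in \<open>simp add: continuous_map_pairwise o_def\<close>)
    then have "pathin X (\<lambda>t. H (t, x))" by (simp add: pathin_def)
    then show ?thesis unfolding path_component_of_def using H0 H1 by blast
  qed
  have hh: "path_component_of X (k (h x)) (k (h y))" if "x \<in> topspace X" "y \<in> topspace X" for x y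
  proof -
    have "h x \<in> topspace Y" "h y \<in> topspace Y"
      using continuous_map_funspace[OF h] that by auto
    then obtain g where "pathin Y g" "g 0 = h x" "g 1 = h y"
      using Y unfolding path_connected_space_def by blast
    then have "pathin X (k \<circ> g)" using pathin_compose k by blast
    then show ?thesis unfolding path_component_of_def
      using \<open>g 0 = h x\<close> \<open>g 1 = h y\<close> by (intro exI[of _ "k \<circ> g"]) simp
  qed
  have "path_component_of X x y" if "x \<in> topspace X" "y \<in> topspace X" for x y
    using path_component_of_trans[OF path_component_of_trans[OF path_component_of_sym[OF kx[OF that(1)]]
        hh[OF that]] kx[OF that(2)]] .
  then show ?thesis by (simp add: path_connected_space_iff_path_component)
qed

lemma realization_singleton: "realization {{}, {v}} = {vertex_point v}"
proof (rule equalityI; rule subsetI)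
  fix x assume x: "x \<in> realization {{}, {v}}"
  have "{w. x w \<noteq> 0} \<noteq> {}"
  proof
    assume "{w. x w \<noteq> 0} = {}"
    then have "(\<Sum>w | x w \<noteq> 0. x w) = 0" by (simp only: sum.empty)
    then show False using x by (simp add: realization_def)
  qed
  then have s: "{w. x w \<noteq> 0} = {v}" and "(\<Sum>w | x w \<noteq> 0. x w) = 1"
    using x by (auto simp: realization_def)
  then have "x v = 1" by simp
  moreover have "x w = 0" if "w \<noteq> v" for w using s that by blast
  ultimately have "x w = vertex_point v w" for w by (cases "w = v") (auto simp: vertex_point_def)
  then show "x \<in> {vertex_point v}" by blast
qed (auto intro: vertex_point_in)

lemma point_wedge_of_spheres:
  "top_of_set (realization {{}, {v}}) homotopy_equivalent_space wedge_of_spheres {} d"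
proof -
  let ?X = "top_of_set (realization {{}, {v}})" and ?Y = "wedge_of_spheres {} d"
  have top: "topspace ?Y = {None}" "topspace ?X = {vertex_point v}"
    by (simp_all add: wedge_of_spheres_def topspace_wedge realization_singleton)
  have f: "continuous_map ?X ?Y (\<lambda>_. None)" and g: "continuous_map ?Y ?X (\<lambda>_. vertex_point v)"
    using top by simp_all
  have "homotopic_with (\<lambda>_. True) ?X ?X ((\<lambda>_. vertex_point v) \<circ> (\<lambda>_. None)) id"
    by (rule homotopic_with_equal) (use top continuous_map_compose[OF f g] in auto)
  moreover have "homotopic_with (\<lambda>_. True) ?Y ?Y ((\<lambda>_. None) \<circ> (\<lambda>_. vertex_point v)) id"
    by (rule homotopic_with_equal) (use top continuous_map_compose[OF g f] in auto)
  ultimately show ?thesis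
    unfolding homotopy_equivalent_space_def using f g by blast
qed

section \<open>Complexes built by expansions and sphere attachments\<close>

text \<open>\<open>built_edge\<close> adds a 1-sphere to the wedge and \<open>built_triangle\<close> a 2-sphere; the other steps preserve
  the homotopy type.\<close>

inductive built :: "'a set set \<Rightarrow> bool" where
  built_point: "built {{}, {v}}"
| built_vertex: "built F \<Longrightarrow> {u} \<in> F \<Longrightarrow> {v} \<notin> F \<Longrightarrow> built (F \<union> {{v}, {u, v}})"
| built_edge: "built F \<Longrightarrow> {u} \<in> F \<Longrightarrow> {v} \<in> F \<Longrightarrow> u \<noteq> v \<Longrightarrow> {u, v} \<notin> F \<Longrightarrow>
    built (insert {u, v} F)"
| built_expand: "built F \<Longrightarrow> {a, c} \<in> F \<Longrightarrow> {b, c} \<in> F \<Longrightarrow> {a, b} \<notin> F \<Longrightarrow>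
    a \<noteq> b \<Longrightarrow> a \<noteq> c \<Longrightarrow> b \<noteq> c \<Longrightarrow> built (F \<union> {{a, b}, {c, a, b}})"
| built_triangle: "built F \<Longrightarrow> {a, b} \<in> F \<Longrightarrow> {b, c} \<in> F \<Longrightarrow> {a, c} \<in> F \<Longrightarrow> {a, b, c} \<notin> F \<Longrightarrow>
    a \<noteq> b \<Longrightarrow> b \<noteq> c \<Longrightarrow> a \<noteq> c \<Longrightarrow> walk_equiv F [a, b, c, a] [a] \<Longrightarrow> built (insert {a, b, c} F)"

lemma built_closed:
  assumes "built F" shows "I \<in> F \<Longrightarrow> J \<subseteq> I \<Longrightarrow> J \<in> F"
  using assms
proof (induction arbitrary: I J)
  case (built_point v)
  then show ?case by auto
next
  case (built_vertex F u v)
  have "{} \<in> F" using built_vertex.IH[OF built_vertex.hyps(2)] by blast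
  have "J \<in> F \<union> {{v}, {u, v}}" if "J \<subseteq> {u, v}"
  proof -
    have "J \<in> {{}, {u}, {v}, {u, v}}" using that by blast
    then show ?thesis using \<open>{} \<in> F\<close> built_vertex.hyps by blast
  qed
  moreover have "J \<subseteq> {u, v} \<or> I \<in> F" using built_vertex.prems by blast
  ultimately show ?case using built_vertex.IH built_vertex.prems(2) by blast
next
  case (built_edge F u v)
  have "{} \<in> F" using built_edge.IH[OF built_edge.hyps(2)] by blast
  have "J \<in> insert {u, v} F" if "J \<subseteq> {u, v}"
  proof -
    have "J \<in> {{}, {u}, {v}, {u, v}}" using that by blast
    then show ?thesis using \<open>{} \<in> F\<close> built_edge.hyps by blast
  qed
  moreover have "J \<subseteq> {u, v} \<or> I \<in> F" using built_edge.prems by blast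
  ultimately show ?case using built_edge.IH built_edge.prems(2) by blast
next
  case (built_expand F a c b)
  have "J \<in> F \<union> {{a, b}, {c, a, b}}" if J: "J \<subseteq> {c, a, b}"
  proof -
    have "J \<subseteq> {a, c} \<or> J \<subseteq> {b, c} \<or> J = {a, b} \<or> J = {c, a, b}" using J by blast
    then show ?thesis using built_expand.IH built_expand.hyps by blast
  qed
  moreover have "J \<subseteq> {c, a, b} \<or> I \<in> F" using built_expand.prems by blast
  ultimately show ?case using built_expand.IH built_expand.prems(2) by blast
next
  case (built_triangle F a b c)
  have "J \<in> insert {a, b, c} F" if J: "J \<subseteq> {a, b, c}"
  proof -
    have "J \<subseteq> {a, b} \<or> J \<subseteq> {b, c} \<or> J \<subseteq> {a, c} \<or> J = {a, b, c}" using J by blast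
    then show ?thesis using built_triangle.IH built_triangle.hyps by blast
  qed
  moreover have "J \<subseteq> {a, b, c} \<or> I \<in> F" using built_triangle.prems by blast
  ultimately show ?case using built_triangle.IH built_triangle.prems(2) by blast
qed

lemma built_finite_face:
  assumes "built F" "I \<in> F" shows "finite I"
  using assms by (induction) auto

text \<open>Indices are natural numbers so that a fresh \<open>j\<close> exists at each attachment.
  For a new edge the wedge reached so far supplies path-connectedness of the complex, and with it
  the path that makes the pair of ends null-homotopic.\<close>

theorem built_wedge_of_spheres:
  assumes "built F"
  shows "\<exists>(I :: nat set) d. finite I \<and> (\<forall>i\<in>I. d i \<in> {1, 2}) \<and>
    top_of_set (realization F) homotopy_equivalent_space wedge_of_spheres I d"
  using assms
proof induction
  case (built_point v)
  show ?case by (intro exI[of _ "{} :: nat set"] exI[of _ "\<lambda>_. 1"]) (simp add: point_wedge_of_spheres)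
next
  case (built_vertex F u v)
  have "top_of_set (realization (F \<union> {{v}, {u, v}})) homotopy_equivalent_space top_of_set (realization F)"
  proof (rule elementary_expansion)
    show "u \<notin> {v}" using built_vertex by auto
    show "insert u ({v} - {w}) \<in> F" if "w \<in> {v}" for w using that built_vertex by auto
  qed (use built_vertex built_closed[OF built_vertex.hyps(1)] built_finite_face in auto)
  then show ?case using built_vertex.IH homotopy_eqv_trans by blast
next
  case (built_expand F a c b)
  have "top_of_set (realization (F \<union> {{a, b}, {c, a, b}})) homotopy_equivalent_space top_of_set (realization F)"
  proof (rule elementary_expansion)
    show "c \<notin> {a, b}" using built_expand by auto
    have "{a, b} - {a} = {b}" "{a, b} - {b} = {a}" using built_expand by auto
    then show "insert c ({a, b} - {w}) \<in> F" if "w \<in> {a, b}" for w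
      using that built_expand by (auto simp: insert_commute)
  qed (use built_expand built_closed[OF built_expand.hyps(1)] built_finite_face in auto)
  then show ?case using built_expand.IH homotopy_eqv_trans by blast
next
  case (built_edge F u v)
  then obtain I :: "nat set" and d where I: "finite I" "\<forall>i\<in>I. d i \<in> {1, 2}"
    and he: "top_of_set (realization F) homotopy_equivalent_space wedge_of_spheres I d" by blast
  have pos: "0 < d i" if "i \<in> I" for i using I(2) that by auto
  obtain j where j: "j \<notin> I" using I(1) ex_new_if_finite infinite_UNIV_nat by blast
  have pc: "path_connected_space (top_of_set (realization F))"
    using homotopy_equivalent_path_connected_space[OF he path_connected_wedge_of_spheres[OF pos]] .
  have "top_of_set (realization (insert {u, v} F)) homotopy_equivalent_space
      wedge_of_spheres (insert j I) (d(j := Suc 0))"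
  proof (rule sphere_attachment[OF _ _ _ _ edge_boundary_null[OF built_edge.hyps(4,2,3) pc] he pos j])
    show "J \<in> F" if "J \<subset> {u, v}" for J
    proof -
      have "J \<subseteq> {u} \<or> J \<subseteq> {v}" using that by blast
      then show ?thesis using built_closed[OF built_edge.hyps(1)] built_edge.hyps(2,3) by blast
    qed
    show "card {u, v} = Suc (Suc 0)" using built_edge.hyps(4) by simp
  qed (use built_edge.hyps built_closed[OF built_edge.hyps(1)] in auto)
  moreover have "finite (insert j I)" "\<forall>i\<in>insert j I. (d(j := Suc 0)) i \<in> {1, 2}"
    using I by auto
  ultimately show ?case by blast
next
  case (built_triangle F a b c)
  then obtain I :: "nat set" and d where I: "finite I" "\<forall>i\<in>I. d i \<in> {1, 2}"
    and he: "top_of_set (realization F) homotopy_equivalent_space wedge_of_spheres I d" by blast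
  have pos: "0 < d i" if "i \<in> I" for i using I(2) that by auto
  obtain j where j: "j \<notin> I" using I(1) ex_new_if_finite infinite_UNIV_nat by blast
  note cl = built_closed[OF built_triangle.hyps(1)]
  have "top_of_set (realization (insert {a, b, c} F)) homotopy_equivalent_space
      wedge_of_spheres (insert j I) (d(j := Suc 1))"
  proof (rule sphere_attachment[OF _ _ _ _ triangle_boundary_null[OF _ built_triangle.hyps(6,7,8,2,3,4,9)] he pos j])
    show "J \<in> F" if "J \<subset> {a, b, c}" for J
    proof -
      have "J \<subseteq> {a, b} \<or> J \<subseteq> {b, c} \<or> J \<subseteq> {a, c}" using that by blast
      then show ?thesis using cl built_triangle.hyps(2,3,4) by blast
    qed
    show "card {a, b, c} = Suc (Suc 1)" using built_triangle.hyps(6,7,8) by simp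
  qed (use built_triangle.hyps cl in auto)
  moreover have "finite (insert j I)" "\<forall>i\<in>insert j I. (d(j := Suc 1)) i \<in> {1, 2}"
    using I by auto
  ultimately show ?case by blast
qed

section \<open>Homology\<close>

text \<open>The \<open>e\<close>-coefficients of members of \<open>H\<close> form a subgroup of the
  integers; an element realising its generator complements the members without \<open>e\<close>,
  whose basis comes from the induction. The basis is indexed by the naturals below \<open>k\<close>,
  so the new element gets index \<open>k\<close>.\<close>

lemma free_Abelian_subgroup_basis:
  fixes H :: "('e \<Rightarrow>\<^sub>0 int) set"
  assumes "finite E" "\<And>h. h \<in> H \<Longrightarrow> Poly_Mapping.keys h \<subseteq> E" "0 \<in> H"
    "\<And>g h. g \<in> H \<Longrightarrow> h \<in> H \<Longrightarrow> g - h \<in> H"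
  shows "\<exists>k (\<psi> :: (nat \<Rightarrow>\<^sub>0 int) \<Rightarrow> ('e \<Rightarrow>\<^sub>0 int)).
    (\<forall>x y. \<psi> (x + y) = \<psi> x + \<psi> y) \<and> bij_betw \<psi> {c. Poly_Mapping.keys c \<subseteq> {..<k}} H"
  using assms
proof (induction E arbitrary: H rule: finite_induct)
  case empty
  then have "H = {0}" by auto
  then have "bij_betw (\<lambda>_ :: nat \<Rightarrow>\<^sub>0 int. 0) {c. Poly_Mapping.keys c \<subseteq> {..<0}} H"
    by (auto simp: bij_betw_def inj_on_def)
  then show ?case by (intro exI[of _ 0] exI[of _ "\<lambda>_. 0"]) simp
next
  case (insert e E)
  note H0 = insert.prems(2) and Hdiff = insert.prems(3)
  have Hadd: "g + h \<in> H" if "g \<in> H" "h \<in> H" for g h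
  proof -
    have "g - (0 - h) \<in> H" using that H0 Hdiff by blast
    then show ?thesis by simp
  qed
  have Hcmul: "frag_cmul n h \<in> H" if "h \<in> H" for n h
    using frag_closure_minus_cmul[of "\<lambda>x. x \<in> H" h n] H0 Hdiff that by blast
  let ?l = "\<lambda>h. Poly_Mapping.lookup h e"
  define H' where "H' = {h \<in> H. ?l h = 0}"
  have "Poly_Mapping.keys h \<subseteq> E" if "h \<in> H'" for h
    using that insert.prems(1)[of h] by (auto simp: H'_def in_keys_iff)
  then obtain k :: nat and \<psi>' :: "(nat \<Rightarrow>\<^sub>0 int) \<Rightarrow> ('e \<Rightarrow>\<^sub>0 int)"
    where add: "\<And>x y. \<psi>' (x + y) = \<psi>' x + \<psi>' y"
    and bij: "bij_betw \<psi>' {c. Poly_Mapping.keys c \<subseteq> {..<k}} H'"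
    using insert.IH[of H'] H0 Hdiff by (auto simp: H'_def lookup_minus)
  show ?case
  proof (cases "H = H'")
    case True
    then show ?thesis using add bij by blast
  next
    case False
    then obtain h1 where "h1 \<in> H" "?l h1 \<noteq> 0" by (auto simp: H'_def)
    then have "0 < ?l h1 \<or> 0 < ?l (0 - h1)" by (simp add: lookup_minus) linarith
    then have "\<exists>h\<in>H. 0 < ?l h" using \<open>h1 \<in> H\<close> Hdiff[OF H0 \<open>h1 \<in> H\<close>] by blast
    then have ex: "\<exists>n::nat. 0 < n \<and> (\<exists>h\<in>H. ?l h = int n)"
      by (metis of_nat_0_less_iff zero_less_imp_eq_int)
    \<comment> \<open>The least positive coefficient divides all others, since a nonzero remainder
      would be a smaller one. If all coefficients vanish, then \<open>H = H'\<close>, the case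
      treated before.\<close>
    define d where "d = (LEAST n::nat. 0 < n \<and> (\<exists>h\<in>H. ?l h = int n))"
    have "0 < d \<and> (\<exists>h\<in>H. ?l h = int d)" unfolding d_def by (rule LeastI_ex[OF ex])
    then obtain h0 where d: "0 < d" and h0: "h0 \<in> H" "?l h0 = int d" by blast
    have dvd: "int d dvd ?l h" if "h \<in> H" for h
    proof -
      let ?r = "?l h mod int d"
      have "?l (h - frag_cmul (?l h div int d) h0) = ?r"
        using h0 by (simp add: lookup_minus minus_div_mult_eq_mod)
      moreover have "h - frag_cmul (?l h div int d) h0 \<in> H"
        using that h0 Hcmul Hdiff by blast
      moreover have r: "0 \<le> ?r" "?r < int d" using d by simp_all
      ultimately have "\<not> 0 < nat ?r"
        using not_less_Least[of "nat ?r" "\<lambda>n. 0 < n \<and> (\<exists>h\<in>H. ?l h = int n)"]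
        by (metis d_def nat_0_le nat_less_iff)
      then show ?thesis using r by (simp add: dvd_eq_mod_eq_0)
    qed
    let ?t = "\<lambda>c :: nat \<Rightarrow>\<^sub>0 int. c - frag_cmul (Poly_Mapping.lookup c k) (frag_of k)"
    define \<psi> where "\<psi> c = \<psi>' (?t c) + frag_cmul (Poly_Mapping.lookup c k) h0" for c
    have t_keys: "Poly_Mapping.keys (?t c) \<subseteq> {..<k}" if "Poly_Mapping.keys c \<subseteq> {..<Suc k}" for c
    proof
      fix i assume i: "i \<in> Poly_Mapping.keys (?t c)"
      then have "i \<noteq> k" by (auto simp: in_keys_iff lookup_minus)
      moreover have "i \<in> Poly_Mapping.keys c"
        using i \<open>i \<noteq> k\<close> by (auto simp: in_keys_iff lookup_minus)
      ultimately show "i \<in> {..<k}" using that by (auto simp: less_Suc_eq)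
    qed
    have \<psi>'H: "\<psi>' c \<in> H'" if "Poly_Mapping.keys c \<subseteq> {..<k}" for c
      using bij_betwE[OF bij] that by blast
    have \<psi>H: "\<psi> c \<in> H" and l\<psi>: "?l (\<psi> c) = Poly_Mapping.lookup c k * int d"
      if "Poly_Mapping.keys c \<subseteq> {..<Suc k}" for c
      using \<psi>'H[OF t_keys[OF that]] h0 Hadd Hcmul by (auto simp: \<psi>_def H'_def lookup_add)
    have "\<psi> (x + y) = \<psi> x + \<psi> y" for x y
    proof -
      have "?t (x + y) = ?t x + ?t y"
        by (simp add: lookup_add frag_cmul_distrib)
      then have "\<psi>' (?t (x + y)) = \<psi>' (?t x) + \<psi>' (?t y)" by (simp only: add)
      then show ?thesis
        unfolding \<psi>_def by (simp only: lookup_add frag_cmul_distrib) (simp add: algebra_simps)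
    qed
    moreover have "bij_betw \<psi> {c. Poly_Mapping.keys c \<subseteq> {..<Suc k}} H"
      unfolding bij_betw_def
    proof (intro conjI inj_onI)
      fix x y assume x: "x \<in> {c. Poly_Mapping.keys c \<subseteq> {..<Suc k}}"
        and y: "y \<in> {c. Poly_Mapping.keys c \<subseteq> {..<Suc k}}" and xy: "\<psi> x = \<psi> y"
      have l: "Poly_Mapping.lookup x k = Poly_Mapping.lookup y k"
        using l\<psi>[of x] l\<psi>[of y] x y xy d by simp
      then have "\<psi>' (?t x) = \<psi>' (?t y)" using xy by (simp add: \<psi>_def)
      then have "?t x = ?t y"
        using bij_betw_imp_inj_on[OF bij] t_keys x y by (simp add: inj_on_def)
      then show "x = y" using l by simp
    next
      show "\<psi> ` {c. Poly_Mapping.keys c \<subseteq> {..<Suc k}} = H"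
      proof (intro equalityI subsetI)
        fix h assume h: "h \<in> H"
        then obtain q where q: "?l h = int d * q" using dvd by blast
        let ?h = "h - frag_cmul q h0"
        have "?h \<in> H'" using h h0 q Hdiff Hcmul by (auto simp: H'_def lookup_minus)
        then obtain c where c: "Poly_Mapping.keys c \<subseteq> {..<k}" "\<psi>' c = ?h"
          using bij_betw_imp_surj_on[OF bij] by (metis (mono_tags, lifting) imageE mem_Collect_eq)
        let ?c = "c + frag_cmul q (frag_of k)"
        have ck: "Poly_Mapping.lookup c k = 0" using c(1) by (metis in_keys_iff lessThan_iff less_irrefl subsetD)
        then have "\<psi> ?c = h" using c(2) by (simp add: \<psi>_def lookup_add)
        moreover have "Poly_Mapping.keys ?c \<subseteq> {..<Suc k}"
          using c(1) Poly_Mapping.keys_add[of c "frag_cmul q (frag_of k)"]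
            keys_cmul[of q "frag_of k"] by (fastforce simp: less_Suc_eq)
        ultimately show "h \<in> \<psi> ` {c. Poly_Mapping.keys c \<subseteq> {..<Suc k}}" by blast
      qed (use \<psi>H in blast)
    qed
    ultimately show ?thesis by blast
  qed
qed

lemma iso_free_Abelian_group_inj:
  assumes g: "inj_on g A"
  shows "frag_extend (frag_of \<circ> g) \<in> iso (free_Abelian_group A) (free_Abelian_group (g ` A))"
proof (rule isoI)
  have keys: "Poly_Mapping.keys (frag_extend (frag_of \<circ> f) c) \<subseteq> f ` Poly_Mapping.keys c"
    for f :: "'x \<Rightarrow> 'y" and c
    using keys_frag_extend[of "frag_of \<circ> f" c] by (auto simp: keys_frag_of)
  have car: "frag_extend (frag_of \<circ> f) c \<in> carrier (free_Abelian_group D)"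
    if "c \<in> carrier (free_Abelian_group C)" "\<And>x. x \<in> C \<Longrightarrow> f x \<in> D"
    for f :: "'x \<Rightarrow> 'y" and c C D
  proof -
    have "f ` Poly_Mapping.keys c \<subseteq> D" using that by auto
    then have "Poly_Mapping.keys (frag_extend (frag_of \<circ> f) c) \<subseteq> D"
      by (rule subset_trans[OF keys])
    then show ?thesis by simp
  qed
  show "frag_extend (frag_of \<circ> g) \<in> hom (free_Abelian_group A) (free_Abelian_group (g ` A))"
  proof (rule homI)
    show "frag_extend (frag_of \<circ> g) x \<in> carrier (free_Abelian_group (g ` A))"
      if "x \<in> carrier (free_Abelian_group A)" for x
      by (rule car[OF that imageI])
  qed (simp add: frag_extend_add)
  have id: "frag_extend (frag_of \<circ> f) c = c" if "\<And>x. x \<in> Poly_Mapping.keys c \<Longrightarrow> f x = x"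
    for f :: "'x \<Rightarrow> 'x" and c
  proof -
    have "frag_extend (frag_of \<circ> f) c = frag_extend frag_of c"
      by (rule frag_extend_eq) (simp add: that)
    also have "\<dots> = c" by (rule frag_expansion[symmetric])
    finally show ?thesis .
  qed
  show "bij_betw (frag_extend (frag_of \<circ> g)) (carrier (free_Abelian_group A))
      (carrier (free_Abelian_group (g ` A)))"
  proof (rule bij_betwI[where g = "frag_extend (frag_of \<circ> inv_into A g)"])
    show "frag_extend (frag_of \<circ> g) \<in> carrier (free_Abelian_group A) \<rightarrow> carrier (free_Abelian_group (g ` A))"
      by (intro funcsetI car imageI)
    show "frag_extend (frag_of \<circ> inv_into A g) \<in> carrier (free_Abelian_group (g ` A)) \<rightarrow> carrier (free_Abelian_group A)"
      by (intro funcsetI car inv_into_into)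
    show "frag_extend (frag_of \<circ> inv_into A g) (frag_extend (frag_of \<circ> g) x) = x"
      if "x \<in> carrier (free_Abelian_group A)" for x
    proof -
      have "frag_extend (frag_of \<circ> inv_into A g) (frag_extend (frag_of \<circ> g) x)
          = frag_extend (frag_of \<circ> (inv_into A g \<circ> g)) x"
        by (simp add: frag_extend_compose o_assoc)
      also have "\<dots> = x" using that g by (intro id) auto
      finally show ?thesis .
    qed
    show "frag_extend (frag_of \<circ> g) (frag_extend (frag_of \<circ> inv_into A g) y) = y"
      if "y \<in> carrier (free_Abelian_group (g ` A))" for y
    proof -
      have "frag_extend (frag_of \<circ> g) (frag_extend (frag_of \<circ> inv_into A g) y)
          = frag_extend (frag_of \<circ> (g \<circ> inv_into A g)) y"
        by (simp add: frag_extend_compose o_assoc)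
      also have "\<dots> = y" using that by (intro id) (auto simp: f_inv_into_f)
      finally show ?thesis .
    qed
  qed
qed

text \<open>\<open>is_free_abelian\<close> asks for a basis inside the carrier. The images of the
  generators serve, as an isomorphism keeps them distinct.\<close>

lemma is_free_abelianI:
  fixes k :: nat
  assumes G: "comm_group G" and iso: "free_Abelian_group {..<k} \<cong> G"
  shows "is_free_abelian G"
proof -
  obtain \<theta> where \<theta>: "\<theta> \<in> iso (free_Abelian_group {..<k}) G"
    using iso by (auto simp: is_iso_def)
  let ?g = "\<lambda>i. \<theta> (frag_of i)"
  have bij: "bij_betw \<theta> (carrier (free_Abelian_group {..<k})) (carrier G)"
    using \<theta> by (simp add: iso_def)
  have "inj_on ?g {..<k}"
  proof (rule inj_onI)
    fix i j assume ij: "i \<in> {..<k}" "j \<in> {..<k}" "?g i = ?g j"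
    have "frag_of i \<in> carrier (free_Abelian_group {..<k})" "frag_of j \<in> carrier (free_Abelian_group {..<k})"
      using ij by simp_all
    then have "frag_of i = frag_of j"
      using inj_onD[OF bij_betw_imp_inj_on[OF bij] ij(3)] by blast
    then show "i = j" by (simp add: frag_of_eq)
  qed
  then have "free_Abelian_group {..<k} \<cong> free_Abelian_group (?g ` {..<k})"
    using iso_free_Abelian_group_inj by (auto simp: is_iso_def)
  then have "G \<cong> free_Abelian_group (?g ` {..<k})"
    using group.iso_sym[OF group_free_Abelian_group iso] iso_trans by blast
  moreover have "?g ` {..<k} \<subseteq> carrier G"
    using bij_betwE[OF bij] by (auto simp: keys_frag_of)
  ultimately show ?thesis unfolding is_free_abelian_def using G by blast
qed

text \<open>A quotient is shown to be free by embedding it into a free group; \<open>\<phi>\<close> induces the embedding.\<close>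

lemma free_abelian_quotient:
  fixes \<phi> :: "('e \<Rightarrow>\<^sub>0 int) \<Rightarrow> ('f \<Rightarrow>\<^sub>0 int)"
  assumes fin: "finite E'"
    and add: "\<And>x y. \<phi> (x + y) = \<phi> x + \<phi> y"
    and keys: "\<And>c. Poly_Mapping.keys c \<subseteq> E \<Longrightarrow> Poly_Mapping.keys (\<phi> c) \<subseteq> E'"
    and Z: "\<And>c. c \<in> Z \<Longrightarrow> Poly_Mapping.keys c \<subseteq> E" "0 \<in> Z" "\<And>c d. c \<in> Z \<Longrightarrow> d \<in> Z \<Longrightarrow> c - d \<in> Z"
    and B: "B \<subseteq> Z" "\<And>c. c \<in> Z \<Longrightarrow> \<phi> c = 0 \<longleftrightarrow> c \<in> B"
  shows "is_free_abelian (subgroup_generated (free_Abelian_group E) Z Mod B)"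
proof -
  let ?G = "free_Abelian_group E" and ?M = "\<phi> ` Z"
  let ?K = "subgroup_generated ?G Z" and ?H = "subgroup_generated (free_Abelian_group E') ?M"
  have \<phi>0: "\<phi> 0 = 0" using add[of 0 0] by simp
  have diff: "\<phi> (x - y) = \<phi> x - \<phi> y" for x y using add[of "x - y" y] by simp
  have Zadd: "c + d \<in> Z" if "c \<in> Z" "d \<in> Z" for c d
    using Z(3)[OF that(1) Z(3)[OF Z(2) that(2)]] by simp
  have ZG: "subgroup Z ?G"
  proof (rule group.subgroupI[OF group_free_Abelian_group])
    show "Z \<subseteq> carrier ?G" using Z(1) by auto
    show "Z \<noteq> {}" using Z(2) by blast
    show "inv\<^bsub>?G\<^esub> a \<in> Z" if "a \<in> Z" for a
      using Z(1)[OF that] Z(3)[OF Z(2) that] by simp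
    show "a \<otimes>\<^bsub>?G\<^esub> b \<in> Z" if "a \<in> Z" "b \<in> Z" for a b
      using Zadd[OF that] by simp
  qed
  have carK: "carrier ?K = Z" using subgroup.carrier_subgroup_generated_subgroup[OF ZG] .
  have M: "Poly_Mapping.keys h \<subseteq> E'" if "h \<in> ?M" for h using keys Z(1) that by blast
  have Mdiff: "g - h \<in> ?M" if "g \<in> ?M" "h \<in> ?M" for g h
    using that Z(3) diff by (metis (no_types, lifting) imageE imageI)
  have M0: "0 \<in> ?M" using Z(2) \<phi>0 by (metis imageI)
  have MH: "subgroup ?M (free_Abelian_group E')"
  proof (rule group.subgroupI[OF group_free_Abelian_group])
    show "inv\<^bsub>free_Abelian_group E'\<^esub> a \<in> ?M" if "a \<in> ?M" for a
      using M[OF that] Mdiff[OF M0 that] by simp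
    show "a \<otimes>\<^bsub>free_Abelian_group E'\<^esub> b \<in> ?M" if "a \<in> ?M" "b \<in> ?M" for a b
      using Mdiff[OF that(1) Mdiff[OF M0 that(2)]] by simp
    show "?M \<subseteq> carrier (free_Abelian_group E')" using M by auto
    show "?M \<noteq> {}" using M0 by blast
  qed
  have carH: "carrier ?H = ?M" using subgroup.carrier_subgroup_generated_subgroup[OF MH] .
  obtain k :: nat and \<psi> :: "(nat \<Rightarrow>\<^sub>0 int) \<Rightarrow> ('f \<Rightarrow>\<^sub>0 int)"
    where \<psi>: "\<And>x y. \<psi> (x + y) = \<psi> x + \<psi> y" and bij: "bij_betw \<psi> {c. Poly_Mapping.keys c \<subseteq> {..<k}} ?M"
    using free_Abelian_subgroup_basis[OF fin M M0 Mdiff] by blast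
  have carF: "carrier (free_Abelian_group {..<k}) = {c. Poly_Mapping.keys c \<subseteq> {..<k}}" by auto
  have "\<psi> \<in> iso (free_Abelian_group {..<k}) ?H"
    using bij bij_betwE[OF bij] by (auto intro!: isoI homI simp: \<psi> carH carF)
  then have 1: "free_Abelian_group {..<k} \<cong> ?H" by (auto simp: is_iso_def)
  have groups: "group ?K" "group ?H" by (simp_all add: group.group_subgroup_generated)
  have hom: "\<phi> \<in> hom ?K ?H"
    by (auto intro!: homI simp: add carK carH)
  interpret h: group_hom ?K ?H \<phi>
    by (rule group_hom.intro[OF groups]) (simp add: group_hom_axioms_def hom)
  have "kernel ?K ?H \<phi> = B"
    using B by (auto simp: kernel_def carK)
  then have 2: "?K Mod B \<cong> ?H"
    using h.FactGroup_iso carK carH by simp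
  have commK: "comm_group ?K"
    by (simp add: group.abelian_subgroup_generated abelian_free_Abelian_group)
  have BK: "subgroup B ?K" using h.subgroup_kernel \<open>kernel ?K ?H \<phi> = B\<close> by simp
  have "comm_group (?K Mod B)" using comm_group.abelian_FactGroup[OF commK BK] .
  moreover have "group (?K Mod B)"
    using comm_group.abelian_FactGroup[OF commK BK] comm_group.axioms(2) by blast
  then have "?H \<cong> ?K Mod B" using group.iso_sym 2 by blast
  ultimately show ?thesis
    using is_free_abelianI 1 iso_trans by blast
qed

text \<open>The sign makes the edge antisymmetric in its ends, and a degenerate pair gives 0, so
  that chains of walks tolerate backtracking and repeated vertices.\<close>

definition oriented_edge :: "'a rel \<Rightarrow> 'a \<Rightarrow> 'a \<Rightarrow> 'a set \<Rightarrow>\<^sub>0 int" where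
  "oriented_edge r x y =
     (if x = y then 0 else if (x, y) \<in> r then frag_of {x, y} else - frag_of {x, y})"

fun walk_chain :: "'a rel \<Rightarrow> 'a list \<Rightarrow> 'a set \<Rightarrow>\<^sub>0 int" where
  "walk_chain r [] = 0"
| "walk_chain r [a] = 0"
| "walk_chain r (a # b # l) = oriented_edge r a b + walk_chain r (b # l)"

definition face_chains :: "'a set set \<Rightarrow> nat \<Rightarrow> ('a set \<Rightarrow>\<^sub>0 int) set" where
  "face_chains F p = {c. Poly_Mapping.keys c \<subseteq> {I \<in> F. card I = Suc p}}"

definition boundaries :: "'a rel \<Rightarrow> 'a set set \<Rightarrow> nat \<Rightarrow> ('a set \<Rightarrow>\<^sub>0 int) set" where
  "boundaries r F p = face_boundary r (Suc p) ` face_chains F (Suc p)"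

section \<open>Calculus of chains and boundaries\<close>

lemma face_boundary_add: "face_boundary r p (x + y) = face_boundary r p x + face_boundary r p y"
  by (simp add: face_boundary_def frag_extend_add)

lemma face_boundary_diff: "face_boundary r p (x - y) = face_boundary r p x - face_boundary r p y"
  by (simp add: face_boundary_def frag_extend_diff)

lemma face_boundary_cmul: "face_boundary r p (frag_cmul n x) = frag_cmul n (face_boundary r p x)"
  by (simp add: face_boundary_def frag_extend_cmul)

lemma face_boundary_0 [simp]: "face_boundary r p 0 = 0"
  by (simp add: face_boundary_def)

lemma face_chains_0 [simp]: "0 \<in> face_chains F p"
  by (simp add: face_chains_def)

lemma face_chains_diff: "x \<in> face_chains F p \<Longrightarrow> y \<in> face_chains F p \<Longrightarrow> x - y \<in> face_chains F p"
  using keys_diff[of x y] by (auto simp: face_chains_def)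

lemma face_chains_add: "x \<in> face_chains F p \<Longrightarrow> y \<in> face_chains F p \<Longrightarrow> x + y \<in> face_chains F p"
  using Poly_Mapping.keys_add[of x y] by (auto simp: face_chains_def)

lemma face_chains_cmul: "x \<in> face_chains F p \<Longrightarrow> frag_cmul n x \<in> face_chains F p"
  using keys_cmul[of n x] by (auto simp: face_chains_def)

lemma face_chains_frag_of: "frag_of I \<in> face_chains F p \<longleftrightarrow> I \<in> F \<and> card I = Suc p"
  by (simp add: face_chains_def keys_frag_of)

lemma boundaries_0 [simp]: "0 \<in> boundaries r F p"
  unfolding boundaries_def by (rule image_eqI[of _ _ 0]) auto

lemma boundaries_diff:
  assumes "x \<in> boundaries r F p" "y \<in> boundaries r F p" shows "x - y \<in> boundaries r F p"
proof -
  obtain c d where "c \<in> face_chains F (Suc p)" "d \<in> face_chains F (Suc p)"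
    "x = face_boundary r (Suc p) c" "y = face_boundary r (Suc p) d"
    using assms by (auto simp: boundaries_def)
  then show ?thesis
    unfolding boundaries_def by (intro image_eqI[of _ _ "c - d"]) (auto simp: face_boundary_diff face_chains_diff)
qed

lemma boundaries_minus: "x \<in> boundaries r F p \<Longrightarrow> - x \<in> boundaries r F p"
  using boundaries_diff[OF boundaries_0, of x] by simp

lemma boundaries_add:
  assumes "x \<in> boundaries r F p" "y \<in> boundaries r F p" shows "x + y \<in> boundaries r F p"
  using boundaries_diff[OF assms(1) boundaries_minus[OF assms(2)]] by simp

lemma boundaries_cmul: "x \<in> boundaries r F p \<Longrightarrow> frag_cmul n x \<in> boundaries r F p"
  unfolding boundaries_def
  by (auto simp: face_boundary_cmul[symmetric] intro!: imageI face_chains_cmul)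

lemma boundaries_frag_of:
  "I \<in> F \<Longrightarrow> card I = Suc (Suc p) \<Longrightarrow> face_boundary r (Suc p) (frag_of I) \<in> boundaries r F p"
  unfolding boundaries_def by (intro imageI) (simp add: face_chains_frag_of)

lemma boundaries_mono: "F \<subseteq> G \<Longrightarrow> boundaries r F p \<subseteq> boundaries r G p"
  unfolding boundaries_def face_chains_def by auto

lemma boundaries_cong:
  "{I \<in> F. card I = Suc (Suc p)} = {I \<in> G. card I = Suc (Suc p)} \<Longrightarrow> boundaries r F p = boundaries r G p"
  unfolding boundaries_def face_chains_def by simp

lemma keys_face_boundary_frag_of:
  "Poly_Mapping.keys (face_boundary r p (frag_of I)) \<subseteq> (\<lambda>v. I - {v}) ` I"
proof (cases "p = 0 \<or> infinite I")
  case True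
  then show ?thesis by (auto simp: face_boundary_def)
next
  case False
  have "Poly_Mapping.keys (\<Sum>v\<in>I. frag_cmul ((- 1) ^ card {w \<in> I. w \<noteq> v \<and> (w, v) \<in> r}) (frag_of (I - {v})))
    \<subseteq> (\<Union>v\<in>I. Poly_Mapping.keys (frag_cmul ((- 1) ^ card {w \<in> I. w \<noteq> v \<and> (w, v) \<in> r}) (frag_of (I - {v}))))"
    by (rule Poly_Mapping.keys_sum)
  also have "\<dots> \<subseteq> (\<Union>v\<in>I. {I - {v}})"
    using keys_cmul by (intro UN_mono) (force simp: keys_frag_of)+
  finally show ?thesis using False by (auto simp: face_boundary_def)
qed

lemma face_boundary_in:
  assumes closed: "\<And>I J. I \<in> F \<Longrightarrow> J \<subseteq> I \<Longrightarrow> J \<in> F" and c: "c \<in> face_chains F (Suc p)"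
  shows "face_boundary r (Suc p) c \<in> face_chains F p"
proof -
  have I: "face_boundary r (Suc p) (frag_of I) \<in> face_chains F p" if "I \<in> F" "card I = Suc (Suc p)" for I
  proof -
    have "finite I" using that(2) by (intro card_ge_0_finite) simp
    then have "I - {v} \<in> F \<and> card (I - {v}) = Suc p" if "v \<in> I" for v
      using closed[of I "I - {v}"] that \<open>I \<in> F\<close> \<open>card I = _\<close> by auto
    then show ?thesis
      using keys_face_boundary_frag_of[of r "Suc p" I] by (force simp: face_chains_def)
  qed
  have "Poly_Mapping.keys c \<subseteq> {I \<in> F. card I = Suc (Suc p)}" using c by (simp add: face_chains_def)
  then show ?thesis
  proof (induction c rule: frag_induction)
    case (one x)
    then show ?case using I by blast
  qed (simp_all add: face_boundary_diff face_chains_diff)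
qed

text \<open>This separates the coefficient of a new face from the old chain; maps on chains are
  extended over a new edge through this splitting.\<close>

lemma face_chains_insert_split:
  assumes "c \<in> face_chains (insert e F) p"
  shows "c - frag_cmul (Poly_Mapping.lookup c e) (frag_of e) \<in> face_chains F p"
proof -
  let ?d = "c - frag_cmul (Poly_Mapping.lookup c e) (frag_of e)"
  have "I \<in> F \<and> card I = Suc p" if "I \<in> Poly_Mapping.keys ?d" for I
  proof -
    have "I \<noteq> e" using that by (auto simp: in_keys_iff lookup_minus)
    moreover have "I \<in> Poly_Mapping.keys c"
      using that \<open>I \<noteq> e\<close> by (simp add: in_keys_iff lookup_minus)
    ultimately show ?thesis using assms by (auto simp: face_chains_def)
  qed
  then show ?thesis by (auto simp: face_chains_def)
qed

locale oriented_vertices =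
  fixes r :: "'a rel" and V :: "'a set"
  assumes linear: "linear_order_on V r"
begin

lemma r_total: "x \<in> V \<Longrightarrow> y \<in> V \<Longrightarrow> x \<noteq> y \<Longrightarrow> (x, y) \<in> r \<or> (y, x) \<in> r"
  using linear by (auto simp: linear_order_on_def total_on_def)

lemma r_antisym: "(x, y) \<in> r \<Longrightarrow> (y, x) \<in> r \<Longrightarrow> x = y"
  using linear by (auto simp: linear_order_on_def partial_order_on_def antisym_def)

lemma r_trans: "(x, y) \<in> r \<Longrightarrow> (y, z) \<in> r \<Longrightarrow> (x, z) \<in> r"
  using linear by (auto simp: linear_order_on_def partial_order_on_def preorder_on_def elim: transE)

lemma oriented_edge_swap: "x \<in> V \<Longrightarrow> y \<in> V \<Longrightarrow> oriented_edge r y x = - oriented_edge r x y"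
  using r_total[of x y] r_antisym[of x y] by (auto simp: oriented_edge_def insert_commute)

lemma boundary_ordered_edge:
  assumes "(x, y) \<in> r" "x \<noteq> y"
  shows "face_boundary r (Suc 0) (frag_of {x, y}) = frag_of {y} - frag_of {x}"
proof -
  define f where "f v = frag_cmul ((-1) ^ card {w \<in> {x, y}. w \<noteq> v \<and> (w, v) \<in> r}) (frag_of ({x, y} - {v}))" for v
  have "(y, x) \<notin> r" using r_antisym assms by blast
  then have sets: "{w \<in> {x, y}. w \<noteq> x \<and> (w, x) \<in> r} = {}" "{w \<in> {x, y}. w \<noteq> y \<and> (w, y) \<in> r} = {x}"
    "{x, y} - {x} = {y}" "{x, y} - {y} = {x}"
    using assms by auto
  have "face_boundary r (Suc 0) (frag_of {x, y}) = (\<Sum>v\<in>{x, y}. f v)"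
    unfolding face_boundary_def f_def by (simp only: frag_extend_of nat.simps if_False)
  also have "\<dots> = f x + f y" using assms(2) by simp
  also have "f x = frag_of {y}" unfolding f_def sets by simp
  also have "f y = - frag_of {x}" unfolding f_def sets by simp
  finally show ?thesis by simp
qed

lemma boundary_oriented_edge:
  assumes "x \<in> V" "y \<in> V"
  shows "face_boundary r (Suc 0) (oriented_edge r x y) = frag_of {y} - frag_of {x}"
proof (cases "x = y")
  case False
  then consider "(x, y) \<in> r" | "(y, x) \<in> r" "(x, y) \<notin> r" using r_total assms by blast
  then show ?thesis
  proof cases
    case 1
    then show ?thesis using boundary_ordered_edge False by (simp add: oriented_edge_def)
  next
    case 2
    then show ?thesis
      using boundary_ordered_edge[of y x] False face_boundary_diff[of r "Suc 0" 0 "frag_of {x, y}"]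
      by (simp add: oriented_edge_def insert_commute)
  qed
qed (simp add: oriented_edge_def)

lemma boundary_ordered_triangle:
  assumes "(a, b) \<in> r" "(b, c) \<in> r" "a \<noteq> b" "b \<noteq> c"
  shows "face_boundary r 2 (frag_of {a, b, c}) = oriented_edge r a b + oriented_edge r b c + oriented_edge r c a"
proof -
  have ac: "(a, c) \<in> r" "a \<noteq> c" using r_trans r_antisym assms by blast+
  have n: "(b, a) \<notin> r" "(c, b) \<notin> r" "(c, a) \<notin> r" using r_antisym assms ac by blast+
  define f where "f v = frag_cmul ((-1) ^ card {w \<in> {a, b, c}. w \<noteq> v \<and> (w, v) \<in> r})
      (frag_of ({a, b, c} - {v}))" for v
  have sets: "{w \<in> {a, b, c}. w \<noteq> a \<and> (w, a) \<in> r} = {}" "{w \<in> {a, b, c}. w \<noteq> b \<and> (w, b) \<in> r} = {a}"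
    "{w \<in> {a, b, c}. w \<noteq> c \<and> (w, c) \<in> r} = {a, b}"
    "{a, b, c} - {a} = {b, c}" "{a, b, c} - {b} = {a, c}" "{a, b, c} - {c} = {a, b}"
    using assms ac n by auto
  have "face_boundary r 2 (frag_of {a, b, c}) = (\<Sum>v\<in>{a, b, c}. f v)"
    unfolding face_boundary_def f_def by (simp only: frag_extend_of zero_neq_numeral[symmetric] if_False)
  also have "\<dots> = f a + (f b + f c)" using assms(3,4) ac(2) by simp
  also have "f a = frag_of {b, c}" unfolding f_def sets by simp
  also have "f b = - frag_of {a, c}" unfolding f_def sets by simp
  also have "f c = frag_of {a, b}" unfolding f_def sets using assms(3) by simp
  finally show ?thesis
    using assms ac n by (simp add: oriented_edge_def insert_commute)
qed

text \<open>The sign is that of the permutation sorting \<open>a\<close>, \<open>b\<close>,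
  \<open>c\<close> by \<open>r\<close>. It is left open because boundaries are closed under
  negation.\<close>

lemma boundary_triangle:
  assumes V: "a \<in> V" "b \<in> V" "c \<in> V" and abc: "a \<noteq> b" "b \<noteq> c" "a \<noteq> c"
  shows "face_boundary r 2 (frag_of {a, b, c}) = oriented_edge r a b + oriented_edge r b c + oriented_edge r c a
    \<or> face_boundary r 2 (frag_of {a, b, c}) = - (oriented_edge r a b + oriented_edge r b c + oriented_edge r c a)"
proof -
  let ?o = "oriented_edge r" and ?T = "\<lambda>a b c. oriented_edge r a b + oriented_edge r b c + oriented_edge r c a"
  have sw: "?o b a = - ?o a b" "?o c b = - ?o b c" "?o a c = - ?o c a"
    by (rule oriented_edge_swap[OF V(1,2)], rule oriented_edge_swap[OF V(2,3)], rule oriented_edge_swap[OF V(3,1)])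
  have pos: "?T b c a = ?T a b c" "?T c a b = ?T a b c" by (simp_all add: algebra_simps)
  have neg: "?T b a c = - ?T a b c" "?T a c b = - ?T a b c" "?T c b a = - ?T a b c"
    unfolding sw by (simp_all add: algebra_simps)
  have sets: "{b, c, a} = {a, b, c}" "{c, a, b} = {a, b, c}" "{b, a, c} = {a, b, c}"
    "{a, c, b} = {a, b, c}" "{c, b, a} = {a, b, c}" by auto
  have "(a, b) \<in> r \<or> (b, a) \<in> r" "(b, c) \<in> r \<or> (c, b) \<in> r" "(a, c) \<in> r \<or> (c, a) \<in> r"
    using r_total V abc by blast+
  then consider "(a, b) \<in> r" "(b, c) \<in> r" | "(b, c) \<in> r" "(c, a) \<in> r" | "(c, a) \<in> r" "(a, b) \<in> r"
    | "(b, a) \<in> r" "(a, c) \<in> r" | "(a, c) \<in> r" "(c, b) \<in> r" | "(c, b) \<in> r" "(b, a) \<in> r" by blast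
  then show ?thesis
  proof cases
    case 1 then show ?thesis using boundary_ordered_triangle[of a b c] abc by simp
  next
    case 2 then show ?thesis using boundary_ordered_triangle[of b c a] abc pos sets by simp
  next
    case 3 then show ?thesis using boundary_ordered_triangle[of c a b] abc pos sets by simp
  next
    case 4 then show ?thesis using boundary_ordered_triangle[of b a c] abc neg sets by simp
  next
    case 5 then show ?thesis using boundary_ordered_triangle[of a c b] abc neg sets by simp
  next
    case 6 then show ?thesis using boundary_ordered_triangle[of c b a] abc neg sets by simp
  qed
qed

lemma boundary_boundary_triangle:
  assumes "I \<subseteq> V" "card I = 3"
  shows "face_boundary r (Suc 0) (face_boundary r 2 (frag_of I)) = 0"
proof -
  obtain a b c where I: "I = {a, b, c}" "a \<noteq> b" "b \<noteq> c" "a \<noteq> c"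
    using assms(2) by (auto simp: card_3_iff)
  then have V: "a \<in> V" "b \<in> V" "c \<in> V" using assms by auto
  let ?T = "oriented_edge r a b + oriented_edge r b c + oriented_edge r c a"
  have T: "face_boundary r (Suc 0) ?T = 0"
    by (simp add: face_boundary_add boundary_oriented_edge V)
  then have "face_boundary r (Suc 0) (- ?T) = 0"
    using face_boundary_diff[of r "Suc 0" 0 ?T] by simp
  with T boundary_triangle[OF V I(2,3,4)] show ?thesis unfolding I(1) by (elim disjE) (simp_all only:)
qed

lemma boundary_boundary:
  assumes "F \<subseteq> Pow V" "c \<in> boundaries r F 1" shows "face_boundary r 1 c = 0"
proof -
  obtain d where d: "d \<in> face_chains F 2" "c = face_boundary r 2 d"
    using assms(2) by (auto simp: boundaries_def numeral_2_eq_2)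
  have "Poly_Mapping.keys d \<subseteq> {I \<in> F. card I = 3}" using d(1) by (simp add: face_chains_def)
  then have "face_boundary r (Suc 0) (face_boundary r 2 d) = 0"
  proof (induction d rule: frag_induction)
    case (one x)
    then show ?case using boundary_boundary_triangle assms(1) by blast
  qed (auto simp: face_boundary_diff)
  then show ?thesis using d by simp
qed

lemma walk_chain_append:
  "walk_chain r (xs @ a # ys) = walk_chain r (xs @ [a]) + walk_chain r (a # ys)"
proof (induction xs rule: induct_list012)
  case (2 x)
  then show ?case by simp
next
  case (3 x y zs)
  then show ?case by (simp add: add.assoc)
qed simp

text \<open>The only rule that changes the chain replaces two sides of a face by the third. The
  difference is, up to sign, the boundary of that face, or 0 if two of its vertices coincide. This
  is the passage from homotopy to homology.\<close>

lemma walk_equiv_homologous: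
  assumes F: "F \<subseteq> Pow V" and pq: "walk_equiv F p q"
  shows "walk_chain r p - walk_chain r q \<in> boundaries r F 1"
  using pq
proof induction
  case (walk_sym p q)
  show ?case using boundaries_minus[OF walk_sym.IH] by simp
next
  case (walk_trans p q s)
  show ?case using boundaries_add[OF walk_trans.IH] by simp
next
  case (walk_stay xs a ys)
  have "walk_chain r (xs @ a # a # ys) = walk_chain r (xs @ a # ys)"
    using walk_chain_append[of xs a "a # ys"] walk_chain_append[of xs a ys] by (simp add: oriented_edge_def)
  then show ?case by simp
next
  case (walk_face a b c xs ys)
  then have V: "a \<in> V" "b \<in> V" "c \<in> V" using F by auto
  let ?o = "oriented_edge r"
  have "walk_chain r (xs @ a # b # c # ys) - walk_chain r (xs @ a # c # ys) = ?o a b + ?o b c - ?o a c"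
    using walk_chain_append[of xs a "b # c # ys"] walk_chain_append[of xs a "c # ys"] by simp
  also have "\<dots> = ?o a b + ?o b c + ?o c a" using oriented_edge_swap[OF V(1,3)] by simp
  also have "\<dots> \<in> boundaries r F 1"
  proof (cases "a \<noteq> b \<and> b \<noteq> c \<and> a \<noteq> c")
    case True
    then have "card {a, b, c} = 3" by simp
    then have mem: "face_boundary r 2 (frag_of {a, b, c}) \<in> boundaries r F 1"
      using boundaries_frag_of[OF walk_face(1), of 1 r] by (simp add: numeral_2_eq_2)
    from True have "a \<noteq> b" "b \<noteq> c" "a \<noteq> c" by auto
    from boundary_triangle[OF V this] show ?thesis
    proof
      assume "face_boundary r 2 (frag_of {a, b, c}) = ?o a b + ?o b c + ?o c a"
      then show ?thesis using mem by (simp only:)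
    next
      assume "face_boundary r 2 (frag_of {a, b, c}) = - (?o a b + ?o b c + ?o c a)"
      then have "?o a b + ?o b c + ?o c a = - face_boundary r 2 (frag_of {a, b, c})"
        by (simp only: minus_minus)
      then show ?thesis using boundaries_minus[OF mem] by (simp only:)
    qed
  next
    case False
    have self: "?o x x = 0" for x by (simp add: oriented_edge_def)
    from False consider "a = b" | "b = c" | "a = c" by blast
    then have "?o a b + ?o b c + ?o c a = 0"
      using oriented_edge_swap[OF V(1,2)] oriented_edge_swap[OF V(2,3)] oriented_edge_swap[OF V(1,3)]
      by cases (simp_all add: self)
    then show ?thesis by simp
  qed
  finally show ?case .
qed simp

end

context oriented_vertices
begin

section \<open>Homology of built complexes in degrees 0 and 1\<close>

lemma boundary_edge_in:
  assumes "F \<subseteq> Pow V" "{x, y} \<in> F" "x \<noteq> y"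
  shows "frag_of {y} - frag_of {x} \<in> boundaries r F 0"
proof -
  have V: "x \<in> V" "y \<in> V" using assms by auto
  have "oriented_edge r x y \<in> face_chains F (Suc 0)"
  proof (cases "(x, y) \<in> r")
    case True
    then show ?thesis using assms by (simp add: oriented_edge_def face_chains_frag_of)
  next
    case False
    then show ?thesis
      using assms face_chains_diff[OF face_chains_0, of "frag_of {x, y}" F "Suc 0"]
      by (simp add: oriented_edge_def face_chains_frag_of)
  qed
  then show ?thesis
    unfolding boundaries_def boundary_oriented_edge[OF V, symmetric] by (rule imageI)
qed

text \<open>After the initial point, only \<open>built_vertex\<close> creates vertices, and the edge
  that comes with a new vertex makes it homologous to an old one.\<close>

lemma built_connected:
  assumes "built F" "F \<subseteq> Pow V"
  shows "\<exists>u. {u} \<in> F \<and> (\<forall>v. {v} \<in> F \<longrightarrow> frag_of {v} - frag_of {u} \<in> boundaries r F 0)"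
  using assms
proof induction
  case (built_point v)
  then show ?case by (intro exI[of _ v]) auto
next
  case (built_vertex F u v)
  then obtain w where w: "{w} \<in> F" "\<And>x. {x} \<in> F \<Longrightarrow> frag_of {x} - frag_of {w} \<in> boundaries r F 0"
    by auto
  let ?F = "F \<union> {{v}, {u, v}}"
  have uv: "u \<noteq> v" using built_vertex.hyps by auto
  have old: "frag_of {x} - frag_of {w} \<in> boundaries r ?F 0" if "{x} \<in> F" for x
    using w(2)[OF that] boundaries_mono[of F ?F r 0] by blast
  have "frag_of {v} - frag_of {u} \<in> boundaries r ?F 0"
    by (rule boundary_edge_in[OF built_vertex.prems]) (use uv in auto)
  from boundaries_add[OF this old[OF built_vertex.hyps(2)]]
  have new: "frag_of {v} - frag_of {w} \<in> boundaries r ?F 0" by simp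
  have "frag_of {x} - frag_of {w} \<in> boundaries r ?F 0" if "{x} \<in> ?F" for x
    using that uv old[of x] new by (auto simp: doubleton_eq_iff)
  then show ?case using w(1) by blast
next
  case (built_edge F u v)
  then obtain w where w: "{w} \<in> F" "\<And>x. {x} \<in> F \<Longrightarrow> frag_of {x} - frag_of {w} \<in> boundaries r F 0"
    by auto
  have "{x} \<in> F" if "{x} \<in> insert {u, v} F" for x
    using that built_edge.hyps by (auto simp: doubleton_eq_iff)
  then show ?case using w boundaries_mono[of F "insert {u, v} F" r 0] by blast
next
  case (built_expand F a c b)
  then obtain w where w: "{w} \<in> F" "\<And>x. {x} \<in> F \<Longrightarrow> frag_of {x} - frag_of {w} \<in> boundaries r F 0"
    by auto
  have "{x} \<in> F" if "{x} \<in> F \<union> {{a, b}, {c, a, b}}" for x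
    using that built_expand.hyps by (auto simp: doubleton_eq_iff)
  then show ?case using w boundaries_mono[of F "F \<union> {{a, b}, {c, a, b}}" r 0] by blast
next
  case (built_triangle F a b c)
  then obtain w where w: "{w} \<in> F" "\<And>x. {x} \<in> F \<Longrightarrow> frag_of {x} - frag_of {w} \<in> boundaries r F 0"
    by auto
  have "{x} \<in> F" if "{x} \<in> insert {a, b, c} F" for x
    using that built_triangle.hyps by auto
  then show ?case using w boundaries_mono[of F "insert {a, b, c} F" r 0] by blast
qed

text \<open>An injection of the first homology group into the free group of 1-chains. It is kept as
  an additive map on all chains, so that it can be adjusted face by face; its kernel is prescribed
  on cycles.\<close>

definition embeds_H1 :: "'a set set \<Rightarrow> (('a set \<Rightarrow>\<^sub>0 int) \<Rightarrow> ('a set \<Rightarrow>\<^sub>0 int)) \<Rightarrow> bool" where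
  "embeds_H1 F \<phi> \<longleftrightarrow> (\<forall>x y. \<phi> (x + y) = \<phi> x + \<phi> y) \<and> (\<forall>c\<in>face_chains F 1. \<phi> c \<in> face_chains F 1) \<and>
     (\<forall>c\<in>face_chains F 1. face_boundary r 1 c = 0 \<longrightarrow> (\<phi> c = 0 \<longleftrightarrow> c \<in> boundaries r F 1))"

abbreviation coeff :: "'a set \<Rightarrow> ('a set \<Rightarrow>\<^sub>0 int) \<Rightarrow> int" where
  "coeff e c \<equiv> Poly_Mapping.lookup c e"

lemma face_chains_mono: "F \<subseteq> G \<Longrightarrow> face_chains F p \<subseteq> face_chains G p"
  by (auto simp: face_chains_def)

lemma face_chains_cong:
  "{I \<in> F. card I = Suc p} = {I \<in> G. card I = Suc p} \<Longrightarrow> face_chains F p = face_chains G p"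
  by (simp add: face_chains_def)

lemma coeff_notin: "c \<in> face_chains F p \<Longrightarrow> e \<notin> F \<Longrightarrow> coeff e c = 0"
  by (auto simp: face_chains_def in_keys_iff)

lemma boundaries_chains:
  assumes "\<And>I J. I \<in> F \<Longrightarrow> J \<subseteq> I \<Longrightarrow> J \<in> F" shows "boundaries r F p \<subseteq> face_chains F p"
  unfolding boundaries_def
proof (rule image_subsetI)
  fix c assume "c \<in> face_chains F (Suc p)"
  then show "face_boundary r (Suc p) c \<in> face_chains F p"
    by (rule face_boundary_in[rotated]) (rule assms)
qed

lemma boundaries_insert:
  assumes "x \<in> boundaries r (insert t F) p"
  obtains k y where "y \<in> boundaries r F p" "x = y + frag_cmul k (face_boundary r (Suc p) (frag_of t))"
proof -
  obtain c where c: "c \<in> face_chains (insert t F) (Suc p)" "x = face_boundary r (Suc p) c"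
    using assms by (auto simp: boundaries_def)
  let ?d = "c - frag_cmul (coeff t c) (frag_of t)"
  have "?d \<in> face_chains F (Suc p)" using face_chains_insert_split[OF c(1)] .
  then have "face_boundary r (Suc p) ?d \<in> boundaries r F p"
    unfolding boundaries_def by (rule imageI)
  moreover have "x = face_boundary r (Suc p) ?d + frag_cmul (coeff t c) (face_boundary r (Suc p) (frag_of t))"
    by (simp add: c(2) face_boundary_diff face_boundary_cmul)
  ultimately show ?thesis using that by blast
qed

text \<open>No triangle contains the new edge, so a cycle through it is never a boundary and its
  coefficient becomes a new free coordinate. Old images do not involve \<open>e\<close>, hence the
  two summands cannot cancel.\<close>

lemma embeds_H1_edge:
  assumes closed: "\<And>I J. I \<in> F \<Longrightarrow> J \<subseteq> I \<Longrightarrow> J \<in> F"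
    and \<phi>: "embeds_H1 F \<phi>" and e: "e \<notin> F" "card e = 2"
  shows "embeds_H1 (insert e F) (\<lambda>c. \<phi> (c - frag_cmul (coeff e c) (frag_of e)) + frag_cmul (coeff e c) (frag_of e))"
    (is "embeds_H1 ?F ?\<phi>")
proof -
  let ?drop = "\<lambda>c. c - frag_cmul (coeff e c) (frag_of e)"
  have add: "\<phi> (x + y) = \<phi> x + \<phi> y" for x y using \<phi> by (simp add: embeds_H1_def)
  have B: "boundaries r ?F 1 = boundaries r F 1"
    using e by (intro boundaries_cong) auto
  have BC: "boundaries r F 1 \<subseteq> face_chains F 1" by (rule boundaries_chains) (rule closed)
  have drop: "?drop c \<in> face_chains F 1" if "c \<in> face_chains ?F 1" for c
    using face_chains_insert_split[OF that] .
  have \<phi>F: "\<phi> c \<in> face_chains F 1" if "c \<in> face_chains F 1" for c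
    using \<phi> that by (simp add: embeds_H1_def)
  have eF: "frag_of e \<in> face_chains ?F 1" using e by (simp add: face_chains_frag_of)
  show ?thesis
    unfolding embeds_H1_def
  proof (intro conjI allI ballI impI)
    fix x y
    have "?drop (x + y) = ?drop x + ?drop y" by (simp add: lookup_add frag_cmul_distrib)
    then have "\<phi> (?drop (x + y)) = \<phi> (?drop x) + \<phi> (?drop y)" by (simp only: add)
    then show "?\<phi> (x + y) = ?\<phi> x + ?\<phi> y"
      by (simp only: lookup_add frag_cmul_distrib) (simp add: algebra_simps)
  next
    fix c assume c: "c \<in> face_chains ?F 1"
    have "\<phi> (?drop c) \<in> face_chains ?F 1"
      using \<phi>F[OF drop[OF c]] face_chains_mono[of F ?F 1] by blast
    then show "?\<phi> c \<in> face_chains ?F 1"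
      by (intro face_chains_add face_chains_cmul eF)
  next
    fix c assume c: "c \<in> face_chains ?F 1" and cycle: "face_boundary r 1 c = 0"
    show "?\<phi> c = 0 \<longleftrightarrow> c \<in> boundaries r ?F 1"
    proof
      assume 0: "?\<phi> c = 0"
      have "coeff e (?\<phi> c) = coeff e c"
        using coeff_notin[OF \<phi>F[OF drop[OF c]] e(1)] by (simp add: lookup_add)
      then have ce: "coeff e c = 0" using 0 by simp
      then have "c \<in> face_chains F 1" "\<phi> c = 0" using drop[OF c] 0 by simp_all
      then show "c \<in> boundaries r ?F 1" using \<phi> cycle B by (simp add: embeds_H1_def)
    next
      assume b: "c \<in> boundaries r ?F 1"
      then have cF: "c \<in> face_chains F 1" using BC B by blast
      then have "coeff e c = 0" using coeff_notin e by blast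
      moreover have "\<phi> c = 0" using \<phi> cycle b cF B by (simp add: embeds_H1_def)
      ultimately show "?\<phi> c = 0" by simp
    qed
  qed
qed

text \<open>The new triangle trades the new edge for the other two sides: subtracting a multiple of
  its boundary \<open>D\<close> moves every chain off the new edge and keeps the class of a
  cycle.\<close>

lemma embeds_H1_expand:
  assumes closed: "\<And>I J. I \<in> F \<Longrightarrow> J \<subseteq> I \<Longrightarrow> J \<in> F" and FV: "F \<subseteq> Pow V"
    and \<phi>: "embeds_H1 F \<phi>" and abc: "a \<noteq> b" "a \<noteq> c" "b \<noteq> c"
    and new: "{a, b} \<notin> F" "{a, c} \<in> F" "{b, c} \<in> F"
  shows "\<exists>\<phi>. embeds_H1 (F \<union> {{a, b}, {c, a, b}}) \<phi>"
proof -
  let ?F = "F \<union> {{a, b}, {c, a, b}}" and ?e = "{a, b}" and ?t = "{c, a, b}"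
  have V: "a \<in> V" "b \<in> V" "c \<in> V" using FV new by auto
  have tset: "?t = {a, b, c}" by auto
  have tF: "?t \<notin> F" using closed[of ?t ?e] new by blast
  have card: "card ?e = 2" "card ?t = 3" using abc by simp_all
  have cl': "I \<in> ?F \<Longrightarrow> J \<subseteq> I \<Longrightarrow> J \<in> ?F" for I J
  proof -
    assume I: "I \<in> ?F" "J \<subseteq> I"
    have "J \<in> ?F" if J: "J \<subseteq> {c, a, b}"
    proof -
      have "J \<subseteq> {a, c} \<or> J \<subseteq> {b, c} \<or> J = {a, b} \<or> J = {c, a, b}" using J by blast
      then show ?thesis using closed new by blast
    qed
    moreover have "J \<subseteq> {c, a, b} \<or> I \<in> F" using I by blast
    ultimately show "J \<in> ?F" using closed I(2) by blast
  qed
  define D where "D = face_boundary r 2 (frag_of ?t)"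
  have DF: "D \<in> boundaries r ?F 1"
    unfolding D_def using boundaries_frag_of[of ?t ?F 1 r] card by (simp add: numeral_2_eq_2)
  have Dcyc: "face_boundary r 1 D = 0"
    using boundary_boundary_triangle[of ?t] V card by (simp add: D_def)
  have BC: "boundaries r F 1 \<subseteq> face_chains F 1" by (rule boundaries_chains) (rule closed)
  have "boundaries r ?F 1 \<subseteq> face_chains ?F 1" by (rule boundaries_chains) (rule cl')
  then have Dch: "D \<in> face_chains ?F 1" using DF by blast
  \<comment> \<open>The new edge occurs in \<open>D\<close> with coefficient 1 or -1. As
    \<open>\<epsilon> * \<epsilon> = 1\<close>, the multiple to subtract is
    \<open>\<epsilon> * coeff ?e c\<close>, without a division.\<close>
  define \<epsilon> where "\<epsilon> = coeff ?e D"
  have "{b, c} \<noteq> {a, b}" "{c, a} \<noteq> {a, b}" "{a, c} \<noteq> {a, b}" "{c, b} \<noteq> {a, b}"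
    using abc by (auto simp: doubleton_eq_iff)
  then have "coeff ?e (oriented_edge r b c) = 0" "coeff ?e (oriented_edge r c a) = 0"
    and "coeff ?e (oriented_edge r a b) = 1 \<or> coeff ?e (oriented_edge r a b) = -1"
    using abc by (simp_all add: oriented_edge_def insert_commute)
  then have \<epsilon>: "\<epsilon> = 1 \<or> \<epsilon> = -1"
    using boundary_triangle[OF V abc(1,3,2)] unfolding \<epsilon>_def D_def tset by (auto simp: lookup_add lookup_minus)
  then have \<epsilon>\<epsilon>: "\<epsilon> * \<epsilon> = 1" by auto
  let ?drop = "\<lambda>c. c - frag_cmul (\<epsilon> * coeff ?e c) D"
  have add: "\<phi> (x + y) = \<phi> x + \<phi> y" for x y using \<phi> by (simp add: embeds_H1_def)
  have chF: "face_chains ?F 1 = face_chains (insert ?e F) 1"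
    using card by (intro face_chains_cong) auto
  have drop: "?drop x \<in> face_chains F 1" if x: "x \<in> face_chains ?F 1" for x
  proof -
    have m: "?drop x \<in> face_chains ?F 1"
      using x Dch by (intro face_chains_diff face_chains_cmul)
    have "coeff ?e (?drop x) = coeff ?e x - \<epsilon> * coeff ?e x * \<epsilon>"
      by (simp add: lookup_minus \<epsilon>_def)
    also have "\<dots> = 0" using \<epsilon> by auto
    finally show ?thesis
      using face_chains_insert_split[of "?drop x" ?e F 1] m chF by simp
  qed
  have "embeds_H1 ?F (\<lambda>x. \<phi> (?drop x))"
    unfolding embeds_H1_def
  proof (intro conjI allI ballI impI)
    fix x y
    have "?drop (x + y) = ?drop x + ?drop y"
      by (simp add: lookup_add distrib_left frag_cmul_distrib)
    then show "\<phi> (?drop (x + y)) = \<phi> (?drop x) + \<phi> (?drop y)" by (simp only: add)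
  next
    fix x assume "x \<in> face_chains ?F 1"
    then have "\<phi> (?drop x) \<in> face_chains F 1" using drop \<phi> by (simp add: embeds_H1_def)
    then show "\<phi> (?drop x) \<in> face_chains ?F 1" using face_chains_mono[of F ?F 1] by blast
  next
    fix x assume x: "x \<in> face_chains ?F 1" and cycle: "face_boundary r 1 x = 0"
    have dc: "face_boundary r 1 (?drop x) = 0"
      using cycle Dcyc by (simp add: face_boundary_diff face_boundary_cmul)
    have iff: "\<phi> (?drop x) = 0 \<longleftrightarrow> ?drop x \<in> boundaries r F 1"
      using \<phi> drop[OF x] dc by (simp add: embeds_H1_def)
    have "?drop x \<in> boundaries r F 1 \<longleftrightarrow> x \<in> boundaries r ?F 1"
    proof
      assume "?drop x \<in> boundaries r F 1"
      then have "?drop x \<in> boundaries r ?F 1" using boundaries_mono[of F ?F r 1] by blast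
      from boundaries_add[OF this boundaries_cmul[OF DF, of "\<epsilon> * coeff ?e x"]]
      show "x \<in> boundaries r ?F 1" by simp
    next
      assume "x \<in> boundaries r ?F 1"
      also have "boundaries r ?F 1 = boundaries r (insert ?t F) 1"
        using card by (intro boundaries_cong) auto
      finally obtain k y where y: "y \<in> boundaries r F 1" "x = y + frag_cmul k D"
        using boundaries_insert by (metis D_def One_nat_def numeral_2_eq_2)
      have "y \<in> face_chains F 1" using y(1) BC by blast
      then have "coeff ?e x = k * \<epsilon>"
        using y(2) coeff_notin[OF _ new(1)] by (simp add: lookup_add \<epsilon>_def)
      then have "\<epsilon> * coeff ?e x = k" using \<epsilon> by auto
      then have "?drop x = y" using y(2) by simp
      then show "?drop x \<in> boundaries r F 1" using y(1) by simp
    qed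
    then show "\<phi> (?drop x) = 0 \<longleftrightarrow> x \<in> boundaries r ?F 1" using iff by simp
  qed
  then show ?thesis by blast
qed

text \<open>A pendant edge lies in no cycle, a new edge adds a coordinate, an expansion is undone by
  subtracting the triangle boundary, and the boundary of an attached triangle bounds already,
  because its boundary walk contracts.\<close>

lemma built_embeds_H1:
  assumes "built F" "F \<subseteq> Pow V" shows "\<exists>\<phi>. embeds_H1 F \<phi>"
  using assms
proof induction
  case (built_point v)
  have "{I \<in> {{}, {v}}. card I = Suc 1} = {}" by auto
  then have "face_chains {{}, {v}} 1 = {0}" by (simp only: face_chains_def) auto
  then have "embeds_H1 {{}, {v}} (\<lambda>c. c)" by (simp add: embeds_H1_def)
  then show ?case by blast
next
  case (built_vertex F u v)
  have FV: "F \<subseteq> Pow V" using built_vertex.prems by blast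
  then obtain \<phi> where \<phi>: "embeds_H1 F \<phi>" using built_vertex.IH by blast
  let ?F = "F \<union> {{v}, {u, v}}" and ?e = "{u, v}"
  have uv: "u \<noteq> v" using built_vertex.hyps by auto
  have V: "u \<in> V" "v \<in> V" using built_vertex.prems by auto
  have card: "card ?e = 2" using uv by simp
  note closed = built_closed[OF built_vertex.hyps(1)]
  let ?drop = "\<lambda>c. c - frag_cmul (coeff ?e c) (frag_of ?e)"
  have chF: "face_chains ?F 1 = face_chains (insert ?e F) 1"
    by (intro face_chains_cong) auto
  have B: "boundaries r ?F 1 = boundaries r F 1"
    using card by (intro boundaries_cong) auto
  have drop: "?drop x \<in> face_chains F 1" if "x \<in> face_chains ?F 1" for x
    using face_chains_insert_split[of x ?e F 1] that chF by simp
  have add: "\<phi> (x + y) = \<phi> x + \<phi> y" for x y using \<phi> by (simp add: embeds_H1_def)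
  \<comment> \<open>\<open>?e\<close> is the only edge at \<open>v\<close>, so the boundary of
    \<open>x\<close> has coefficient plus or minus \<open>coeff ?e x\<close> at
    \<open>{v}\<close>.\<close>
  have ce: "coeff ?e x = 0" if x: "x \<in> face_chains ?F 1" and cycle: "face_boundary r 1 x = 0" for x
  proof -
    have "x = ?drop x + frag_cmul (coeff ?e x) (frag_of ?e)" by simp
    then have "face_boundary r 1 x = face_boundary r 1 (?drop x) + frag_cmul (coeff ?e x) (face_boundary r 1 (frag_of ?e))"
      by (metis face_boundary_add face_boundary_cmul)
    moreover have "coeff {v} (face_boundary r 1 (?drop x)) = 0"
    proof (rule coeff_notin)
      show "face_boundary r 1 (?drop x) \<in> face_chains F 0"
        unfolding One_nat_def
      proof (rule face_boundary_in)
        show "?drop x \<in> face_chains F (Suc 0)" using drop[OF x] by simp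
      qed (rule closed)
      show "{v} \<notin> F" by fact
    qed
    moreover have "coeff {v} (face_boundary r 1 (frag_of ?e)) \<noteq> 0"
    proof (cases "(u, v) \<in> r")
      case True
      then show ?thesis using boundary_ordered_edge[OF True uv] uv by (simp add: lookup_minus)
    next
      case False
      then have "(v, u) \<in> r" using r_total V uv by blast
      from boundary_ordered_edge[OF this] uv show ?thesis by (simp add: lookup_minus insert_commute)
    qed
    ultimately have "coeff ?e x * coeff {v} (face_boundary r 1 (frag_of ?e)) = coeff {v} (face_boundary r 1 x)"
      by (simp add: lookup_add)
    also have "\<dots> = 0" using cycle by simp
    finally show ?thesis using \<open>coeff {v} (face_boundary r 1 (frag_of ?e)) \<noteq> 0\<close> by simp
  qed
  have "embeds_H1 ?F (\<lambda>x. \<phi> (?drop x))"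
    unfolding embeds_H1_def
  proof (intro conjI allI ballI impI)
    fix x y
    have "?drop (x + y) = ?drop x + ?drop y" by (simp add: lookup_add frag_cmul_distrib)
    then show "\<phi> (?drop (x + y)) = \<phi> (?drop x) + \<phi> (?drop y)" by (simp only: add)
  next
    fix x assume "x \<in> face_chains ?F 1"
    then have "\<phi> (?drop x) \<in> face_chains F 1" using drop \<phi> by (simp add: embeds_H1_def)
    then show "\<phi> (?drop x) \<in> face_chains ?F 1" using face_chains_mono[of F ?F 1] by blast
  next
    fix x assume x: "x \<in> face_chains ?F 1" and cycle: "face_boundary r 1 x = 0"
    have "?drop x = x" using ce[OF x cycle] by simp
    then show "\<phi> (?drop x) = 0 \<longleftrightarrow> x \<in> boundaries r ?F 1"
      using \<phi> drop[OF x] cycle B by (simp add: embeds_H1_def)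
  qed
  then show ?case by blast
next
  case (built_edge F u v)
  then obtain \<phi> where "embeds_H1 F \<phi>" by auto
  then show ?case
    using embeds_H1_edge[of F \<phi> "{u, v}"] built_closed[OF built_edge.hyps(1)] built_edge.hyps(4,5) by fastforce
next
  case (built_expand F a c b)
  then obtain \<phi> where \<phi>: "embeds_H1 F \<phi>" by auto
  have "F \<subseteq> Pow V" using built_expand.prems by blast
  then show ?case
    by (rule embeds_H1_expand[OF _ _ \<phi> built_expand.hyps(5,6,7,4,2,3), rotated])
       (rule built_closed[OF built_expand.hyps(1)])
next
  case (built_triangle F a b c)
  have FV: "F \<subseteq> Pow V" using built_triangle.prems by blast
  then obtain \<phi> where \<phi>: "embeds_H1 F \<phi>" using built_triangle.IH by blast
  have V: "a \<in> V" "b \<in> V" "c \<in> V" using built_triangle.prems by auto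
  let ?F = "insert {a, b, c} F" and ?D = "face_boundary r 2 (frag_of {a, b, c})"
  let ?T = "oriented_edge r a b + oriented_edge r b c + oriented_edge r c a"
  have card: "card {a, b, c} = 3" using built_triangle.hyps by simp
  have T: "?T \<in> boundaries r F 1"
    using walk_equiv_homologous[OF FV built_triangle.hyps(9)] by (simp add: add.assoc)
  have D: "?D \<in> boundaries r F 1"
    using boundary_triangle[OF V built_triangle.hyps(6,7,8)]
  proof
    assume "?D = ?T" then show ?thesis using T by (simp only:)
  next
    assume "?D = - ?T" then show ?thesis using boundaries_minus[OF T] by (simp only:)
  qed
  have "boundaries r ?F 1 \<subseteq> boundaries r F 1"
  proof
    fix x assume "x \<in> boundaries r ?F 1"
    then obtain k y where y: "y \<in> boundaries r F 1" "x = y + frag_cmul k (face_boundary r (Suc 1) (frag_of {a, b, c}))"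
      by (rule boundaries_insert)
    then have "x = y + frag_cmul k ?D" by (simp add: numeral_2_eq_2)
    then show "x \<in> boundaries r F 1" using boundaries_add[OF y(1) boundaries_cmul[OF D]] by simp
  qed
  then have B: "boundaries r ?F 1 = boundaries r F 1" using boundaries_mono[of F ?F r 1] by blast
  have "face_chains ?F 1 = face_chains F 1"
    using card by (intro face_chains_cong) auto
  then show ?case using \<phi> B unfolding embeds_H1_def by auto
qed

end

text \<open>The embedding is the augmentation onto a base vertex in degree 0 and the inductively
  built map in degree 1. From degree 2 on it is the identity, as there are no higher faces and so no
  nonzero boundaries.\<close>

theorem built_homology_free:
  assumes S: "is_abs_complex S" and b: "built (faces S)" and card: "\<And>I. I \<in> faces S \<Longrightarrow> card I \<le> 3"
    and r: "linear_order_on (verts S) r"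
  shows "is_free_abelian (simplicial_homology_group r S p)"
proof -
  interpret oriented_vertices r "verts S" by unfold_locales (rule r)
  let ?F = "faces S"
  have FV: "?F \<subseteq> Pow (verts S)" and fin: "finite (verts S)" using S by (auto simp: is_abs_complex_def)
  have finF: "finite ?F" using finite_subset[OF FV] fin by simp
  have BC: "boundaries r ?F q \<subseteq> face_chains ?F q" for q
    by (rule oriented_vertices.boundaries_chains[OF oriented_vertices.intro[OF r]]) (rule built_closed[OF b])
  let ?E = "{I \<in> ?F. card I = Suc p}"
  let ?Z = "{c \<in> carrier (face_chain_group S p). face_boundary r p c = 0}"
  have car: "carrier (face_chain_group S q) = face_chains ?F q" for q
    by (auto simp: face_chain_group_def face_chains_def)
  have B_eq: "face_boundary r (Suc p) ` carrier (face_chain_group S (Suc p)) = boundaries r ?F p"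
    by (simp add: car boundaries_def)
  have main: "is_free_abelian (simplicial_homology_group r S p)"
    if fE: "finite E'" and add: "\<And>x y. \<phi> (x + y) = \<phi> x + \<phi> y"
      and keys: "\<And>c. c \<in> face_chains ?F p \<Longrightarrow> Poly_Mapping.keys (\<phi> c) \<subseteq> E'"
      and BZ: "boundaries r ?F p \<subseteq> ?Z"
      and ker: "\<And>c. c \<in> face_chains ?F p \<Longrightarrow> face_boundary r p c = 0 \<Longrightarrow> \<phi> c = 0 \<longleftrightarrow> c \<in> boundaries r ?F p"
    for E' :: "'a set set" and \<phi> :: "('a set \<Rightarrow>\<^sub>0 int) \<Rightarrow> ('a set \<Rightarrow>\<^sub>0 int)"
    unfolding simplicial_homology_group_def B_eq unfolding face_chain_group_def
  proof (rule free_abelian_quotient[where \<phi> = \<phi>, OF fE add])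
    show "boundaries r ?F p \<subseteq> {c \<in> carrier (free_Abelian_group ?E). face_boundary r p c = 0}"
      using BZ by (simp add: face_chain_group_def)
  qed (use keys ker in \<open>auto simp: face_chains_def face_boundary_diff dest: keys_diff[THEN subsetD]\<close>)
  consider "p = 0" | "p = 1" | "2 \<le> p" by linarith
  then show ?thesis
  proof cases
    case 1
    obtain u where u: "{u} \<in> ?F" "\<And>v. {v} \<in> ?F \<Longrightarrow> frag_of {v} - frag_of {u} \<in> boundaries r ?F 0"
      using built_connected[OF b FV] by blast
    let ?\<phi> = "frag_extend (\<lambda>I. frag_of {u})"
    have c: "c - ?\<phi> c \<in> boundaries r ?F 0" if "c \<in> face_chains ?F 0" for c
    proof -
      have "Poly_Mapping.keys c \<subseteq> {I \<in> ?F. card I = Suc 0}" using that by (simp add: face_chains_def)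
      then show ?thesis
      proof (induction c rule: frag_induction)
        case (one I)
        then obtain v where "I = {v}" by (auto simp: card_1_singleton_iff)
        then show ?case using u(2)[of v] one by simp
      next
        case (diff x y)
        then show ?case using boundaries_diff[OF diff] by (simp add: frag_extend_diff algebra_simps)
      qed simp
    qed
    have 0: "?\<phi> c = 0" if cB: "c \<in> boundaries r ?F 0" for c
    proof -
      obtain d where d: "d \<in> face_chains ?F 1" "c = face_boundary r 1 d"
        using cB by (auto simp: boundaries_def)
      have "Poly_Mapping.keys d \<subseteq> {I \<in> ?F. card I = 2}" using d(1) by (simp add: face_chains_def numeral_2_eq_2)
      then have "?\<phi> (face_boundary r 1 d) = 0"
      proof (induction d rule: frag_induction)
        case (one I)
        then obtain x y where I: "I = {x, y}" "x \<noteq> y" by (auto simp: card_2_iff)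
        then have "x \<in> verts S" "y \<in> verts S" using one FV by auto
        then consider "(x, y) \<in> r" | "(y, x) \<in> r" using r_total I by blast
        then show ?case
        proof cases
          case 1
          then show ?thesis using boundary_ordered_edge[OF 1 I(2)] I(1) by (simp add: frag_extend_diff)
        next
          case 2
          then show ?thesis using boundary_ordered_edge[OF 2] I by (simp add: frag_extend_diff insert_commute)
        qed
      qed (simp_all add: face_boundary_diff frag_extend_diff)
      then show ?thesis using d(2) by simp
    qed
    show ?thesis
    proof (rule main[where \<phi> = ?\<phi> and E' = "{{u}}"])
      show "Poly_Mapping.keys (?\<phi> c) \<subseteq> {{u}}" for c
        by (rule subset_trans[OF keys_frag_extend]) (auto simp: keys_frag_of)
      show "boundaries r ?F p \<subseteq> ?Z"
        using BC[of p] 1 by (auto simp: car face_boundary_def)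
      show "?\<phi> x = 0 \<longleftrightarrow> x \<in> boundaries r ?F p" if "x \<in> face_chains ?F p" for x
        using c[of x] 0[of x] that 1 by auto
    qed (simp_all add: frag_extend_add)
  next
    case 2
    obtain \<phi> where \<phi>: "embeds_H1 ?F \<phi>" using built_embeds_H1[OF b FV] by blast
    show ?thesis
    proof (rule main[where \<phi> = \<phi> and E' = ?F])
      show "Poly_Mapping.keys (\<phi> c) \<subseteq> ?F" if "c \<in> face_chains ?F p" for c
      proof -
        have "\<phi> c \<in> face_chains ?F 1" using \<phi> that 2 by (simp add: embeds_H1_def)
        then show ?thesis by (auto simp: face_chains_def)
      qed
      show "boundaries r ?F p \<subseteq> ?Z"
        using BC[of p] boundary_boundary[OF FV] 2 by (auto simp: car)
    qed (use \<phi> 2 finF in \<open>simp_all add: embeds_H1_def\<close>)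
  next
    case 3
    have none: "{I \<in> ?F. card I = Suc (Suc p)} = {}" using card 3 by fastforce
    have "face_chains ?F (Suc p) = {0}" unfolding face_chains_def none by auto
    then have B: "boundaries r ?F p = {0}" by (simp add: boundaries_def)
    show ?thesis
      by (rule main[where \<phi> = "\<lambda>c. c" and E' = ?F]) (use finF in \<open>auto simp: B car face_chains_def\<close>)
  qed
qed

section \<open>Comparing walks\<close>

lemma walk_equiv_context:
  assumes "walk_equiv F p q" shows "walk_equiv F (us @ p @ vs) (us @ q @ vs)"
  using assms
proof induction
  case (walk_stay xs a ys)
  show ?case using walk_equiv.walk_stay[of F "us @ xs" a "ys @ vs"] by simp
next
  case (walk_face a b c xs ys)
  then show ?case using walk_equiv.walk_face[of a b c F "us @ xs" "ys @ vs"] by simp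
qed (blast intro: walk_equiv.intros)+

lemma walk_equiv_append:
  assumes "walk_equiv F p p'" "walk_equiv F q q'" shows "walk_equiv F (p @ q) (p' @ q')"
  using walk_equiv_context[OF assms(1), of "[]" q] walk_equiv_context[OF assms(2), of p' "[]"]
  by (simp add: walk_trans)

lemma walk_equiv_rev: "walk_equiv F p q \<Longrightarrow> walk_equiv F (rev p) (rev q)"
proof (induction rule: walk_equiv.induct)
  case (walk_stay xs a ys)
  show ?case using walk_equiv.walk_stay[of F "rev ys" a "rev xs"] by simp
next
  case (walk_face a b c xs ys)
  then have "{c, b, a} \<in> F" by (simp add: insert_commute)
  from walk_equiv.walk_face[OF this, of "rev ys" "rev xs"] show ?case by simp
qed (blast intro: walk_equiv.intros)+

lemma walk_equiv_mono: "walk_equiv F p q \<Longrightarrow> F \<subseteq> G \<Longrightarrow> walk_equiv G p q"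
  by (induction rule: walk_equiv.induct) (blast intro: walk_equiv.intros)+

lemma walk_stay': "walk_equiv F [a, a] [a]"
  using walk_stay[of F "[]" a "[]"] by simp

lemma walk_face': "{a, b, c} \<in> F \<Longrightarrow> walk_equiv F [a, b, c] [a, c]"
  using walk_face[of a b c F "[]" "[]"] by simp

lemma walk_back: "{a, b} \<in> F \<Longrightarrow> walk_equiv F [a, b, a] [a]"
  using walk_trans[OF walk_face'[of a b a F] walk_stay'] by (simp add: insert_commute)

lemma walk_rev_right: "is_walk F w \<Longrightarrow> walk_equiv F (w @ rev w) [hd w]"
proof (induction w rule: induct_list012)
  case (2 a)
  then show ?case by (simp add: walk_stay')
next
  case (3 a b l)
  have "walk_equiv F ((b # l) @ rev (b # l)) [b]" using 3 by simp
  from walk_equiv_context[OF this, of "[a]" "[a]"]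
  have "walk_equiv F ((a # b # l) @ rev (a # b # l)) [a, b, a]" by simp
  moreover have "walk_equiv F [a, b, a] [a]" using 3(3) by (intro walk_back) simp
  ultimately show ?case using walk_trans by fastforce
qed simp

lemma walk_rev_left: "is_walk F w \<Longrightarrow> walk_equiv F (rev w @ w) [last w]"
proof (induction w rule: induct_list012)
  case (2 a)
  then show ?case by (simp add: walk_stay')
next
  case (3 a b l)
  have "{b, a} \<in> F" using 3(3) by (simp add: insert_commute)
  then have "walk_equiv F [b, a, b] [b, b]"
    using walk_face'[of b a b F] by (simp add: insert_commute)
  moreover have "walk_equiv F [b, a, a, b] [b, a, b]" using walk_stay[of F "[b]" a "[b]"] by simp
  ultimately have "walk_equiv F [b, a, a, b] [b, b]" using walk_trans by blast
  from walk_equiv_context[OF this, of "rev l" l]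
  have "walk_equiv F (rev (a # b # l) @ (a # b # l)) (rev (b # l) @ (b # l))" by simp
  moreover have "walk_equiv F (rev (b # l) @ (b # l)) [last (b # l)]" using 3 by simp
  ultimately show ?case using walk_trans by fastforce
qed simp

lemma is_walk_snoc:
  "is_walk F w \<Longrightarrow> {last w, x} \<in> F \<Longrightarrow> {x} \<in> F \<Longrightarrow> is_walk F (w @ [x])"
  by (induction w rule: induct_list012) auto

text \<open>The walks \<open>W x\<close> from \<open>\<rho> x\<close> to \<open>x\<close> serve to compare the homotopy class of an edge with
  that of the corresponding edge between the points \<open>\<rho> x\<close>.\<close>

locale walk_labelling =
  fixes F :: "'a set set" and V :: "'a set" and \<rho> :: "'a \<Rightarrow> 'a" and W :: "'a \<Rightarrow> 'a list"
  assumes W_walk: "x \<in> V \<Longrightarrow> is_walk F (W x)"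
    and W_last: "x \<in> V \<Longrightarrow> last (W x) = x"
    and W_hd: "x \<in> V \<Longrightarrow> hd (W x) = \<rho> x"
begin

text \<open>\<open>W x\<close> ends at \<open>x\<close> and \<open>rev (W y)\<close> starts at
  \<open>y\<close>, so their concatenation crosses the edge from \<open>x\<close> to
  \<open>y\<close> on its way from \<open>\<rho> x\<close> to \<open>\<rho> y\<close>.\<close>

definition edge_good :: "'a \<Rightarrow> 'a \<Rightarrow> bool" where
  "edge_good x y \<longleftrightarrow> walk_equiv F (W x @ rev (W y)) [\<rho> x, \<rho> y]"

lemma W_not_Nil: "x \<in> V \<Longrightarrow> W x \<noteq> []"
  using W_walk by fastforce

lemma W_snoc: "x \<in> V \<Longrightarrow> W x = butlast (W x) @ [x]"
  using W_not_Nil W_last append_butlast_last_id by metis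

lemma detour: "x \<in> V \<Longrightarrow> walk_equiv F [x] (rev (W x) @ W x)"
  using walk_sym[OF walk_rev_left[OF W_walk]] W_last by metis

lemma edge_good_sym:
  assumes "edge_good x y" shows "edge_good y x"
  using walk_equiv_rev[OF assms[unfolded edge_good_def]] by (simp add: edge_good_def)

lemma edge_good_self: "x \<in> V \<Longrightarrow> edge_good x x"
  unfolding edge_good_def
  using walk_trans[OF walk_rev_right[OF W_walk] walk_sym[OF walk_stay']] W_hd by metis

text \<open>The stop at \<open>c\<close> is replaced by the round trip to \<open>\<rho> c\<close>
  and back, which cuts the walk into two transported edges.\<close>

lemma edge_good_path:
  assumes V: "x \<in> V" "c \<in> V" "y \<in> V" and good: "edge_good x c" "edge_good c y"
  shows "walk_equiv F (W x @ [c] @ rev (W y)) [\<rho> x, \<rho> c, \<rho> y]"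
proof -
  have 1: "walk_equiv F (W x @ [c] @ rev (W y)) (W x @ (rev (W c) @ W c) @ rev (W y))"
    by (rule walk_equiv_context[OF detour[OF V(2)]])
  have 2: "walk_equiv F ((W x @ rev (W c)) @ (W c @ rev (W y))) ([\<rho> x, \<rho> c] @ [\<rho> c, \<rho> y])"
    using good unfolding edge_good_def by (rule walk_equiv_append)
  have 3: "walk_equiv F ([\<rho> x, \<rho> c] @ [\<rho> c, \<rho> y]) [\<rho> x, \<rho> c, \<rho> y]"
    using walk_stay[of F "[\<rho> x]" "\<rho> c" "[\<rho> y]"] by simp
  show ?thesis using walk_trans[OF 1] walk_trans[OF 2 3] by simp
qed

text \<open>The face replaces the walk over \<open>c\<close> by the edge from \<open>x\<close> to
  \<open>y\<close>, and the assumption \<open>root\<close> does the same among the labels. This is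
  how goodness passes from the two old sides of an expansion to the new edge.\<close>

lemma edge_good_face:
  assumes V: "x \<in> V" "c \<in> V" "y \<in> V" and face: "{x, c, y} \<in> F"
    and good: "edge_good x c" "edge_good c y" and root: "walk_equiv F [\<rho> x, \<rho> c, \<rho> y] [\<rho> x, \<rho> y]"
  shows "edge_good x y"
proof -
  obtain A B where AB: "W x = A @ [x]" "W y = B @ [y]"
    using W_snoc[OF V(1)] W_snoc[OF V(3)] by blast
  have "walk_equiv F (A @ [x, c, y] @ rev B) (A @ [x, y] @ rev B)"
    by (rule walk_equiv_context[OF walk_face'[OF face]])
  then have "walk_equiv F (W x @ [c] @ rev (W y)) (W x @ rev (W y))" by (simp add: AB)
  from walk_trans[OF walk_sym[OF this] walk_trans[OF edge_good_path[OF V good] root]]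
  show ?thesis unfolding edge_good_def .
qed

text \<open>Crossing a tree edge and returning along the longer walk is a backtrack at the end of
  \<open>W p\<close>.\<close>

lemma edge_good_tree:
  assumes V: "p \<in> V" "x \<in> V" and W: "W x = W p @ [x]" and face: "{p, x} \<in> F" and \<rho>: "\<rho> x = \<rho> p"
  shows "edge_good p x"
proof -
  obtain A where A: "W p = A @ [p]" using W_snoc[OF V(1)] by blast
  have "walk_equiv F [p, x, p] [p, p]"
    using face walk_face'[of p x p F] by (simp add: insert_commute)
  from walk_equiv_context[OF this, of A "rev A"]
  have "walk_equiv F (W p @ rev (W x)) (W p @ rev (W p))" by (simp add: W A)
  from walk_trans[OF this edge_good_self[OF V(1), unfolded edge_good_def]]
  show ?thesis unfolding edge_good_def \<rho> .
qed

text \<open>Transport turns two sides into a walk over the labels, which \<open>root\<close>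
  shortens; transporting back gives the third side, since round trips along \<open>W\<close>
  contract. What remains is a backtrack over the edge from \<open>a\<close> to
  \<open>c\<close>.\<close>

lemma triangle_null:
  assumes V: "a \<in> V" "b \<in> V" "c \<in> V" and good: "edge_good a b" "edge_good b c" "edge_good a c"
    and edge: "{a, c} \<in> F" and root: "walk_equiv F [\<rho> a, \<rho> b, \<rho> c] [\<rho> a, \<rho> c]"
  shows "walk_equiv F [a, b, c, a] [a]"
proof -
  have "walk_equiv F (W a @ [b] @ rev (W c)) (W a @ rev (W c))"
    using walk_trans[OF walk_trans[OF edge_good_path[OF V good(1,2)] root]
        walk_sym[OF good(3)[unfolded edge_good_def]]] .
  from walk_equiv_context[OF this, of "rev (W a)" "W c"]
  have 1: "walk_equiv F ((rev (W a) @ W a) @ [b] @ (rev (W c) @ W c)) ((rev (W a) @ W a) @ (rev (W c) @ W c))"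
    by simp
  have 2: "walk_equiv F ([a] @ [b] @ [c]) ((rev (W a) @ W a) @ [b] @ (rev (W c) @ W c))"
    by (intro walk_equiv_append detour V walk_refl)
  have 3: "walk_equiv F ((rev (W a) @ W a) @ (rev (W c) @ W c)) ([a] @ [c])"
    by (rule walk_sym, intro walk_equiv_append detour V)
  have "walk_equiv F [a, b, c] [a, c]" using walk_trans[OF walk_trans[OF 2 1] 3] by simp
  from walk_equiv_context[OF this, of "[]" "[a]"]
  have 4: "walk_equiv F [a, b, c, a] [a, c, a]" by simp
  show ?thesis using walk_trans[OF 4 walk_back[OF edge]] .
qed

end

section \<open>Building a complex in a prescribed order\<close>

lemma finite_has_greatest:
  fixes f :: "'b \<Rightarrow> nat"
  assumes "finite A" "A \<noteq> {}" shows "\<exists>x\<in>A. \<forall>y\<in>A. f y \<le> f x"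
proof -
  have "Max (f ` A) \<in> f ` A" using assms by (intro Max_in) auto
  then obtain x where x: "x \<in> A" "Max (f ` A) = f x" by blast
  have "f y \<le> f x" if "y \<in> A" for y
    using Max_ge[of "f ` A" "f y"] assms(1) that x(2) by simp
  then show ?thesis using x(1) by blast
qed

text \<open>Among the vertices other than \<open>r0\<close>, one of greatest \<open>D\<close> is
  nobody's parent, so it is a leaf and can be attached last.\<close>

lemma built_tree:
  assumes "finite U" "r0 \<in> U" "\<And>x. x \<in> U \<Longrightarrow> x \<noteq> r0 \<Longrightarrow> P x \<in> U \<and> D (P x) < (D x :: nat)"
  shows "built ({{}} \<union> (\<lambda>x. {x}) ` U \<union> (\<lambda>x. {P x, x}) ` (U - {r0}))"
  using assms
proof (induction "card U" arbitrary: U rule: less_induct)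
  case less
  show ?case
  proof (cases "U = {r0}")
    case True
    then show ?thesis using built_point[of r0] by (simp add: insert_commute)
  next
    case False
    then have ne: "U - {r0} \<noteq> {}" using less.prems by blast
    obtain x where x: "x \<in> U - {r0}" "\<And>y. y \<in> U - {r0} \<Longrightarrow> D y \<le> D x"
      using finite_has_greatest[of "U - {r0}" D] less.prems(1) ne by blast
    let ?U = "U - {x}"
    let ?F = "{{}} \<union> (\<lambda>x. {x}) ` ?U \<union> (\<lambda>x. {P x, x}) ` (?U - {r0})"
    have P: "P y \<in> ?U" if "y \<in> U" "y \<noteq> r0" for y
      using less.prems(3)[OF that] x(2)[of y] that by force
    have "built ?F"
    proof (rule less.hyps)
      show "card ?U < card U" using x less.prems(1) by (intro psubset_card_mono) auto
      show "P y \<in> ?U \<and> D (P y) < D y" if "y \<in> ?U" "y \<noteq> r0" for y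
        using P[of y] less.prems(3)[of y] that by blast
    qed (use x less.prems in auto)
    moreover have "{P x} \<in> ?F" using P[of x] x by blast
    moreover have "{x} \<notin> ?F" by auto
    ultimately have "built (?F \<union> {{x}, {P x, x}})" by (rule built_vertex)
    moreover have "?F \<union> {{x}, {P x, x}} = {{}} \<union> (\<lambda>x. {x}) ` U \<union> (\<lambda>x. {P x, x}) ` (U - {r0})"
      using x(1) by auto
    ultimately show ?thesis by simp
  qed
qed

lemma built_add_edges:
  assumes "finite E" "built F" "\<And>e. e \<in> E \<Longrightarrow> \<exists>u v. e = {u, v} \<and> u \<noteq> v \<and> {u} \<in> F \<and> {v} \<in> F"
  shows "built (F \<union> E)"
  using assms
proof (induction E rule: finite_induct)
  case (insert e E)
  have b: "built (F \<union> E)"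
    by (rule insert.IH[OF insert.prems(1)], rule insert.prems(2)) simp
  obtain u v where "e = {u, v}" "u \<noteq> v" "{u} \<in> F" "{v} \<in> F" using insert.prems(2)[of e] by blast
  then have "built (insert e (F \<union> E))"
    using built_edge[OF b, of u v] b by (cases "e \<in> F \<union> E") (auto simp: insert_absorb)
  then show ?case by simp
qed simp

lemma built_add_triangles:
  assumes "finite T" "built F"
    "\<And>t. t \<in> T \<Longrightarrow> \<exists>a b c. t = {a, b, c} \<and> a \<noteq> b \<and> b \<noteq> c \<and> a \<noteq> c \<and> {a, b} \<in> F \<and> {b, c} \<in> F \<and> {a, c} \<in> F
        \<and> walk_equiv F [a, b, c, a] [a]"
  shows "built (F \<union> T)"
  using assms
proof (induction T rule: finite_induct)
  case (insert t T)
  have b: "built (F \<union> T)"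
    by (rule insert.IH[OF insert.prems(1)], rule insert.prems(2)) simp
  obtain a b c where t: "t = {a, b, c}" "a \<noteq> b" "b \<noteq> c" "a \<noteq> c" "{a, b} \<in> F" "{b, c} \<in> F" "{a, c} \<in> F"
    "walk_equiv F [a, b, c, a] [a]" using insert.prems(2)[OF insertI1] by (elim exE conjE)
  have "built (insert t (F \<union> T))"
  proof (cases "t \<in> F \<union> T")
    case True
    then show ?thesis using b by (simp add: insert_absorb)
  next
    case False
    then show ?thesis
      using built_triangle[OF b, of a b c] t walk_equiv_mono[OF t(8), of "F \<union> T"] by simp
  qed
  then show ?case by simp
qed simp

text \<open>Edges come in order of increasing \<open>\<mu>\<close>. The induction takes away an edge
  of greatest \<open>\<mu>\<close>; the other two sides of its triangle lie strictly lower or in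
  \<open>F\<close>, so they are still present.\<close>

lemma built_add_expansions:
  fixes \<mu> :: "'a set \<Rightarrow> nat"
  assumes "finite E" "built F"
    "\<And>e. e \<in> E \<Longrightarrow> \<exists>a b. e = {a, b} \<and> a \<noteq> b \<and> \<kappa> e \<noteq> a \<and> \<kappa> e \<noteq> b \<and> e \<notin> F \<and>
      {a, \<kappa> e} \<in> F \<union> {e' \<in> E. \<mu> e' < \<mu> e} \<and> {b, \<kappa> e} \<in> F \<union> {e' \<in> E. \<mu> e' < \<mu> e}"
  shows "built (F \<union> E \<union> (\<lambda>e. insert (\<kappa> e) e) ` E)"
  using assms
proof (induction "card E" arbitrary: E rule: less_induct)
  case less
  show ?case
  proof (cases "E = {}")
    case True
    then show ?thesis using less.prems by simp
  next
    case False
    obtain e where e: "e \<in> E" "\<And>e'. e' \<in> E \<Longrightarrow> \<mu> e' \<le> \<mu> e"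
      using finite_has_greatest[OF less.prems(1) False, of \<mu>] by blast
    let ?E = "E - {e}"
    let ?G = "F \<union> ?E \<union> (\<lambda>e. insert (\<kappa> e) e) ` ?E"
    have lower: "{e' \<in> E. \<mu> e' < \<mu> d} \<subseteq> ?E" if "d \<in> E" for d
      using e(2)[OF that] by auto
    have lower': "{e' \<in> E. \<mu> e' < \<mu> d} = {e' \<in> ?E. \<mu> e' < \<mu> d}" if "d \<in> E" for d
      using lower[OF that] by blast
    have G: "built ?G"
    proof (rule less.hyps)
      show "card ?E < card E" using e less.prems(1) by (intro psubset_card_mono) auto
      show "\<exists>a b. d = {a, b} \<and> a \<noteq> b \<and> \<kappa> d \<noteq> a \<and> \<kappa> d \<noteq> b \<and> d \<notin> F \<and>
          {a, \<kappa> d} \<in> F \<union> {e' \<in> ?E. \<mu> e' < \<mu> d} \<and> {b, \<kappa> d} \<in> F \<union> {e' \<in> ?E. \<mu> e' < \<mu> d}"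
        if "d \<in> ?E" for d
      proof -
        have d: "d \<in> E" using that by blast
        show ?thesis using less.prems(3)[OF d] unfolding lower'[OF d] .
      qed
    qed (use less.prems in auto)
    obtain a b where ab: "e = {a, b}" "a \<noteq> b" "\<kappa> e \<noteq> a" "\<kappa> e \<noteq> b" "e \<notin> F"
      "{a, \<kappa> e} \<in> F \<union> {e' \<in> E. \<mu> e' < \<mu> e}" "{b, \<kappa> e} \<in> F \<union> {e' \<in> E. \<mu> e' < \<mu> e}"
      using less.prems(3)[OF e(1)] by (elim exE conjE)
    \<comment> \<open>The number of vertices tells the new edge from the triangles attached
      before.\<close>
    have "e \<noteq> insert (\<kappa> d) d" if d: "d \<in> ?E" for d
    proof -
      obtain u v where "d = {u, v}" "u \<noteq> v" "\<kappa> d \<noteq> u" "\<kappa> d \<noteq> v" using less.prems(3)[of d] d by blast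
      then have "card (insert (\<kappa> d) d) = 3" by simp
      moreover have "card e = 2" using ab by simp
      ultimately show ?thesis by auto
    qed
    then have "e \<notin> ?G" using ab(5) by blast
    then have new: "{a, b} \<notin> ?G" unfolding ab(1) .
    have sub: "F \<union> {e' \<in> E. \<mu> e' < \<mu> e} \<subseteq> ?G" using lower[OF e(1)] by blast
    have "built (?G \<union> {{a, b}, {\<kappa> e, a, b}})"
      by (rule built_expand[OF G subsetD[OF sub ab(6)] subsetD[OF sub ab(7)] new ab(2)
            ab(3)[symmetric] ab(4)[symmetric]])
    moreover have "?G \<union> {{a, b}, {\<kappa> e, a, b}} = F \<union> E \<union> (\<lambda>e. insert (\<kappa> e) e) ` E"
      using e(1) ab(1) by auto
    ultimately show ?thesis by simp
  qed
qed

section \<open>Complexes of zero sets\<close>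

locale zero_sets =
  fixes V :: "'a set" and L :: "'a set set"
  assumes finite_V: "finite V" and finite_L: "finite L" and L_sub: "L \<subseteq> Pow V"
begin

definition adj :: "'a \<Rightarrow> 'a \<Rightarrow> bool" where
  "adj x y \<longleftrightarrow> x \<in> V \<and> y \<in> V \<and> (\<exists>Z\<in>L. (x \<in> Z) \<noteq> (y \<in> Z))"

definition tri :: "'a \<Rightarrow> 'a \<Rightarrow> 'a \<Rightarrow> bool" where
  "tri x y z \<longleftrightarrow> adj x y \<and> z \<in> V \<and> (\<exists>Z\<in>L. x \<in> Z \<and> y \<in> Z \<and> z \<notin> Z)"

definition vertex_faces :: "'a set set" where
  "vertex_faces = {{}} \<union> (\<lambda>x. {x}) ` V"

definition edge_faces :: "'a set set" where
  "edge_faces = {{x, y} |x y. adj x y}"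

definition triangle_faces :: "'a set set" where
  "triangle_faces = {{x, y, z} |x y z. tri x y z}"

text \<open>The set \<open>V\<close> is excluded: it misses no vertex and so yields no triangle, yet
  it would turn every edge of the complex into an edge of the graph.\<close>

definition flat_adj :: "'a set set \<Rightarrow> 'a \<Rightarrow> 'a \<Rightarrow> bool" where
  "flat_adj L' x y \<longleftrightarrow> adj x y \<and> (\<exists>Z\<in>L'. x \<in> Z \<and> y \<in> Z \<and> Z \<noteq> V)"

lemma adj_sym: "adj x y \<Longrightarrow> adj y x"
  by (auto simp: adj_def)

lemma adj_neq: "adj x y \<Longrightarrow> x \<noteq> y"
  by (auto simp: adj_def)

lemma adj_V: "adj x y \<Longrightarrow> x \<in> V \<and> y \<in> V"
  by (auto simp: adj_def)

text \<open>The member of \<open>L\<close> that separates \<open>x\<close> from \<open>y\<close>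
  separates \<open>z\<close> from one of them. In other words, not being adjacent is
  transitive.\<close>

lemma adj_cases: "adj x y \<Longrightarrow> z \<in> V \<Longrightarrow> adj z x \<or> adj z y"
  by (auto simp: adj_def)

lemma tri_adj: assumes "tri x y z" shows "adj x y" "adj x z" "adj y z"
  using assms by (auto simp: tri_def adj_def)

lemma flat_adj_sym: "flat_adj L' x y \<Longrightarrow> flat_adj L' y x"
  using adj_sym by (auto simp: flat_adj_def)

lemma flat_adj_imp_adj: "flat_adj L' x y \<Longrightarrow> adj x y"
  by (simp add: flat_adj_def)

lemma flat_adj_rtranclp_sym: "(flat_adj L')\<^sup>*\<^sup>* x y \<Longrightarrow> (flat_adj L')\<^sup>*\<^sup>* y x"
  using flat_adj_sym by (metis sympD sympI symp_rtranclp)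

definition joined :: "'a set set \<Rightarrow> bool" where
  "joined L' \<longleftrightarrow> (\<forall>x\<in>V. \<forall>y\<in>V. (flat_adj L')\<^sup>*\<^sup>* x y)"

text \<open>If the flat through \<open>x\<close> and \<open>y\<close> contained \<open>z\<close>,
  then \<open>z\<close> would be adjacent to one of them within that flat and lie in their
  component.\<close>

lemma tri_of_flat_adj:
  assumes L': "L' \<subseteq> L" and g: "flat_adj L' x y" and z: "z \<in> V" "\<not> (flat_adj L')\<^sup>*\<^sup>* x z"
  shows "tri x y z"
proof -
  obtain Z where Z: "Z \<in> L'" "x \<in> Z" "y \<in> Z" "Z \<noteq> V" and xy: "adj x y" using g by (auto simp: flat_adj_def)
  have "z \<notin> Z"
  proof
    assume "z \<in> Z"
    from adj_cases[OF xy z(1)] have "flat_adj L' x z \<or> flat_adj L' y z"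
      using Z \<open>z \<in> Z\<close> adj_sym by (auto simp: flat_adj_def)
    then have "(flat_adj L')\<^sup>*\<^sup>* x z" using g by (meson r_into_rtranclp rtranclp.rtrancl_into_rtrancl)
    then show False using z by simp
  qed
  then show ?thesis using Z xy z L' by (auto simp: tri_def)
qed

text \<open>The flat through \<open>x\<close> and \<open>a\<close> misses \<open>y\<close>, for
  otherwise it would make \<open>x\<close> and \<open>y\<close> neighbours in the graph.\<close>

lemma tri_of_flat_adj_step:
  assumes L': "L' \<subseteq> L" and g: "flat_adj L' x a" and y: "y \<in> V" "adj x y" "\<not> flat_adj L' x y"
  shows "tri x a y"
  using assms by (auto simp: tri_def flat_adj_def)

text \<open>The choice of \<open>L'\<close>: maximal among the subfamilies of \<open>L\<close> that leave the graph on \<open>V\<close>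
  disconnected. Either \<open>L' = L\<close>, and every triangle has two vertices in one component, or one
  further set \<open>S\<close> meets all components and a vertex \<open>r0\<close> outside \<open>S\<close> spans triangles with
  all edges inside \<open>S\<close>.\<close>

lemma obtain_subfamily:
  assumes t: "tri x0 y0 z0"
  obtains L' S r0 where "L' \<subseteq> L" "\<not> joined L'" "r0 \<in> V" "\<exists>x. flat_adj L' r0 x"
    "S \<subseteq> V" "\<And>x. x \<in> V \<Longrightarrow> \<exists>z\<in>S. (flat_adj L')\<^sup>*\<^sup>* x z"
    "(\<forall>x y z. tri x y z \<longrightarrow> flat_adj L' x y) \<or> (\<forall>u\<in>S. \<forall>v\<in>S. adj u v \<longrightarrow> tri u v r0)"
proof -
  have "\<not> joined {}"
  proof -
    have "x = y" if "(flat_adj {})\<^sup>*\<^sup>* x y" for x y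
      using that by (induction rule: rtranclp_induct) (auto simp: flat_adj_def)
    then have "\<not> (flat_adj {})\<^sup>*\<^sup>* x0 y0" using adj_neq[OF tri_adj(1)[OF t]] by blast
    then show ?thesis using adj_V[OF tri_adj(1)[OF t]] unfolding joined_def by blast
  qed
  then have "{} \<in> {L'. L' \<subseteq> L \<and> \<not> joined L'}" by simp
  then have ne: "{L'. L' \<subseteq> L \<and> \<not> joined L'} \<noteq> {}" by (rule ex_in_conv[THEN iffD1, OF exI])
  have "{L'. L' \<subseteq> L \<and> \<not> joined L'} \<subseteq> Pow L" by (rule subsetI) simp
  then have "finite {L'. L' \<subseteq> L \<and> \<not> joined L'}"
    by (rule finite_subset) (simp add: finite_L)
  from finite_has_greatest[OF this ne, of card] obtain L' where
    "L' \<in> {L'. L' \<subseteq> L \<and> \<not> joined L'}" "\<forall>M\<in>{L'. L' \<subseteq> L \<and> \<not> joined L'}. card M \<le> card L'"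
    by (elim bexE)
  then have L': "L' \<subseteq> L" "\<not> joined L'"
    and max: "M \<subseteq> L \<Longrightarrow> \<not> joined M \<Longrightarrow> card M \<le> card L'" for M by simp_all
  let ?R = "flat_adj L'"
  show ?thesis
  proof (cases "L' = L")
    case True
    \<comment> \<open>The flat of a triangle misses the third vertex, so it is proper, and it
      belongs to \<open>L'\<close> because nothing is left out.\<close>
    have mode: "?R x y" if "tri x y z" for x y z
      using that True L_sub by (auto simp: tri_def flat_adj_def)
    show ?thesis
    proof (rule that[OF L', of x0 V])
      show "x0 \<in> V" using tri_adj(1)[OF t] adj_V by blast
      show "\<exists>x. ?R x0 x" using mode[OF t] by blast
      show "\<exists>z\<in>V. ?R\<^sup>*\<^sup>* x z" if "x \<in> V" for x using that by blast
    qed (use mode in auto)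
  next
    case False
    then obtain Z1 where Z1: "Z1 \<in> L" "Z1 \<notin> L'" using L' by blast
    have "card (insert Z1 L') = Suc (card L')"
      using Z1 L' finite_L by (simp add: finite_subset)
    then have J: "joined (insert Z1 L')" using max[of "insert Z1 L'"] Z1 L' by force
    have Z1V: "Z1 \<noteq> V"
    proof
      assume "Z1 = V"
      then have "flat_adj (insert Z1 L') = ?R" by (auto simp: flat_adj_def fun_eq_iff)
      then show False using J L' by (simp add: joined_def)
    qed
    \<comment> \<open>A component that \<open>Z1\<close> misses gains nothing from adding
      \<open>Z1\<close>, so it would be all of \<open>V\<close> without it.\<close>
    have meet: "\<exists>z\<in>Z1. ?R\<^sup>*\<^sup>* x z" if x: "x \<in> V" for x
    proof (rule ccontr)
      assume no: "\<not> ?thesis"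
      have reach: "?R\<^sup>*\<^sup>* x y" if "(flat_adj (insert Z1 L'))\<^sup>*\<^sup>* x y" for y
        using that
      proof (induction rule: rtranclp_induct)
        case (step y w)
        have "y \<notin> Z1" using no step.IH by blast
        then have "?R y w" using step.hyps(2) by (auto simp: flat_adj_def)
        then show ?case using step.IH by simp
      qed simp
      have all: "?R\<^sup>*\<^sup>* x y" if "y \<in> V" for y using reach J x that by (auto simp: joined_def)
      have "joined L'"
        unfolding joined_def
      proof (intro ballI)
        fix u v assume "u \<in> V" "v \<in> V"
        then show "?R\<^sup>*\<^sup>* u v" using rtranclp_trans[OF flat_adj_rtranclp_sym[OF all] all] by blast
      qed
      then show False using L' by simp
    qed
    obtain c where c: "c \<in> V" "c \<notin> Z1" using Z1V Z1 L_sub by blast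
    show ?thesis
    proof (rule that[OF L', of c Z1])
      obtain z where z: "z \<in> Z1" "?R\<^sup>*\<^sup>* c z" using meet[OF c(1)] by blast
      then have "c \<noteq> z" using c by blast
      then show "\<exists>x. ?R c x" using z(2) by (meson converse_rtranclpE)
      show "Z1 \<subseteq> V" using Z1 L_sub by blast
      show "(\<forall>x y z. tri x y z \<longrightarrow> ?R x y) \<or> (\<forall>u\<in>Z1. \<forall>v\<in>Z1. adj u v \<longrightarrow> tri u v c)"
        using Z1 c by (auto simp: tri_def)
    qed (use c meet in auto)
  qed
qed

end

text \<open>From here on the graph of the chosen subfamily enters through these properties only.
  Since \<open>r0\<close> has a neighbour, \<open>tri_out\<close> makes it adjacent to every vertex
  outside its component, and in particular to all other roots.\<close>

locale zero_sets_graph = zero_sets +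
  fixes R :: "'a \<Rightarrow> 'a \<Rightarrow> bool" and S :: "'a set" and r0 :: 'a
  assumes R_adj: "R x y \<Longrightarrow> adj x y" and R_sym: "R x y \<Longrightarrow> R y x"
    and outside: "x \<in> V \<Longrightarrow> \<exists>d\<in>V. \<not> R\<^sup>*\<^sup>* x d"
    and tri_out: "R x y \<Longrightarrow> z \<in> V \<Longrightarrow> \<not> R\<^sup>*\<^sup>* x z \<Longrightarrow> tri x y z"
    and tri_in: "R x a \<Longrightarrow> adj x y \<Longrightarrow> \<not> R x y \<Longrightarrow> tri x a y"
    and r0_V: "r0 \<in> V" and r0_R: "\<exists>x. R r0 x"
    and S_V: "S \<subseteq> V" and S_meets: "x \<in> V \<Longrightarrow> \<exists>z\<in>S. R\<^sup>*\<^sup>* x z"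
    and alternative: "(\<forall>x y z. tri x y z \<longrightarrow> R x y) \<or> (\<forall>u\<in>S. \<forall>v\<in>S. adj u v \<longrightarrow> tri u v r0)"
begin

section \<open>Roots, distances and the spanning tree\<close>

lemma R_star_sym: "R\<^sup>*\<^sup>* x y \<Longrightarrow> R\<^sup>*\<^sup>* y x"
  using R_sym by (metis sympD sympI symp_rtranclp)

lemma R_star_V: "R\<^sup>*\<^sup>* x y \<Longrightarrow> x \<in> V \<Longrightarrow> y \<in> V"
  by (induction rule: rtranclp_induct) (use R_adj adj_V in auto)

lemma relpowp_sym: "(R ^^ k) x y \<Longrightarrow> (R ^^ k) y x"
proof (induction k arbitrary: y)
  case (Suc k)
  then obtain z where "(R ^^ k) x z" "R z y" by auto
  then show ?case using Suc.IH R_sym relpowp_Suc_I2 by metis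
qed auto

text \<open>Apart from \<open>r0\<close>, roots are taken in \<open>S\<close>, so that under the
  second alternative an edge between two of them spans a triangle with \<open>r0\<close>. The
  predicate under \<open>SOME\<close> depends on the component of \<open>x\<close> only, hence so
  does the choice.\<close>

definition root :: "'a \<Rightarrow> 'a" where
  "root x = (if R\<^sup>*\<^sup>* r0 x then r0 else SOME z. z \<in> S \<and> R\<^sup>*\<^sup>* x z)"

definition steps :: "'a \<Rightarrow> 'a \<Rightarrow> nat" where
  "steps x y = (LEAST k. (R ^^ k) x y)"

definition depth :: "'a \<Rightarrow> nat" where
  "depth x = steps (root x) x"

lemma root_S: assumes "x \<in> V" "\<not> R\<^sup>*\<^sup>* r0 x" shows "root x \<in> S" "R\<^sup>*\<^sup>* x (root x)"
proof -
  have "\<exists>z. z \<in> S \<and> R\<^sup>*\<^sup>* x z" using S_meets[OF assms(1)] by blast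
  then have "root x \<in> S \<and> R\<^sup>*\<^sup>* x (root x)"
    using assms(2) someI_ex[of "\<lambda>z. z \<in> S \<and> R\<^sup>*\<^sup>* x z"] by (simp add: root_def)
  then show "root x \<in> S" "R\<^sup>*\<^sup>* x (root x)" by auto
qed

lemma root_star: assumes "x \<in> V" shows "R\<^sup>*\<^sup>* (root x) x"
proof (cases "R\<^sup>*\<^sup>* r0 x")
  case False
  then show ?thesis using root_S[OF assms] R_star_sym by blast
qed (simp add: root_def)

lemma root_V: "x \<in> V \<Longrightarrow> root x \<in> V"
  using root_star R_star_sym R_star_V by blast

lemma root_cong: assumes "R\<^sup>*\<^sup>* x y" shows "root x = root y"
proof -
  have "R\<^sup>*\<^sup>* r0 x = R\<^sup>*\<^sup>* r0 y" "R\<^sup>*\<^sup>* x z = R\<^sup>*\<^sup>* y z" for z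
    using assms R_star_sym by (meson rtranclp_trans)+
  then show ?thesis by (simp add: root_def)
qed

lemma root_eq_iff: "x \<in> V \<Longrightarrow> y \<in> V \<Longrightarrow> root x = root y \<longleftrightarrow> R\<^sup>*\<^sup>* x y"
  using root_star root_cong R_star_sym by (metis rtranclp_trans)

lemma root_r0 [simp]: "root r0 = r0"
  by (simp add: root_def)

lemma steps_relpowp: "R\<^sup>*\<^sup>* x y \<Longrightarrow> (R ^^ steps x y) x y"
  unfolding steps_def by (rule LeastI_ex) (simp add: rtranclp_power)

lemma steps_le: "(R ^^ k) x y \<Longrightarrow> steps x y \<le> k"
  unfolding steps_def by (rule Least_le)

lemma steps_sym: "steps x y = steps y x"
  unfolding steps_def using relpowp_sym by (metis (no_types, lifting))

lemma depth_0: "x \<in> V \<Longrightarrow> depth x = 0 \<longleftrightarrow> root x = x"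
proof
  assume x: "x \<in> V" and "depth x = 0"
  then show "root x = x" using steps_relpowp[OF root_star[OF x]] by (simp add: depth_def)
next
  assume "root x = x"
  then show "depth x = 0" using steps_le[of 0 "root x" x] by (simp add: depth_def)
qed

lemma parent_exists:
  assumes "x \<in> V" "0 < depth x"
  shows "\<exists>p. R p x \<and> depth p = depth x - 1 \<and> root p = root x"
proof -
  obtain k where k: "depth x = Suc k" using assms(2) gr0_conv_Suc by blast
  have "(R ^^ Suc k) (root x) x"
    using steps_relpowp[OF root_star[OF assms(1)]] k by (simp add: depth_def)
  then obtain p where p: "(R ^^ k) (root x) p" "R p x" by auto
  have rp: "root p = root x" using root_cong[of p x] p(2) by blast
  have "depth p \<le> k" using steps_le[OF p(1)] rp by (simp add: depth_def)
  moreover have "depth x \<le> Suc (depth p)"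
  proof -
    have "R\<^sup>*\<^sup>* (root x) p" using p(1) relpowp_imp_rtranclp by metis
    then have "(R ^^ depth p) (root x) p" using steps_relpowp rp by (simp add: depth_def)
    then have "(R ^^ Suc (depth p)) (root x) x" using p(2) by auto
    then show ?thesis using steps_le by (simp add: depth_def)
  qed
  ultimately show ?thesis using p(2) rp k by auto
qed

definition par :: "'a \<Rightarrow> 'a" where
  "par x = (SOME p. R p x \<and> depth p = depth x - 1 \<and> root p = root x)"

lemma par:
  assumes "x \<in> V" "0 < depth x"
  shows "R (par x) x" "depth (par x) = depth x - 1" "root (par x) = root x"
  using someI_ex[OF parent_exists[OF assms]] unfolding par_def by blast+

definition tree_par :: "'a \<Rightarrow> 'a" where
  "tree_par x = (if depth x = 0 then r0 else par x)"

text \<open>By \<open>tri_out\<close> some flat contains \<open>x\<close> and its neighbour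
  \<open>w\<close> but misses \<open>y\<close>; in particular it separates \<open>x\<close> from
  \<open>y\<close>.\<close>

lemma cross_adj:
  assumes V: "x \<in> V" "y \<in> V" and "root x \<noteq> root y" and "\<exists>w. R x w"
  shows "adj x y"
  using assms tri_out tri_adj(2) root_eq_iff by blast

lemma isolated_root: assumes "x \<in> V" "\<nexists>w. R x w" shows "root x = x"
  using R_star_sym[OF root_star[OF assms(1)]] assms(2) by (metis converse_rtranclpE)

lemma root_R: assumes x: "x \<in> V" "\<exists>w. R x w" shows "\<exists>w. R (root x) w"
proof (rule ccontr)
  assume "\<nexists>w. R (root x) w"
  then have "root x = x" using root_star[OF x(1)] by (metis converse_rtranclpE)
  then show False using x \<open>\<nexists>w. R (root x) w\<close> by simp
qed

lemma root_root: "x \<in> V \<Longrightarrow> root (root x) = root x"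
  using root_cong[OF root_star] .

text \<open>If a vertex has a neighbour, so does its root, which is then adjacent to all vertices
  outside the component. Isolated vertices are their own roots.\<close>

lemma root_adj: assumes "adj x y" "root x \<noteq> root y" shows "adj (root x) (root y)"
proof -
  have V: "x \<in> V" "y \<in> V" using assms adj_V by auto
  consider "\<exists>w. R x w" | "\<exists>w. R y w" | "\<nexists>w. R x w" "\<nexists>w. R y w" by blast
  then show ?thesis
  proof cases
    case 1
    then show ?thesis using cross_adj root_V root_root root_R V assms(2) by metis
  next
    case 2
    then have "adj (root y) (root x)" using cross_adj root_V root_root root_R V assms(2) by metis
    then show ?thesis by (rule adj_sym)
  next
    case 3
    then show ?thesis using isolated_root V assms(1) by metis
  qed
qed

definition local_triangles :: bool where
  "local_triangles \<longleftrightarrow> (\<forall>x y z. tri x y z \<longrightarrow> R x y)"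

definition tree_edges :: "'a set set" where
  "tree_edges = (\<lambda>x. {tree_par x, x}) ` (V - {r0})"

text \<open>The free edges become the 1-spheres.\<close>

definition free_edges :: "'a set set" where
  "free_edges = (if local_triangles then {{x, y} |x y. adj x y \<and> depth x = 0 \<and> depth y = 0} else {})"

definition killed_edges :: "'a set set" where
  "killed_edges = edge_faces - tree_edges - free_edges"

lemma tree_edge_adj: assumes "x \<in> V" "x \<noteq> r0" shows "adj (tree_par x) x"
proof (cases "depth x = 0")
  case True
  then have "root x = x" using depth_0 assms by blast
  then have "root r0 \<noteq> root x" using assms by simp
  then show ?thesis using cross_adj[OF r0_V assms(1) _ r0_R] True by (simp add: tree_par_def)
next
  case False
  then show ?thesis using par(1)[OF assms(1)] R_adj by (simp add: tree_par_def)
qed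

lemma tree_edgeI: "x \<in> V \<Longrightarrow> x \<noteq> r0 \<Longrightarrow> {tree_par x, x} \<in> tree_edges"
  by (simp add: tree_edges_def)

lemma tree_edges_faces: "tree_edges \<subseteq> edge_faces"
  using tree_edge_adj by (auto simp: tree_edges_def edge_faces_def)

lemma free_edges_faces: "free_edges \<subseteq> edge_faces"
  by (auto simp: free_edges_def edge_faces_def)

text \<open>The constant summand makes every edge between components precede every edge inside one.\<close>

definition pair_level :: "'a \<Rightarrow> 'a \<Rightarrow> nat" where
  "pair_level x y = (if R\<^sup>*\<^sup>* x y then Suc (\<Sum>v\<in>V. depth v) + steps x y else depth x + depth y)"

text \<open>An edge is an unordered pair; which listing is chosen does not matter, as
  \<open>pair_level\<close> is symmetric.\<close>

definition level :: "'a set \<Rightarrow> nat" where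
  "level e = (SOME n. \<exists>x y. e = {x, y} \<and> n = pair_level x y)"

section \<open>A triangle for each killed edge\<close>

lemma pair_level_sym: "pair_level x y = pair_level y x"
  using R_star_sym steps_sym by (auto simp: pair_level_def)

lemma level_pair: "level {x, y} = pair_level x y"
proof -
  have "\<exists>u v. {x, y} = {u, v} \<and> level {x, y} = pair_level u v"
    unfolding level_def by (rule someI_ex) blast
  then obtain u v where "{x, y} = {u, v}" "level {x, y} = pair_level u v" by blast
  then show ?thesis using pair_level_sym by (auto simp: doubleton_eq_iff)
qed

text \<open>The vertex \<open>c\<close> completes \<open>e\<close> to a triangle whose other sides
  are available earlier. The last clause serves the transport to the roots: either \<open>e\<close>
  joins two roots and is coned off from \<open>r0\<close>, or two of the three vertices share a root
  and the transported triangle degenerates.\<close>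

definition apex_ok :: "'a set \<Rightarrow> 'a \<Rightarrow> bool" where
  "apex_ok e c \<longleftrightarrow> (\<exists>a b. e = {a, b} \<and> a \<noteq> b \<and> c \<noteq> a \<and> c \<noteq> b \<and> c \<in> V \<and> adj a b \<and> adj a c \<and> adj b c \<and>
     {a, b, c} \<in> triangle_faces \<and>
     {a, c} \<in> tree_edges \<union> free_edges \<union> {e' \<in> killed_edges. level e' < level e} \<and>
     {b, c} \<in> tree_edges \<union> free_edges \<union> {e' \<in> killed_edges. level e' < level e} \<and>
     (if depth a = 0 \<and> depth b = 0 then c = r0 else root a = root b \<or> root c = root a \<or> root c = root b))"

lemma lower_edge:
  assumes "adj x y" "level {x, y} < n"
  shows "{x, y} \<in> tree_edges \<union> free_edges \<union> {e' \<in> killed_edges. level e' < n}"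
  using assms by (auto simp: killed_edges_def edge_faces_def)

text \<open>The parent of \<open>x\<close> is a neighbour in the same component, so it spans a
  triangle with \<open>x\<close> and \<open>y\<close>. Its edge to \<open>y\<close> still runs
  between components, at total depth smaller by 1, and its edge to \<open>x\<close> is in the
  tree.\<close>

lemma apex_cross:
  assumes xy: "adj x y" "\<not> R\<^sup>*\<^sup>* x y" and d: "0 < depth x"
  shows "\<exists>c. apex_ok {x, y} c"
proof -
  have V: "x \<in> V" "y \<in> V" using xy adj_V by auto
  note p = par[OF V(1) d]
  let ?p = "par x"
  have pV: "?p \<in> V" using p(1) R_adj adj_V by blast
  have neq: "root ?p \<noteq> root y" using p(3) root_eq_iff V xy(2) by simp
  have npy: "\<not> R\<^sup>*\<^sup>* ?p y" using neq root_eq_iff[OF pV V(2)] by simp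
  have t: "tri x ?p y" using tri_out[OF R_sym[OF p(1)] V(2) xy(2)] .
  have "x \<noteq> r0" using d depth_0[OF r0_V] by auto
  then have "{?p, x} \<in> tree_edges" using tree_edgeI[OF V(1)] d by (simp add: tree_par_def)
  moreover have "level {y, ?p} < level {x, y}"
    unfolding level_pair using npy R_star_sym xy(2) p(2) d by (auto simp: pair_level_def)
  then have "{y, ?p} \<in> tree_edges \<union> free_edges \<union> {e' \<in> killed_edges. level e' < level {x, y}}"
    using tri_adj(3)[OF t] adj_sym by (intro lower_edge) auto
  moreover have "{x, y, ?p} \<in> triangle_faces"
    using t unfolding triangle_faces_def by (auto simp: insert_commute)
  ultimately have "apex_ok {x, y} ?p"
    unfolding apex_ok_def using xy(1) tri_adj[OF t] adj_neq adj_sym pV p(3) d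
    by (intro exI[of _ x] exI[of _ y]) (auto simp: insert_commute)
  then show ?thesis by blast
qed

text \<open>An edge of the graph is coned off from a vertex of another component, all edges between
  components being lower. For any other edge the first vertex on a shortest path from
  \<open>x\<close> to \<open>y\<close> serves: it is nearer to both ends than they are to each
  other.\<close>

lemma apex_inside:
  assumes xy: "adj x y" "R\<^sup>*\<^sup>* x y"
  shows "\<exists>c. apex_ok {x, y} c"
proof -
  have V: "x \<in> V" "y \<in> V" using xy adj_V by auto
  have neq: "x \<noteq> y" using adj_neq xy by blast
  have root: "root x = root y" using root_cong xy by blast
  have nr: "\<not> (depth x = 0 \<and> depth y = 0)" using depth_0 V root neq by metis
  show ?thesis
  proof (cases "R x y")
    case True
    obtain d where d: "d \<in> V" "\<not> R\<^sup>*\<^sup>* x d" using outside[OF V(1)] by blast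
    have yd: "\<not> R\<^sup>*\<^sup>* y d" using d(2) xy(2) by (meson rtranclp_trans)
    have t: "tri x y d" using tri_out[OF True d] .
    \<comment> \<open>The constant in \<open>pair_level\<close> is larger than the depths of two
      distinct vertices together.\<close>
    have low: "level {u, d} < level {x, y}" if "u \<in> V" "\<not> R\<^sup>*\<^sup>* u d" for u
    proof -
      have "u \<noteq> d" using that by auto
      then have "depth u + depth d = (\<Sum>v\<in>{u, d}. depth v)" by simp
      also have "\<dots> \<le> (\<Sum>v\<in>V. depth v)" using that d finite_V by (intro sum_mono2) auto
      finally show ?thesis unfolding level_pair using that xy by (simp add: pair_level_def)
    qed
    have "apex_ok {x, y} d"
      unfolding apex_ok_def
      using xy(1) neq d(1) tri_adj[OF t] adj_neq t root nr lower_edge[OF tri_adj(2)[OF t] low[OF V(1) d(2)]]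
        lower_edge[OF tri_adj(3)[OF t] low[OF V(2) yd]]
      by (intro exI[of _ x] exI[of _ y]) (auto simp: triangle_faces_def)
    then show ?thesis by blast
  next
    case False
    obtain k where k: "steps x y = Suc k"
      using steps_relpowp[OF xy(2)] neq by (cases "steps x y") auto
    have "(R ^^ Suc k) x y" using steps_relpowp[OF xy(2)] k by simp
    then obtain a where a: "R x a" "(R ^^ k) a y" using relpowp_Suc_D2 by metis
    have "k \<noteq> 0" using a False by (cases k) auto
    have t: "tri x a y" using tri_in[OF a(1) xy(1) False] .
    have xa: "R\<^sup>*\<^sup>* x a" using a(1) by blast
    have ya: "R\<^sup>*\<^sup>* y a" using xa xy(2) R_star_sym by (meson rtranclp_trans)
    have "(R ^^ 1) x a" unfolding relpowp_1 by (rule a(1))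
    then have "steps x a \<le> 1" by (rule steps_le)
    then have 1: "level {x, a} < level {x, y}"
      unfolding level_pair using xa xy(2) k \<open>k \<noteq> 0\<close> by (simp add: pair_level_def)
    have "steps y a \<le> k" using steps_le[OF relpowp_sym[OF a(2)]] .
    then have 2: "level {y, a} < level {x, y}"
      unfolding level_pair using ya xy(2) k by (simp add: pair_level_def)
    have "{x, y, a} \<in> triangle_faces"
      using t unfolding triangle_faces_def by (auto simp: insert_commute)
    then have "apex_ok {x, y} a"
      unfolding apex_ok_def
      using xy(1) neq tri_adj[OF t] adj_neq adj_sym adj_V root nr lower_edge[OF tri_adj(1)[OF t] 1]
        lower_edge[OF adj_sym[OF tri_adj(3)[OF t]] 2]
      by (intro exI[of _ x] exI[of _ y]) (auto dest: adj_neq)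
    then show ?thesis by blast
  qed
qed

lemma root_in_S: "x \<in> V \<Longrightarrow> depth x = 0 \<Longrightarrow> x \<noteq> r0 \<Longrightarrow> x \<in> S"
  using root_S(1) depth_0 root_def by metis

lemma apex_exists: assumes "e \<in> killed_edges" shows "\<exists>c. apex_ok e c"
proof -
  obtain x y where e: "e = {x, y}" "adj x y" using assms by (auto simp: killed_edges_def edge_faces_def)
  have V: "x \<in> V" "y \<in> V" using e adj_V by auto
  show ?thesis
  proof (cases "R\<^sup>*\<^sup>* x y")
    case True
    then show ?thesis using apex_inside e by blast
  next
    case cross: False
    consider "0 < depth x" | "0 < depth y" | "depth x = 0" "depth y = 0" by blast
    then show ?thesis
    proof cases
      case 1
      then show ?thesis using apex_cross cross e by blast
    next
      case 2
      then show ?thesis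
        using apex_cross[of y x] cross e adj_sym R_star_sym by (metis insert_commute)
    next
      case 3
      have nt: "e \<notin> tree_edges" "e \<notin> free_edges" using assms by (auto simp: killed_edges_def)
      have tr: "{r0, u} \<in> tree_edges" if "u \<in> V" "u \<noteq> r0" "depth u = 0" for u
        using tree_edgeI[OF that(1,2)] that(3) by (simp add: tree_par_def)
      \<comment> \<open>All edges from \<open>r0\<close> to other roots are in the tree, so both
        ends differ from \<open>r0\<close> and lie in \<open>S\<close>. Since the edge is not free,
        the second alternative holds, and \<open>r0\<close> is the apex.\<close>
      have x0: "x \<noteq> r0" and y0: "y \<noteq> r0"
        using nt(1) tr[of x] tr[of y] V 3 e adj_neq by (auto simp: insert_commute)
      have "\<not> local_triangles"
      proof
        assume local_triangles
        then have "e \<in> free_edges" unfolding free_edges_def using 3 e by auto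
        then show False using nt(2) by simp
      qed
      then have "\<forall>u\<in>S. \<forall>v\<in>S. adj u v \<longrightarrow> tri u v r0" using alternative by (auto simp: local_triangles_def)
      then have t: "tri x y r0" using root_in_S V 3 x0 y0 e by blast
      have "apex_ok e r0"
        unfolding apex_ok_def
        using e tri_adj[OF t] adj_neq r0_V t tr[of x] tr[of y] V 3 x0 y0
        by (intro exI[of _ x] exI[of _ y]) (auto simp: triangle_faces_def insert_commute)
      then show ?thesis by blast
    qed
  qed
qed

end

context zero_sets_graph
begin

definition apex :: "'a set \<Rightarrow> 'a" where
  "apex e = (SOME c. apex_ok e c)"

lemma apex: "e \<in> killed_edges \<Longrightarrow> apex_ok e (apex e)"
  unfolding apex_def using apex_exists by (rule someI_ex)

text \<open>The complex before any 2-sphere: all edges are present, but of the triangles only those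
  spent on killed edges.\<close>

definition core :: "'a set set" where
  "core = vertex_faces \<union> edge_faces \<union> (\<lambda>e. insert (apex e) e) ` killed_edges"

lemma edge_faces_split: "edge_faces = tree_edges \<union> free_edges \<union> killed_edges"
  using tree_edges_faces free_edges_faces by (auto simp: killed_edges_def)

lemma finite_edge_faces: "finite edge_faces"
proof -
  have "edge_faces \<subseteq> Pow V" using adj_V by (auto simp: edge_faces_def)
  then show ?thesis using finite_V finite_subset by blast
qed

lemma edge_in_core: "adj x y \<Longrightarrow> {x, y} \<in> core"
  by (auto simp: core_def edge_faces_def)

lemma vertex_in_core: "x \<in> V \<Longrightarrow> {x} \<in> core"
  by (auto simp: core_def vertex_faces_def)

lemma built_core: "built core"
proof -
  \<comment> \<open>The shift puts \<open>r0\<close> below the other roots, which also have depth 0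
    but have \<open>r0\<close> as parent.\<close>
  let ?D = "\<lambda>x. if x = r0 then 0 else Suc (depth x)"
  let ?K0 = "vertex_faces \<union> tree_edges"
  have "built ({{}} \<union> (\<lambda>x. {x}) ` V \<union> (\<lambda>x. {tree_par x, x}) ` (V - {r0}))"
  proof (rule built_tree[where D = ?D, OF finite_V r0_V])
    fix x assume x: "x \<in> V" "x \<noteq> r0"
    then have "tree_par x \<in> V" using tree_edge_adj adj_V by blast
    moreover have "?D (tree_par x) < ?D x"
      using par(2)[OF x(1)] x(2) by (auto simp: tree_par_def)
    ultimately show "tree_par x \<in> V \<and> ?D (tree_par x) < ?D x" by blast
  qed
  then have 1: "built ?K0" by (simp add: vertex_faces_def tree_edges_def)
  have 2: "built (?K0 \<union> free_edges)"
  proof (rule built_add_edges[OF _ 1])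
    show "finite free_edges" using finite_subset[OF free_edges_faces finite_edge_faces] .
    fix e assume "e \<in> free_edges"
    then obtain u v where "e = {u, v}" "adj u v" using free_edges_faces by (auto simp: edge_faces_def)
    then show "\<exists>u v. e = {u, v} \<and> u \<noteq> v \<and> {u} \<in> ?K0 \<and> {v} \<in> ?K0"
      using adj_V adj_neq unfolding vertex_faces_def by blast
  qed
  have "built (?K0 \<union> free_edges \<union> killed_edges \<union> (\<lambda>e. insert (apex e) e) ` killed_edges)"
  proof (rule built_add_expansions[OF _ 2, where \<mu> = level])
    show "finite killed_edges" using finite_edge_faces by (simp add: killed_edges_def)
    fix e assume e: "e \<in> killed_edges"
    obtain a b where ab: "e = {a, b}" "a \<noteq> b" "apex e \<noteq> a" "apex e \<noteq> b"
      "{a, apex e} \<in> tree_edges \<union> free_edges \<union> {e' \<in> killed_edges. level e' < level e}"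
      "{b, apex e} \<in> tree_edges \<union> free_edges \<union> {e' \<in> killed_edges. level e' < level e}"
      using apex[OF e] unfolding apex_ok_def by blast
    have "e \<notin> vertex_faces" using ab(1,2) by (auto simp: vertex_faces_def)
    then have "e \<notin> ?K0 \<union> free_edges" using e by (auto simp: killed_edges_def)
    then show "\<exists>a b. e = {a, b} \<and> a \<noteq> b \<and> apex e \<noteq> a \<and> apex e \<noteq> b \<and> e \<notin> ?K0 \<union> free_edges \<and>
        {a, apex e} \<in> ?K0 \<union> free_edges \<union> {e' \<in> killed_edges. level e' < level e} \<and>
        {b, apex e} \<in> ?K0 \<union> free_edges \<union> {e' \<in> killed_edges. level e' < level e}"
      using ab by (intro exI[of _ a] exI[of _ b]) blast
  qed
  then show ?thesis unfolding core_def edge_faces_split by (simp add: Un_assoc)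
qed

section \<open>Transport along the tree to the roots\<close>

primrec climb :: "nat \<Rightarrow> 'a \<Rightarrow> 'a list" where
  "climb 0 x = [x]"
| "climb (Suc k) x = climb k (par x) @ [x]"

text \<open>The walk starts at the root of the component and not at \<open>r0\<close>: an edge is
  compared with an edge between roots, which may be a 1-sphere and need not contract.\<close>

definition trunk :: "'a \<Rightarrow> 'a list" where
  "trunk x = climb (depth x) x"

lemma trunk_snoc: "x \<in> V \<Longrightarrow> 0 < depth x \<Longrightarrow> trunk x = trunk (par x) @ [x]"
  using par(2)[of x] by (cases "depth x") (auto simp: trunk_def)

lemma trunk_root: "x \<in> V \<Longrightarrow> depth x = 0 \<Longrightarrow> trunk x = [x]"
  by (simp add: trunk_def)

lemma trunk_walk: "x \<in> V \<Longrightarrow> is_walk core (trunk x) \<and> last (trunk x) = x \<and> hd (trunk x) = root x"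
proof (induction "depth x" arbitrary: x)
  case 0
  then have "trunk x = [x]" "root x = x" using depth_0[of x] trunk_root[of x] by simp_all
  then show ?case using vertex_in_core 0 by simp
next
  case (Suc k)
  have d: "0 < depth x" using Suc.hyps(2) by simp
  note p = par[OF Suc.prems d]
  have pV: "par x \<in> V" using p(1) R_adj adj_V by blast
  have IH: "is_walk core (trunk (par x))" "last (trunk (par x)) = par x" "hd (trunk (par x)) = root (par x)"
    using Suc.hyps(1)[of "par x"] p(2) Suc.hyps(2) pV by auto
  have ne: "trunk (par x) \<noteq> []" using IH(1) by auto
  have "is_walk core (trunk x)"
    unfolding trunk_snoc[OF Suc.prems d]
    by (rule is_walk_snoc) (use IH edge_in_core[OF R_adj[OF p(1)]] vertex_in_core Suc.prems in auto)
  then show ?case using trunk_snoc[OF Suc.prems d] IH p(3) ne by simp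
qed

sublocale walk_labelling core V root trunk
  using trunk_walk by unfold_locales blast+

lemma edge_good_roots:
  assumes "x \<in> V" "y \<in> V" "depth x = 0" "depth y = 0" shows "edge_good x y"
proof -
  have "root x = x" "root y = y" using assms depth_0 by blast+
  then show ?thesis by (simp add: edge_good_def trunk_root assms walk_refl)
qed

lemma edge_good_tree_edge: assumes "x \<in> V" "x \<noteq> r0" shows "edge_good (tree_par x) x"
proof (cases "depth x = 0")
  case True
  have "depth r0 = 0" using depth_0[OF r0_V] by simp
  then show ?thesis using edge_good_roots[OF r0_V assms(1)] True by (simp add: tree_par_def)
next
  case False
  then have d: "0 < depth x" by simp
  note p = par[OF assms(1) d]
  have "par x \<in> V" using p(1) R_adj adj_V by blast
  then have "edge_good (par x) x"
    using edge_good_tree[OF _ assms(1) trunk_snoc[OF assms(1) d]] edge_in_core[OF R_adj[OF p(1)]] p(3) by simp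
  then show ?thesis using d by (simp add: tree_par_def)
qed

lemma edge_good_initial:
  assumes "{x, y} \<in> tree_edges \<union> free_edges" shows "edge_good x y"
  using assms
proof
  assume "{x, y} \<in> tree_edges"
  then obtain u where u: "u \<in> V" "u \<noteq> r0" "{x, y} = {tree_par u, u}"
    unfolding tree_edges_def by blast
  have "x = tree_par u \<and> y = u \<or> x = u \<and> y = tree_par u" using u(3) by (simp add: doubleton_eq_iff)
  then show ?thesis
    using edge_good_tree_edge[OF u(1,2)] edge_good_sym[OF edge_good_tree_edge[OF u(1,2)]] by auto
next
  assume "{x, y} \<in> free_edges"
  then obtain u v where uv: "{x, y} = {u, v}" "adj u v" "depth u = 0" "depth v = 0"
    by (auto simp: free_edges_def split: if_splits)
  have "x = u \<and> y = v \<or> x = v \<and> y = u" using uv(1) by (simp add: doubleton_eq_iff)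
  then show ?thesis using edge_good_roots adj_V[OF uv(2)] uv(3,4) by auto
qed

text \<open>Two of the three roots agree. If they are neighbours in the walk, it stutters; if they
  are its ends, it goes out and back along an edge supplied by \<open>root_adj\<close>.\<close>

lemma root_shortcut:
  assumes "adj a c" "root a = root b \<or> root c = root a \<or> root c = root b"
  shows "walk_equiv core [root a, root c, root b] [root a, root b]"
proof -
  consider "root c = root a" | "root c = root b" | "root c \<noteq> root a" "root a = root b"
    using assms(2) by blast
  then show ?thesis
  proof cases
    case 1
    then show ?thesis using walk_stay[of core "[]" "root a" "[root b]"] by simp
  next
    case 2
    then show ?thesis using walk_stay[of core "[root a]" "root b" "[]"] by simp
  next
    case 3
    then have "{root a, root c} \<in> core" using root_adj[OF assms(1)] edge_in_core by metis
    then show ?thesis using walk_face'[of "root a" "root c" "root b" core] 3 by (simp add: insert_commute)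
  qed
qed

text \<open>Induction in the order of the expansions: the apex triangle makes a killed edge good
  once its lower sides are. Between two roots the trunks are single vertices, and the edge is good
  outright.\<close>

lemma edge_good_all: "adj x y \<Longrightarrow> edge_good x y"
proof (induction "level {x, y}" arbitrary: x y rule: less_induct)
  case less
  have "{x, y} \<in> edge_faces" using less.prems by (auto simp: edge_faces_def)
  then consider "{x, y} \<in> tree_edges \<union> free_edges" | "{x, y} \<in> killed_edges"
    unfolding edge_faces_split by blast
  then show ?case
  proof cases
    case 1
    then show ?thesis by (rule edge_good_initial)
  next
    case 2
    let ?e = "{x, y}" and ?c = "apex {x, y}"
    obtain a b where ab: "?e = {a, b}" "?c \<in> V" "adj a b" "adj a ?c" "adj b ?c"
      "{a, ?c} \<in> tree_edges \<union> free_edges \<union> {e' \<in> killed_edges. level e' < level ?e}"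
      "{b, ?c} \<in> tree_edges \<union> free_edges \<union> {e' \<in> killed_edges. level e' < level ?e}"
      and r: "if depth a = 0 \<and> depth b = 0 then ?c = r0
        else root a = root b \<or> root ?c = root a \<or> root ?c = root b"
      using apex[OF 2] unfolding apex_ok_def by blast
    have V: "a \<in> V" "b \<in> V" using ab(3) adj_V by auto
    have "edge_good a b"
    proof (cases "depth a = 0 \<and> depth b = 0")
      case True
      then show ?thesis using edge_good_roots V by blast
    next
      case False
      have lower: "edge_good u ?c"
        if "adj u ?c" "{u, ?c} \<in> tree_edges \<union> free_edges \<union> {e' \<in> killed_edges. level e' < level ?e}" for u
        using that edge_good_initial less.hyps by blast
      have "{a, ?c, b} \<in> core"
      proof -
        have "insert ?c ?e \<in> core" using 2 by (auto simp: core_def)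
        then show ?thesis unfolding ab(1) by (simp add: insert_commute)
      qed
      then show ?thesis
        using edge_good_face[OF V(1) ab(2) V(2) _ lower[OF ab(4,6)] edge_good_sym[OF lower[OF ab(5,7)]]]
          root_shortcut[OF ab(4)] r False by auto
    qed
    moreover have "x = a \<and> y = b \<or> x = b \<and> y = a" using ab(1) by (simp add: doubleton_eq_iff)
    ultimately show ?thesis using edge_good_sym[of a b] by auto
  qed
qed

text \<open>Without \<open>local_triangles\<close> no edge is free, so an edge between two roots
  other than \<open>r0\<close> is killed, with apex \<open>r0\<close>. Its triangle lies in
  \<open>core\<close> and provides the detour.\<close>

lemma root_detour:
  assumes A: "\<not> local_triangles" and uv: "u \<in> V" "v \<in> V" "depth u = 0" "depth v = 0" "u = v \<or> adj u v"
  shows "walk_equiv core [u, v] [u, r0, v]"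
proof -
  have tr: "{r0, w} \<in> core" if "w \<in> V" "depth w = 0" for w
    using tree_edge_adj[OF that(1)] that edge_in_core vertex_in_core by (cases "w = r0") (auto simp: tree_par_def)
  consider "u = r0" | "v = r0" | "u = v" "u \<noteq> r0" | "adj u v" "u \<noteq> r0" "v \<noteq> r0" using uv(5) by blast
  then show ?thesis
  proof cases
    case 1
    then show ?thesis using walk_sym[OF walk_stay[of core "[]" r0 "[v]"]] by simp
  next
    case 2
    then show ?thesis using walk_sym[OF walk_stay[of core "[u]" r0 "[]"]] by simp
  next
    case 3
    have "{u, r0, u} \<in> core" using tr[OF uv(1,3)] by (simp add: insert_commute)
    then show ?thesis unfolding \<open>u = v\<close>[symmetric] by (rule walk_sym[OF walk_face'])
  next
    case 4
    \<comment> \<open>A tree edge between two vertices of depth 0 has \<open>r0\<close> as an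
      end.\<close>
    have "{u, v} \<notin> tree_edges"
    proof
      assume "{u, v} \<in> tree_edges"
      then obtain w where w: "w \<in> V" "w \<noteq> r0" "{u, v} = {tree_par w, w}"
        unfolding tree_edges_def by blast
      have "w = u \<or> w = v" "tree_par w = u \<or> tree_par w = v"
        using w(3) unfolding doubleton_eq_iff by (elim disjE; simp)+
      then have "depth w = 0" using uv(3,4) by blast
      then have "tree_par w = r0" by (simp add: tree_par_def)
      then show False using \<open>tree_par w = u \<or> tree_par w = v\<close> 4 by simp
    qed
    moreover have "{u, v} \<in> edge_faces" using 4 by (auto simp: edge_faces_def)
    ultimately have k: "{u, v} \<in> killed_edges" using A by (simp add: killed_edges_def free_edges_def)
    obtain a b where "{u, v} = {a, b}" "if depth a = 0 \<and> depth b = 0 then apex {u, v} = r0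
        else root a = root b \<or> root (apex {u, v}) = root a \<or> root (apex {u, v}) = root b"
      using apex[OF k] unfolding apex_ok_def by blast
    moreover from this(1) have "depth a = 0 \<and> depth b = 0"
      using uv(3,4) unfolding doubleton_eq_iff by (elim disjE conjE) simp_all
    ultimately have "apex {u, v} = r0" by simp
    moreover have "insert (apex {u, v}) {u, v} \<in> core" unfolding core_def using k by (rule UnI2[OF imageI])
    ultimately have "insert r0 {u, v} \<in> core" by simp
    then have "{u, r0, v} \<in> core" by (simp add: insert_commute)
    then show ?thesis by (rule walk_sym[OF walk_face'])
  qed
qed

text \<open>If triangles are local, \<open>x\<close> and \<open>y\<close> share a root. Otherwise
  both root edges are rerouted through \<open>r0\<close>, and the excursion from \<open>r0\<close>
  to the middle root is a backtrack.\<close>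

lemma triangle_root_shortcut:
  assumes t: "tri x y z"
  shows "walk_equiv core [root x, root y, root z] [root x, root z]"
proof (cases local_triangles)
  case True
  then have "R x y" using t by (auto simp: local_triangles_def)
  then have "root x = root y" by (intro root_cong) blast
  then show ?thesis using root_shortcut[OF tri_adj(1)[OF t]] by simp
next
  case False
  have V: "x \<in> V" "y \<in> V" "z \<in> V" using tri_adj[OF t] adj_V by auto
  have detour: "walk_equiv core [root a, root b] [root a, r0, root b]" if "adj a b" for a b
  proof (rule root_detour[OF False])
    have ab: "a \<in> V" "b \<in> V" using that adj_V by auto
    then show "root a \<in> V" "root b \<in> V" by (simp_all add: root_V)
    then show "depth (root a) = 0" "depth (root b) = 0" using depth_0 root_root ab by simp_all
    show "root a = root b \<or> adj (root a) (root b)" using root_adj[OF that] by blast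
  qed
  let ?x = "root x" and ?y = "root y" and ?z = "root z"
  have 1: "walk_equiv core ([?x, ?y] @ [?z]) ([?x, r0, ?y] @ [?z])"
    using walk_equiv_context[OF detour[OF tri_adj(1)[OF t]], of "[]" "[?z]"] by simp
  have 2: "walk_equiv core ([?x, r0] @ [?y, ?z]) ([?x, r0] @ [?y, r0, ?z])"
    using walk_equiv_context[OF detour[OF tri_adj(3)[OF t]], of "[?x, r0]" "[]"] by simp
  have y: "{r0, ?y} \<in> core"
  proof (cases "?y = r0")
    case True
    then show ?thesis using vertex_in_core r0_V by simp
  next
    case False
    have "depth ?y = 0" using depth_0 root_root V root_V by simp
    then show ?thesis
      using tree_edge_adj[OF root_V[OF V(2)] False] edge_in_core by (simp add: tree_par_def)
  qed
  have 3: "walk_equiv core ([?x] @ [r0, ?y, r0] @ [?z]) ([?x] @ [r0] @ [?z])"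
    by (rule walk_equiv_context[OF walk_back[OF y]])
  have "walk_equiv core [?x, ?y, ?z] [?x, r0, ?z]"
    using walk_trans[OF walk_trans[OF 1[simplified] 2[simplified]] 3[simplified]] .
  then show ?thesis using walk_trans walk_sym[OF detour[OF tri_adj(2)[OF t]]] by blast
qed

text \<open>All edges are good, so \<open>triangle_null\<close> contracts the boundary of every
  triangle within \<open>core\<close>. The triangles of \<open>core\<close> are faces by
  \<open>apex_ok\<close>, hence the union is the whole complex.\<close>

theorem built_faces: "built (vertex_faces \<union> edge_faces \<union> triangle_faces)"
proof -
  have "built (core \<union> triangle_faces)"
  proof (rule built_add_triangles[OF _ built_core])
    have "triangle_faces \<subseteq> Pow V" using tri_adj adj_V by (fastforce simp: triangle_faces_def)
    then show "finite triangle_faces" using finite_V finite_subset by blast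
    fix t assume "t \<in> triangle_faces"
    then obtain x y z where t: "t = {x, y, z}" "tri x y z" by (auto simp: triangle_faces_def)
    note adj = tri_adj[OF t(2)]
    have V: "x \<in> V" "y \<in> V" "z \<in> V" using adj adj_V by auto
    have "walk_equiv core [x, y, z, x] [x]"
      using triangle_null[OF V edge_good_all edge_good_all edge_good_all edge_in_core
          triangle_root_shortcut[OF t(2)]] adj by blast
    then show "\<exists>a b c. t = {a, b, c} \<and> a \<noteq> b \<and> b \<noteq> c \<and> a \<noteq> c \<and> {a, b} \<in> core \<and> {b, c} \<in> core \<and>
        {a, c} \<in> core \<and> walk_equiv core [a, b, c, a] [a]"
      using t(1) adj adj_neq edge_in_core by blast
  qed
  moreover have "(\<lambda>e. insert (apex e) e) ` killed_edges \<subseteq> triangle_faces"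
  proof (rule image_subsetI)
    fix e assume "e \<in> killed_edges"
    from apex[OF this] obtain a b where "e = {a, b}" "{a, b, apex e} \<in> triangle_faces"
      unfolding apex_ok_def by blast
    then show "insert (apex e) e \<in> triangle_faces" by (simp add: insert_commute)
  qed
  then have "core \<union> triangle_faces = vertex_faces \<union> edge_faces \<union> triangle_faces"
    by (auto simp: core_def)
  ultimately show ?thesis by simp
qed

end

context zero_sets
begin

text \<open>The triangle provides two distinct vertices, so that the empty subfamily leaves the
  graph disconnected, and a root with a neighbour in case no flat is left over.\<close>

theorem built_complex:
  assumes "tri x0 y0 z0" shows "built (vertex_faces \<union> edge_faces \<union> triangle_faces)"
proof (rule obtain_subfamily[OF assms])
  fix L' S r0
  assume L': "L' \<subseteq> L" "\<not> joined L'" and r0: "r0 \<in> V" "\<exists>x. flat_adj L' r0 x"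
    and S: "S \<subseteq> V" "\<And>x. x \<in> V \<Longrightarrow> \<exists>z\<in>S. (flat_adj L')\<^sup>*\<^sup>* x z"
      "(\<forall>x y z. tri x y z \<longrightarrow> flat_adj L' x y) \<or> (\<forall>u\<in>S. \<forall>v\<in>S. adj u v \<longrightarrow> tri u v r0)"
  have out: "\<exists>d\<in>V. \<not> (flat_adj L')\<^sup>*\<^sup>* x d" if x: "x \<in> V" for x
  proof (rule ccontr)
    assume "\<not> ?thesis"
    then have all: "(flat_adj L')\<^sup>*\<^sup>* x d" if "d \<in> V" for d using that by blast
    have "joined L'"
      unfolding joined_def
    proof (intro ballI)
      fix u v assume "u \<in> V" "v \<in> V"
      then show "(flat_adj L')\<^sup>*\<^sup>* u v" using rtranclp_trans[OF flat_adj_rtranclp_sym[OF all] all] by blast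
    qed
    then show False using L' by simp
  qed
  interpret zero_sets_graph V L "flat_adj L'" S r0
  proof
    show "flat_adj L' x y \<Longrightarrow> adj x y" for x y by (rule flat_adj_imp_adj)
    show "flat_adj L' x y \<Longrightarrow> flat_adj L' y x" for x y by (rule flat_adj_sym)
    show "flat_adj L' x a \<Longrightarrow> adj x y \<Longrightarrow> \<not> flat_adj L' x y \<Longrightarrow> tri x a y" for x a y
      by (rule tri_of_flat_adj_step[OF L'(1)]) (simp_all add: adj_V)
    show "flat_adj L' x y \<Longrightarrow> z \<in> V \<Longrightarrow> \<not> (flat_adj L')\<^sup>*\<^sup>* x z \<Longrightarrow> tri x y z" for x y z
      by (rule tri_of_flat_adj[OF L'(1)])
  qed (fact out r0 S)+
  show ?thesis by (rule built_faces)
qed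

end

section \<open>Boolean representable complexes\<close>

definition representable :: "nat \<Rightarrow> (nat \<Rightarrow> 'a \<Rightarrow> bool) \<Rightarrow> 'a set \<Rightarrow> bool" where
  "representable m M X \<longleftrightarrow> (\<exists>R\<subseteq>{..<m}. congruent_lower_unitriangular M R X)"

text \<open>Distinctness of the chosen rows and columns is automatic.\<close>

lemma lower_unitriangular_representable:
  assumes "lower_unitriangular n (\<lambda>i j. M (r i) (c j))" and "\<And>i. i < n \<Longrightarrow> r i < m"
  shows "representable m M (c ` {..<n})"
proof -
  have d: "M (r i) (c i)" if "i < n" for i
    using assms(1) that by (auto simp: lower_unitriangular_def)
  have u: "\<not> M (r i) (c j)" if "i < j" "j < n" for i j
    using assms(1) that by (auto simp: lower_unitriangular_def)
  have "r i \<noteq> r j \<and> c i \<noteq> c j" if "i < j" "j < n" for i j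
  proof -
    have "M (r i) (c i)" "M (r j) (c j)" "\<not> M (r i) (c j)"
      using d[of i] d[of j] u[OF that] that by simp_all
    then show ?thesis by metis
  qed
  then have "inj_on r {..<n}" "inj_on c {..<n}"
    by (intro linorder_inj_onI'; simp)+
  then have "bij_betw r {..<n} (r ` {..<n})" "bij_betw c {..<n} (c ` {..<n})"
    by (simp_all add: inj_on_imp_bij_betw)
  then have "congruent_lower_unitriangular M (r ` {..<n}) (c ` {..<n})"
    unfolding congruent_lower_unitriangular_def using assms(1) by blast
  moreover have "r ` {..<n} \<subseteq> {..<m}" using assms(2) by auto
  ultimately show ?thesis unfolding representable_def by blast
qed

lemma representableE:
  assumes "representable m M X"
  obtains r c where "X = c ` {..<card X}" "\<And>i. i < card X \<Longrightarrow> r i < m"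
    "\<And>i. i < card X \<Longrightarrow> M (r i) (c i)" "\<And>i j. i < j \<Longrightarrow> j < card X \<Longrightarrow> \<not> M (r i) (c j)"
proof -
  obtain R n r c where R: "R \<subseteq> {..<m}" and b: "bij_betw r {..<n} R" "bij_betw c {..<n} X"
    and l: "lower_unitriangular n (\<lambda>i j. M (r i) (c j))"
    using assms unfolding representable_def congruent_lower_unitriangular_def by blast
  have n: "n = card X" using bij_betw_same_card[OF b(2)] by simp
  show ?thesis
  proof (rule that)
    show "X = c ` {..<card X}" using b(2) n by (simp add: bij_betw_def)
    show "r i < m" if "i < card X" for i
      using bij_betwE[OF b(1)] R that n by blast
    show "M (r i) (c i)" if "i < card X" for i
      using l that n by (simp add: lower_unitriangular_def)
    show "\<not> M (r i) (c j)" if "i < j" "j < card X" for i j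
      using l that n by (simp add: lower_unitriangular_def)
  qed
qed

lemma representable_pair:
  assumes "i < m" "j < m" "M i x" "\<not> M i y" "M j y"
  shows "representable m M {x, y}"
proof -
  let ?r = "\<lambda>k. [i, j] ! k" and ?c = "\<lambda>k. [x, y] ! k"
  have "lower_unitriangular 2 (\<lambda>k l. M (?r k) (?c l))"
    using assms by (auto simp: lower_unitriangular_def less_2_cases_iff nth_Cons')
  then have "representable m M (?c ` {..<2})"
    by (rule lower_unitriangular_representable) (use assms in \<open>auto simp: less_2_cases_iff\<close>)
  moreover have "?c ` {..<2} = {x, y}" by (auto simp: numeral_2_eq_2 lessThan_Suc)
  ultimately show ?thesis by simp
qed

text \<open>With columns ordered \<open>z\<close>, \<open>x\<close>, \<open>y\<close>, row
  \<open>k\<close> is zero beyond the diagonal; what remains is the 2 by 2 case for \<open>x\<close>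
  and \<open>y\<close>.\<close>

lemma representable_triple:
  assumes "i < m" "j < m" "k < m" "M k z" "\<not> M k x" "\<not> M k y" "M i x" "\<not> M i y" "M j y"
  shows "representable m M {x, y, z}"
proof -
  let ?r = "\<lambda>l. [k, i, j] ! l" and ?c = "\<lambda>l. [z, x, y] ! l"
  have less3: "l < 3 \<longleftrightarrow> l = 0 \<or> l = 1 \<or> l = 2" for l :: nat by auto
  have "lower_unitriangular 3 (\<lambda>k l. M (?r k) (?c l))"
    unfolding lower_unitriangular_def
  proof (intro conjI allI impI)
    show "M (?r l) (?c l)" if "l < 3" for l
      using that assms unfolding less3 by auto
    show "\<not> M (?r l) (?c l')" if "l < l' \<and> l' < 3" for l l'
    proof -
      have "l = 0 \<and> l' = 1 \<or> l = 0 \<and> l' = 2 \<or> l = 1 \<and> l' = 2" using that by auto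
      then show ?thesis using assms by auto
    qed
  qed
  then have "representable m M (?c ` {..<3})"
  proof (rule lower_unitriangular_representable)
    show "?r l < m" if "l < 3" for l
      using that assms unfolding less3 by auto
  qed
  moreover have "?c ` {..<3} = {x, y, z}" by (auto simp: numeral_3_eq_3 lessThan_Suc)
  ultimately show ?thesis by simp
qed

definition row_zeros :: "'a set \<Rightarrow> nat \<Rightarrow> (nat \<Rightarrow> 'a \<Rightarrow> bool) \<Rightarrow> 'a set set" where
  "row_zeros V m M = (\<lambda>i. {v \<in> V. \<not> M i v}) ` {..<m}"

lemma zero_sets_row_zeros: "finite V \<Longrightarrow> zero_sets V (row_zeros V m M)"
  by unfold_locales (auto simp: row_zeros_def)

text \<open>The first row of a lower unitriangular matrix vanishes on all later columns: it
  separates two columns, and of three its zero set contains the last two and misses the first.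
  Conversely, the last diagonal entry comes from representability of singletons.\<close>

lemma representable_small_faces:
  assumes fin: "finite V" and single: "\<And>v. v \<in> V \<Longrightarrow> representable m M {v}"
    and empty: "representable m M {}"
  shows "{X. X \<subseteq> V \<and> card X \<le> 3 \<and> representable m M X} =
    zero_sets.vertex_faces V \<union> zero_sets.edge_faces V (row_zeros V m M)
      \<union> zero_sets.triangle_faces V (row_zeros V m M)"
proof -
  interpret zero_sets V "row_zeros V m M" by (rule zero_sets_row_zeros[OF fin])
  have row: "\<exists>j<m. M j v" if v: "v \<in> V" for v
  proof -
    obtain r c where "{v} = c ` {..<card {v}}" "\<And>i. i < card {v} \<Longrightarrow> r i < m"
      "\<And>i. i < card {v} \<Longrightarrow> M (r i) (c i)"
      by (rule representableE[OF single[OF v]]) blast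
    from this(1) this(2,3)[of 0] have "{v} = {c 0}" "r 0 < m" "M (r 0) (c 0)"
      by (simp_all add: lessThan_Suc)
    then show ?thesis by auto
  qed
  have adj_iff: "adj x y \<longleftrightarrow> x \<in> V \<and> y \<in> V \<and> (\<exists>i<m. M i x \<noteq> M i y)" for x y
    unfolding adj_def unfolding row_zeros_def by auto
  have tri_iff: "tri x y z \<longleftrightarrow> adj x y \<and> z \<in> V \<and> (\<exists>i<m. M i z \<and> \<not> M i x \<and> \<not> M i y)" for x y z
    unfolding tri_def adj_iff unfolding row_zeros_def by auto
  have sym3: "{y, x, z} = {x, y, z}" for x y z :: 'a by (rule insert_commute)
  have pair: "representable m M {x, y}" if a: "adj x y" for x y
  proof -
    obtain i where i: "i < m" "M i x \<noteq> M i y" and V: "x \<in> V" "y \<in> V" using a adj_iff by blast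
    obtain j j' where j: "j < m" "M j x" "j' < m" "M j' y" using row V by meson
    \<comment> \<open>Whichever of \<open>x\<close> and \<open>y\<close> has entry 1 in row
      \<open>i\<close> is listed first; the other gets its diagonal entry from a row of its
      own.\<close>
    show ?thesis
      using representable_pair[of i m j' M x y] representable_pair[of i m j M y x] i j
      by (cases "M i x") (simp_all add: insert_commute)
  qed
  have triple: "representable m M {x, y, z}" if t: "tri x y z" for x y z
  proof -
    obtain i k where i: "i < m" "M i x \<noteq> M i y" and V: "x \<in> V" "y \<in> V"
      and k: "k < m" "M k z" "\<not> M k x" "\<not> M k y" using t unfolding tri_iff adj_iff by blast
    obtain j j' where j: "j < m" "M j x" "j' < m" "M j' y" using row V by meson
    show ?thesis
      using representable_triple[of i m j' k M z x y] representable_triple[of i m j k M z y x] i j k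
      by (cases "M i x") (simp_all add: sym3)
  qed
  have "X \<in> vertex_faces \<union> edge_faces \<union> triangle_faces"
    if X: "X \<subseteq> V" "card X \<le> 3" "representable m M X" for X
  proof -
    have finX: "finite X" using X(1) fin by (rule finite_subset)
    obtain r c where rc: "X = c ` {..<card X}" "\<And>i. i < card X \<Longrightarrow> r i < m"
      "\<And>i. i < card X \<Longrightarrow> M (r i) (c i)" "\<And>i j. i < j \<Longrightarrow> j < card X \<Longrightarrow> \<not> M (r i) (c j)"
      by (rule representableE[OF X(3)]) (rule that)
    have cX: "c i \<in> V" if "i < card X" for i using rc(1) X(1) that by blast
    consider "card X = 0" | "card X = 1" | "card X = 2" | "card X = 3" using X(2) by linarith
    then show ?thesis
    proof cases
      case 1
      then have "X = {}" using finX by simp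
      then show ?thesis by (simp add: vertex_faces_def)
    next
      case 2
      then show ?thesis using X(1) by (auto simp: vertex_faces_def card_1_singleton_iff)
    next
      case 3
      then have "X = {c 0, c 1}" using rc(1) by (auto simp: numeral_2_eq_2 lessThan_Suc)
      moreover have "adj (c 0) (c 1)"
        unfolding adj_iff using cX[of 0] cX[of 1] rc(2)[of 0] rc(3)[of 0] rc(4)[of 0 1] 3 by auto
      ultimately show ?thesis unfolding edge_faces_def by blast
    next
      case 4
      then have "X = {c 1, c 2, c 0}" using rc(1) by (auto simp: numeral_3_eq_3 numeral_2_eq_2 lessThan_Suc)
      moreover have "adj (c 1) (c 2)"
        unfolding adj_iff using cX[of 1] cX[of 2] rc(2)[of 1] rc(3)[of 1] rc(4)[of 1 2] 4 by auto
      then have "tri (c 1) (c 2) (c 0)"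
        unfolding tri_iff using cX[of 0] rc(2)[of 0] rc(3)[of 0] rc(4)[of 0 1] rc(4)[of 0 2] 4 by auto
      ultimately show ?thesis unfolding triangle_faces_def by blast
    qed
  qed
  moreover have "X \<subseteq> V \<and> card X \<le> 3 \<and> representable m M X"
    if X: "X \<in> vertex_faces \<union> edge_faces \<union> triangle_faces" for X
  proof -
    consider "X = {}" | x where "x \<in> V" "X = {x}" | x y where "adj x y" "X = {x, y}"
      | x y z where "tri x y z" "X = {x, y, z}"
      using X unfolding vertex_faces_def edge_faces_def triangle_faces_def by blast
    then show ?thesis
    proof cases
      case 1
      then show ?thesis using empty by simp
    next
      case 2
      then show ?thesis using single by simp
    next
      case (3 x y)
      then show ?thesis using adj_V[of x y] pair[of x y] card_insert_le_m1[of 3 "{y}" x] by simp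
    next
      case (4 x y z)
      have "card {x, y, z} \<le> 3" by (simp add: card_insert_if)
      then show ?thesis using 4 triple[of x y z] adj_V[OF tri_adj(1)] adj_V[OF tri_adj(2)] by auto
    qed
  qed
  ultimately show ?thesis by blast
qed

text \<open>Dimension 2 provides a face with three vertices, so the truncation level is at least 3,
  and no face is larger. Hence the faces are all representable sets of size at most 3, whatever the
  level, and there is a triangle to start the construction.\<close>

lemma TBRSC_dim_2_built:
  assumes "TBRSC S" and dim: "complex_dim S = 2"
  shows "is_abs_complex S" and "built (faces S)" and "I \<in> faces S \<Longrightarrow> card I \<le> 3"
proof -
  obtain S' k where "BRSC S'" and k: "1 \<le> k" and S: "S = truncation k S'"
    using assms(1) unfolding TBRSC_def by blast
  then obtain m M where S': "is_abs_complex S'"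
    and F': "faces S' = {X. X \<subseteq> verts S' \<and> representable m M X}"
    unfolding BRSC_def representable_def by blast
  let ?V = "verts S'"
  have V: "finite ?V" "?V \<noteq> {}" and single: "\<And>v. v \<in> ?V \<Longrightarrow> {v} \<in> faces S'"
    and down: "\<And>I J. I \<in> faces S' \<Longrightarrow> J \<subseteq> I \<Longrightarrow> J \<in> faces S'"
    using S' unfolding is_abs_complex_def by blast+
  have vS: "verts S = ?V" and fS: "faces S = {X \<in> faces S'. X \<subseteq> ?V \<and> card X \<le> k}"
    unfolding S truncation_def by auto
  have "faces S \<subseteq> Pow ?V" unfolding fS by blast
  then have fin: "finite (faces S)" using V by (simp add: finite_subset)
  obtain v where v: "v \<in> ?V" using V(2) by blast
  then have "{v} \<in> faces S" unfolding fS using single k by simp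
  then have ne: "card ` faces S \<noteq> {}" by blast
  have Max: "Max (card ` faces S) = 3" using dim unfolding complex_dim_def by simp
  then have "3 \<in> card ` faces S" using Max_in[OF finite_imageI[OF fin] ne] by simp
  then obtain T where T: "T \<in> faces S" "card T = 3" by force
  show le3: "card I \<le> 3" if "I \<in> faces S" for I
    using Max_ge[OF finite_imageI[OF fin] imageI[OF that], of card] Max by simp
  have "3 \<le> k" using T unfolding fS by simp
  then have fS3: "faces S = {X. X \<subseteq> ?V \<and> card X \<le> 3 \<and> representable m M X}"
    using le3 unfolding fS F' by force
  show "is_abs_complex S"
    unfolding is_abs_complex_def vS
  proof (intro conjI ballI allI impI)
    show "{u} \<in> faces S" if "u \<in> ?V" for u unfolding fS using single[OF that] that k by simp
    show "J \<in> faces S" if I: "I \<in> faces S" and J: "J \<subseteq> I" for I J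
    proof -
      have "finite I" using I V(1) finite_subset unfolding fS by blast
      then have "card J \<le> card I" using J by (rule card_mono)
      then show ?thesis using I down[of I J] J unfolding fS by auto
    qed
  qed (use V \<open>faces S \<subseteq> Pow ?V\<close> in auto)
  interpret zero_sets ?V "row_zeros ?V m M" by (rule zero_sets_row_zeros[OF V(1)])
  have "{} \<in> faces S'" using down[OF single[OF v]] by blast
  then have faces: "faces S = vertex_faces \<union> edge_faces \<union> triangle_faces"
    unfolding fS3 using representable_small_faces[OF V(1)] single unfolding F' by blast
  have "T \<in> triangle_faces"
  proof -
    have "card X \<le> 2" if "X \<in> vertex_faces \<union> edge_faces" for X
      using that by (auto simp: vertex_faces_def edge_faces_def card_insert_if)
    then show ?thesis using T unfolding faces by force
  qed
  then obtain x y z where "tri x y z" unfolding triangle_faces_def by blast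
  then show "built (faces S)" unfolding faces by (rule built_complex)
qed

theorem theorem8p4:
  fixes S :: "'a abs_complex"
  assumes "TBRSC S" and "complex_dim S = 2"
  shows "(\<forall>r p. linear_order_on (verts S) r \<longrightarrow> is_free_abelian (simplicial_homology_group r S p)) \<and>
    (\<exists>(I :: nat set) d. finite I \<and> (\<forall>i\<in>I. d i \<in> {1, 2}) \<and>
       geometric_realization S homotopy_equivalent_space wedge_of_spheres I d)"
proof (intro conjI allI impI)
  note S = TBRSC_dim_2_built[OF assms]
  show "is_free_abelian (simplicial_homology_group r S p)" if "linear_order_on (verts S) r" for r p
    using S that by (rule built_homology_free)
  show "\<exists>(I :: nat set) d. finite I \<and> (\<forall>i\<in>I. d i \<in> {1, 2}) \<and>
       geometric_realization S homotopy_equivalent_space wedge_of_spheres I d"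
    using built_wedge_of_spheres[OF S(2)] S(1)
    by (simp add: geometric_realization_eq is_abs_complex_def)
qed

end
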